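(* Let $A$ be the adjacency matrix of the Chung-Lu random graph $\mathcal{G}_n(\vec d_n)$, where the degree sequences $\vec d_n$ satisfy, as $n\to\infty$: (D1) there exists $\xi>2$ such that $(\log n)^{2\xi}\ll m_\infty\ll n^{1/2}$; and (D2) $m_0\asymp m_\infty$. Let $\lambda_1$ be the largest eigenvalue of $A$. Then the following hold. (I) $$\mathbb{E}[\lambda_1]=\frac{m_2}{m_1}+\frac{m_1m_3}{m_2^2}+o(1),\qquad n\to\infty.$$ (II) $$\frac{m_2}{m_1}\left(\frac{\lambda_1-\mathbb{E}[\lambda_1]}{\sigma_1}\right)\longrightarrow \mathcal{N}(0,2)\quad\text{in distribution as } n\to\infty,$$ where $$\sigma_1^2=\sum_{i,j=1}^n (p_{ij})^3(1-p_{ij})\sim\frac{m_3^2}{m_1^3},\qquad n\to\infty.$$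
   Context: For each $n$, $\vec d_n=(d_i)_{i\in[n]}$ is a sequence of positive integers (depending on $n$; the dependence on $n$ is suppressed in all quantities), $[n]=\{1,\dots,n\}$. Put $m_k=\sum_{i\in[n]}d_i^k$ for $k=1,2,3,\ldots$, $m_\infty=\max_{i\in[n]}d_i$ and $m_0=\min_{i\in[n]}d_i$ (so $m_0$ denotes the minimum, not the sum of zeroth powers). The Chung-Lu random graph $\mathcal{G}_n(\vec d_n)$ has vertex set $[n]$; for each unordered pair of vertices $i,j$ (not necessarily distinct, so self-loops are allowed) an edge is present independently with probability $p_{ij}=d_id_j/m_1$. Its adjacency matrix $A$ is thus the symmetric $n\times n$ matrix whose entries $A(i,j)$, $i\le j$, are independent Bernoulli random variables with parameters $p_{ij}$. Under (D1)-(D2), $p_{ij}\le 1$ for all $i,j$ once $n$ is large, so the model is well defined for all large $n$. Notation as $n\to\infty$: $a_n\ll b_n$ means $a_n/b_n\to0$; $a_n\asymp b_n$ means that $a_n/b_n$ is bounded above and bounded away from zero; $a_n\sim b_n$ means $a_n/b_n\to1$. $\mathcal{N}(0,s)$ is the centered Gaussian law with variance $s$. *)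

theory Defs
  imports
    "HOL-Probability.Probability"
    "HOL-Library.Landau_Symbols"
    "Jordan_Normal_Form.Spectral_Radius"
begin

text \<open>Vertices are numbered \<open>0, \<dots>, n - 1\<close>, matching the indexing of \<^typ>\<open>'a mat\<close>, and a
  degree sequence of length \<open>n\<close> is a function of which only the values on \<open>{..<n}\<close> matter.\<close>

definition deg_sum :: "nat \<Rightarrow> nat \<Rightarrow> (nat \<Rightarrow> nat) \<Rightarrow> real" where
  "deg_sum k n d = (\<Sum>i<n. real (d i) ^ k)"

definition deg_max :: "nat \<Rightarrow> (nat \<Rightarrow> nat) \<Rightarrow> real" where
  "deg_max n d = real (Max (d ` {..<n}))"

definition deg_min :: "nat \<Rightarrow> (nat \<Rightarrow> nat) \<Rightarrow> real" where
  "deg_min n d = real (Min (d ` {..<n}))"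

definition edge_prob :: "nat \<Rightarrow> (nat \<Rightarrow> nat) \<Rightarrow> nat \<Rightarrow> nat \<Rightarrow> real" where
  "edge_prob n d i j = real (d i) * real (d j) / deg_sum 1 n d"

text \<open>A graph with loops is given by the indicator of its edge set, where the unordered pair
  of the vertices \<open>i \<le> j\<close> is encoded as \<open>(i, j)\<close>. Since \<^const>\<open>bernoulli_pmf\<close> truncates its
  parameter to the unit interval, this is a probability law for every \<open>d\<close>; it is the
  Chung-Lu law whenever all edge probabilities are at most 1.\<close>

definition chung_lu :: "nat \<Rightarrow> (nat \<Rightarrow> nat) \<Rightarrow> (nat \<times> nat \<Rightarrow> bool) pmf" where
  "chung_lu n d =
     Pi_pmf {(i, j). i \<le> j \<and> j < n} False (\<lambda>(i, j). bernoulli_pmf (edge_prob n d i j))"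

definition adj_mat :: "nat \<Rightarrow> (nat \<times> nat \<Rightarrow> bool) \<Rightarrow> real mat" where
  "adj_mat n E = mat n n (\<lambda>(i, j). of_bool (E (min i j, max i j)))"

text \<open>Only used for real symmetric matrices of positive dimension, whose set of real
  eigenvalues is finite and nonempty.\<close>

definition largest_eigenvalue :: "real mat \<Rightarrow> real" where
  "largest_eigenvalue A = Max (spectrum A)"

definition lambda1 :: "nat \<Rightarrow> (nat \<times> nat \<Rightarrow> bool) \<Rightarrow> real" where
  "lambda1 n E = largest_eigenvalue (adj_mat n E)"

definition expected_lambda1 :: "nat \<Rightarrow> (nat \<Rightarrow> nat) \<Rightarrow> real" where
  "expected_lambda1 n d = measure_pmf.expectation (chung_lu n d) (lambda1 n)"

definition sigma1 :: "nat \<Rightarrow> (nat \<Rightarrow> nat) \<Rightarrow> real" where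
  "sigma1 n d = sqrt (\<Sum>i<n. \<Sum>j<n. edge_prob n d i j ^ 3 * (1 - edge_prob n d i j))"

text \<open>The centered Gaussian law with variance \<open>s\<close>; the second parameter of
  \<^const>\<open>normal_density\<close> is the standard deviation.\<close>

definition centered_normal :: "real \<Rightarrow> real measure" where
  "centered_normal s = density lborel (\<lambda>x. ennreal (normal_density 0 (sqrt s) x))"

end

theory Submission
  imports Defs
begin

text \<open>With \<open>u = d / |d|\<close> and \<open>\<theta> = m_2 / m_1\<close> the mean of \<open>A\<close> is \<open>\<theta> u u\<^sup>T\<close>; write \<open>H\<close> for the
  centred matrix. A crude count of the walks in the moments of \<open>H\<close> shows that \<open>|H| / \<theta>\<close> tends to
  zero outside an event of probability at most \<open>1 / n^4\<close>, because \<open>m_\<infinity>\<close> dominates \<open>ln n\<close>.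
  Test vectors then give \<open>\<lambda>_1 = \<theta> + u \<bullet> H u + |H u|\<^sup>2 / \<theta>\<close> up to \<open>o(1)\<close>, whose mean is part (I).

  For part (II) the fluctuation of \<open>\<lambda>_1\<close> around its linear part \<open>u \<bullet> A u\<close> is bounded by the
  Efron--Stein inequality: flipping the entry \<open>(i, j)\<close> changes \<open>\<lambda>_1 - u \<bullet> A u\<close> by at most twice
  \<open>|v_i v_j - u_i u_j|\<close> for the top eigenvector \<open>v\<close> before or after the flip, so the variance is
  controlled by the sum of the fourth powers of the entries of \<open>v - u\<close>. Expanding \<open>v\<close> into the
  vectors \<open>H^k u\<close> and using the same walk count with four walks shows that this sum is \<open>o(1 / n)\<close>.
  What remains is the linear form \<open>u \<bullet> H u\<close> in independent variables, for which characteristic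
  functions suffice.\<close>

section \<open>Product Bernoulli measures\<close>

text \<open>The statistic of part (II) multiplies by \<open>\<theta> / \<sigma>\<close>, whose
  square is of order n/m with m the maximal degree, so the variance of the nonlinear part has to be
  o(m/n). The norm of H alone cannot give this: it makes |v - u|^2 of order 1/m up to logarithms,
  hence bounds the sum of fourth powers by about 1/m^2, far above 1/n as m is small against n^(1/2).
  The missing gain is delocalisation: the entries of u are of order n^(-1/2), and the moments of the
  entries of H^k u inherit this. The walk count loses a logarithm, bounding |H|^2 by order m ln n
  instead of m. This is harmless, since only |H| \<le> \<open>\<epsilon> * \<theta>\<close> for a
  fixed \<open>\<epsilon>\<close> is used and \<open>\<theta>\<close> is of order m. The parameter
  \<open>\<epsilon>\<close> stays fixed while n grows and tends to 0 only at the end. Powers are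
  taken up to an exponent between ln n and 2 ln n: long enough that a geometric factor beats both
  the n^2 matrix entries and the truncation error of the eigenvector series, short enough to be
  small against m. On the exceptional event bounds of order n^2 are used, which 1/n^4
  outweighs.\<close>

abbreviation bern_prod :: "'a set \<Rightarrow> ('a \<Rightarrow> real) \<Rightarrow> ('a \<Rightarrow> bool) pmf" where
  "bern_prod S p \<equiv> Pi_pmf S False (\<lambda>e. bernoulli_pmf (p e))"

abbreviation bern_exp :: "'a set \<Rightarrow> ('a \<Rightarrow> real) \<Rightarrow> (('a \<Rightarrow> bool) \<Rightarrow> 'b) \<Rightarrow> 'b::{banach, second_countable_topology}" where
  "bern_exp S p \<equiv> measure_pmf.expectation (bern_prod S p)"

lemma finite_set_bern_prod: "finite S \<Longrightarrow> finite (set_pmf (bern_prod S p))"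
  by (rule finite_subset[OF set_Pi_pmf_subset']) (auto intro!: finite_PiE_dflt)

lemma integrable_bern_prod [simp]:
  fixes f :: "_ \<Rightarrow> 'b::{banach, second_countable_topology}"
  shows "finite S \<Longrightarrow> integrable (measure_pmf (bern_prod S p)) f"
  by (rule integrable_measure_pmf_finite[OF finite_set_bern_prod])

lemma expectation_bern_prod_insert:
  fixes f :: "_ \<Rightarrow> 'b::{banach, second_countable_topology, real_normed_field}"
  assumes "finite S" "e \<notin> S" "0 \<le> p e" "p e \<le> 1"
  shows "bern_exp (insert e S) p f =
    of_real (p e) * bern_exp S p (\<lambda>\<eta>. f (\<eta>(e := True)))
    + of_real (1 - p e) * bern_exp S p (\<lambda>\<eta>. f (\<eta>(e := False)))"
proof -
  have fin: "finite (set_pmf (bern_prod S p))"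
    using assms by (intro finite_set_bern_prod)
  have "bern_exp (insert e S) p f =
      measure_pmf.expectation (bernoulli_pmf (p e) \<bind>
        (\<lambda>y. map_pmf (\<lambda>\<eta>. \<eta>(e := y)) (bern_prod S p))) f"
    using assms by (simp add: Pi_pmf_insert' map_pmf_def)
  also have "\<dots> = (\<Sum>a\<in>UNIV. pmf (bernoulli_pmf (p e)) a *\<^sub>R
      measure_pmf.expectation (map_pmf (\<lambda>\<eta>. \<eta>(e := a)) (bern_prod S p)) f)"
    by (rule pmf_expectation_bind) (use fin in auto)
  finally show ?thesis
    using assms by (simp add: UNIV_bool scaleR_conv_of_real)
qed

text \<open>Independence. The codomain is a general normed field because the factors are powers of
  centred entries in the moment bounds and complex exponentials in the characteristic
  functions.\<close>

lemma expectation_prod_bern_prod: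
  fixes g :: "'a \<Rightarrow> bool \<Rightarrow> 'b::{banach, second_countable_topology, real_normed_field}"
  assumes "finite S" "\<And>e. e \<in> S \<Longrightarrow> 0 \<le> p e \<and> p e \<le> 1"
  shows "bern_exp S p (\<lambda>\<eta>. \<Prod>e\<in>S. g e (\<eta> e)) =
    (\<Prod>e\<in>S. of_real (p e) * g e True + of_real (1 - p e) * g e False)"
  using assms
proof (induction S rule: finite_induct)
  case (insert e S)
  have *: "(\<Prod>x\<in>S. g x ((\<eta>(e := b)) x)) = (\<Prod>x\<in>S. g x (\<eta> x))" for \<eta> b
    using insert.hyps by (intro prod.cong) auto
  have "bern_exp (insert e S) p
        (\<lambda>\<eta>. g e (\<eta> e) * (\<Prod>x\<in>S. g x (\<eta> x))) =
      (of_real (p e) * g e True + of_real (1 - p e) * g e False)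
        * bern_exp S p (\<lambda>\<eta>. \<Prod>x\<in>S. g x (\<eta> x))"
    using insert.hyps insert.prems
    by (subst expectation_bern_prod_insert)
       (auto simp: * fun_upd_same distrib_right mult.assoc simp del: fun_upd_apply)
  then show ?case
    using insert by simp
qed auto

text \<open>The weights arise because resampling the coordinate \<open>e\<close> changes it with probability
  \<open>2 * p e * (1 - p e)\<close>.\<close>

lemma bern_prod_Efron_Stein:
  fixes f :: "('a \<Rightarrow> bool) \<Rightarrow> real"
  assumes "finite S" "\<And>e. e \<in> S \<Longrightarrow> 0 \<le> p e \<and> p e \<le> 1"
  shows "bern_exp S p (\<lambda>\<eta>. (f \<eta>)\<^sup>2)
      - (bern_exp S p f)\<^sup>2
    \<le> (\<Sum>e\<in>S. p e * (1 - p e) * bern_exp S p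
          (\<lambda>\<eta>. (f (\<eta>(e := True)) - f (\<eta>(e := False)))\<^sup>2))"
  using assms
proof (induction S arbitrary: f rule: finite_induct)
  case (insert e S)
  let ?E = "bern_exp S p"
  let ?E' = "bern_exp (insert e S) p"
  let ?p = "p e"
  define f1 f0 where "f1 = (\<lambda>\<eta>. f (\<eta>(e := True)))" and "f0 = (\<lambda>\<eta>. f (\<eta>(e := False)))"
  \<comment> \<open>\<open>g\<close> is the conditional expectation of \<open>f\<close> given the
    other coordinates. The variance of \<open>f\<close> is that of \<open>g\<close> plus the mean
    conditional variance over \<open>e\<close>, and the latter is exactly the summand belonging to
    \<open>e\<close>.\<close>
  define g where "g = (\<lambda>\<eta>. ?p * f1 \<eta> + (1 - ?p) * f0 \<eta>)"
  have p: "0 \<le> ?p" "?p \<le> 1" using insert by auto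
  note I = integrable_bern_prod[OF insert.hyps(1)]
  have split: "?E' h = ?p * ?E (\<lambda>\<eta>. h (\<eta>(e := True))) + (1 - ?p) * ?E (\<lambda>\<eta>. h (\<eta>(e := False)))"
    for h :: "_ \<Rightarrow> real"
    using expectation_bern_prod_insert[of S e p h] insert.hyps p by simp
  have Ef: "?E' f = ?E g"
    by (simp add: split g_def f1_def f0_def I)
  have Ef2: "?E' (\<lambda>\<eta>. (f \<eta>)\<^sup>2) = ?E (\<lambda>\<eta>. (g \<eta>)\<^sup>2) + ?p * (1 - ?p) * ?E (\<lambda>\<eta>. (f1 \<eta> - f0 \<eta>)\<^sup>2)"
  proof -
    have "?E' (\<lambda>\<eta>. (f \<eta>)\<^sup>2) = ?E (\<lambda>\<eta>. ?p * (f1 \<eta>)\<^sup>2 + (1 - ?p) * (f0 \<eta>)\<^sup>2)"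
      by (simp add: split f1_def f0_def I)
    also have "\<dots> = ?E (\<lambda>\<eta>. (g \<eta>)\<^sup>2 + ?p * (1 - ?p) * (f1 \<eta> - f0 \<eta>)\<^sup>2)"
      by (intro Bochner_Integration.integral_cong refl)
         (simp add: g_def power2_eq_square algebra_simps)
    finally show ?thesis by (simp add: I)
  qed
  have last: "?E' (\<lambda>\<eta>. (f (\<eta>(e := True)) - f (\<eta>(e := False)))\<^sup>2) = ?E (\<lambda>\<eta>. (f1 \<eta> - f0 \<eta>)\<^sup>2)"
    by (simp add: split f1_def f0_def algebra_simps)
  have step: "?E (\<lambda>\<eta>. (g (\<eta>(x := True)) - g (\<eta>(x := False)))\<^sup>2)
      \<le> ?E' (\<lambda>\<eta>. (f (\<eta>(x := True)) - f (\<eta>(x := False)))\<^sup>2)" if "x \<in> S" for x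
  proof -
    have x: "x \<noteq> e" using that insert.hyps by auto
    \<comment> \<open>Convexity of the square: averaging over \<open>e\<close> does not increase the
      squared increments in another coordinate \<open>x\<close>.\<close>
    have conv: "(?p * a + (1 - ?p) * b)\<^sup>2 \<le> ?p * a\<^sup>2 + (1 - ?p) * b\<^sup>2" for a b :: real
    proof -
      have "?p * a\<^sup>2 + (1 - ?p) * b\<^sup>2 - (?p * a + (1 - ?p) * b)\<^sup>2 = ?p * (1 - ?p) * (a - b)\<^sup>2"
        by (simp add: power2_eq_square algebra_simps)
      also have "\<dots> \<ge> 0" using p by simp
      finally show ?thesis by simp
    qed
    have "?E (\<lambda>\<eta>. (g (\<eta>(x := True)) - g (\<eta>(x := False)))\<^sup>2)
      \<le> ?E (\<lambda>\<eta>. ?p * (f1 (\<eta>(x := True)) - f1 (\<eta>(x := False)))\<^sup>2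
            + (1 - ?p) * (f0 (\<eta>(x := True)) - f0 (\<eta>(x := False)))\<^sup>2)"
      using conv[of "f1 (_(x := True)) - f1 (_(x := False))" "f0 (_(x := True)) - f0 (_(x := False))"]
      by (intro integral_mono I) (simp add: g_def algebra_simps)
    also have "\<dots> = ?E' (\<lambda>\<eta>. (f (\<eta>(x := True)) - f (\<eta>(x := False)))\<^sup>2)"
      using x by (simp add: split f1_def f0_def I fun_upd_twist)
    finally show ?thesis .
  qed
  have "?E' (\<lambda>\<eta>. (f \<eta>)\<^sup>2) - (?E' f)\<^sup>2
      = (?E (\<lambda>\<eta>. (g \<eta>)\<^sup>2) - (?E g)\<^sup>2) + ?p * (1 - ?p) * ?E (\<lambda>\<eta>. (f1 \<eta> - f0 \<eta>)\<^sup>2)"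
    by (simp add: Ef Ef2)
  also have "\<dots> \<le> (\<Sum>x\<in>S. p x * (1 - p x) * ?E (\<lambda>\<eta>. (g (\<eta>(x := True)) - g (\<eta>(x := False)))\<^sup>2))
      + ?p * (1 - ?p) * ?E (\<lambda>\<eta>. (f1 \<eta> - f0 \<eta>)\<^sup>2)"
    by (intro add_right_mono insert.IH) (use insert.prems in auto)
  also have "\<dots> \<le> (\<Sum>x\<in>S. p x * (1 - p x) * ?E' (\<lambda>\<eta>. (f (\<eta>(x := True)) - f (\<eta>(x := False)))\<^sup>2))
      + ?p * (1 - ?p) * ?E (\<lambda>\<eta>. (f1 \<eta> - f0 \<eta>)\<^sup>2)"
    by (intro add_right_mono sum_mono mult_left_mono step) (use insert.prems in auto)
  finally show ?case
    unfolding sum.insert[OF insert.hyps(1,2)] last by linarith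
qed auto

section \<open>The largest eigenvalue of a real symmetric matrix\<close>

text \<open>Vectors are functions read only below \<open>n\<close>, so linearity needs no dimension
  side conditions; the type \<open>real mat\<close> occurs only to reach
  \<open>largest_eigenvalue\<close>.\<close>

definition dot :: "nat \<Rightarrow> (nat \<Rightarrow> real) \<Rightarrow> (nat \<Rightarrow> real) \<Rightarrow> real" where
  "dot n x y = (\<Sum>i<n. x i * y i)"

definition mat_vec :: "nat \<Rightarrow> (nat \<Rightarrow> nat \<Rightarrow> real) \<Rightarrow> (nat \<Rightarrow> real) \<Rightarrow> nat \<Rightarrow> real" where
  "mat_vec n a x i = (\<Sum>j<n. a i j * x j)"

lemma dot_commute: "dot n x y = dot n y x"
  by (simp add: dot_def mult.commute)

lemma dot_self_nonneg [simp]: "0 \<le> dot n x x"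
  by (simp add: dot_def sum_nonneg)

lemma dot_cong: "(\<And>i. i < n \<Longrightarrow> x i = x' i) \<Longrightarrow> (\<And>i. i < n \<Longrightarrow> y i = y' i) \<Longrightarrow> dot n x y = dot n x' y'"
  by (simp add: dot_def)

lemma dot_self_eq_0D: "dot n x x = 0 \<Longrightarrow> i < n \<Longrightarrow> x i = 0"
  by (simp add: dot_def sum_nonneg_eq_0_iff)

lemma dot_add_left: "dot n (\<lambda>i. x i + y i) z = dot n x z + dot n y z"
  and dot_add_right: "dot n z (\<lambda>i. x i + y i) = dot n z x + dot n z y"
  and dot_diff_left: "dot n (\<lambda>i. x i - y i) z = dot n x z - dot n y z"
  and dot_diff_right: "dot n z (\<lambda>i. x i - y i) = dot n z x - dot n z y"
  and dot_scale_left: "dot n (\<lambda>i. c * x i) z = c * dot n x z"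
  and dot_scale_right: "dot n z (\<lambda>i. c * x i) = c * dot n z x"
  by (simp_all add: dot_def sum.distrib sum_subtractf sum_distrib_left algebra_simps)

lemmas dot_linear = dot_add_left dot_add_right dot_diff_left dot_diff_right
  dot_scale_left dot_scale_right

lemma dot_Cauchy_Schwarz: "(dot n x y)\<^sup>2 \<le> dot n x x * dot n y y"
  using Cauchy_Schwarz_ineq_sum[of x y "{..<n}"] by (simp add: dot_def power2_eq_square)

lemma abs_dot_le: "\<bar>dot n x y\<bar> \<le> sqrt (dot n x x) * sqrt (dot n y y)"
  using real_sqrt_le_mono[OF dot_Cauchy_Schwarz[of n x y]] by (simp add: real_sqrt_mult)

lemma mat_vec_add: "mat_vec n a (\<lambda>i. x i + y i) = (\<lambda>i. mat_vec n a x i + mat_vec n a y i)"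
  and mat_vec_diff: "mat_vec n a (\<lambda>i. x i - y i) = (\<lambda>i. mat_vec n a x i - mat_vec n a y i)"
  and mat_vec_scale: "mat_vec n a (\<lambda>i. c * x i) = (\<lambda>i. c * mat_vec n a x i)"
  by (simp_all add: mat_vec_def fun_eq_iff sum.distrib sum_subtractf sum_distrib_left algebra_simps)

lemmas mat_vec_linear = mat_vec_add mat_vec_diff mat_vec_scale

lemma mat_vec_cong: "(\<And>i. i < n \<Longrightarrow> x i = y i) \<Longrightarrow> mat_vec n a x = mat_vec n a y"
  by (auto simp: mat_vec_def fun_eq_iff)

lemma mat_vec_sym:
  assumes "\<And>i j. a i j = a j i"
  shows "dot n x (mat_vec n a y) = dot n (mat_vec n a x) y"
proof -
  have "dot n x (mat_vec n a y) = (\<Sum>i<n. \<Sum>j<n. x i * (a i j * y j))"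
    by (simp add: dot_def mat_vec_def sum_distrib_left)
  also have "\<dots> = (\<Sum>j<n. \<Sum>i<n. x i * (a i j * y j))"
    by (rule sum.swap)
  also have "\<dots> = (\<Sum>j<n. \<Sum>i<n. a j i * x i * y j)"
    by (intro sum.cong refl) (subst assms, simp)
  also have "\<dots> = dot n (mat_vec n a x) y"
    by (simp add: dot_def mat_vec_def sum_distrib_right)
  finally show ?thesis .
qed

lemma mat_vec_pow_sym:
  assumes "\<And>i j. a i j = a j i"
  shows "dot n x ((mat_vec n a ^^ k) y) = dot n ((mat_vec n a ^^ k) x) y"
proof (induction k arbitrary: x)
  case (Suc k)
  have "dot n x ((mat_vec n a ^^ Suc k) y) = dot n (mat_vec n a x) ((mat_vec n a ^^ k) y)"
    by (simp add: mat_vec_sym[OF assms])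
  also have "\<dots> = dot n ((mat_vec n a ^^ Suc k) x) y"
    by (simp only: Suc.IH funpow_Suc_right o_apply)
  finally show ?case .
qed simp

lemma Rayleigh_quotient_attains_max:
  assumes "n > 0"
  obtains v where "dot n v v = 1" "\<And>x. dot n x (mat_vec n a x) \<le> dot n v (mat_vec n a v) * dot n x x"
proof -
  \<comment> \<open>Freezing the coordinates from \<open>n\<close> on at 0 and confining the others
    to [-1, 1], which the unit norm implies anyway, makes the sphere a closed subset of a product of
    compact sets.\<close>
  define S where "S = {x. (\<forall>i. x i \<in> (if i < n then {-1..1::real} else {0})) \<and> dot n x x = 1}"
  define B where "B = PiE UNIV (\<lambda>i. if i < n then {-1..1::real} else {0})"
  have "compactin (product_topology (\<lambda>i::nat. euclidean) UNIV) B"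
    unfolding B_def by (subst compactin_PiE) auto
  then have "compact B"
    by (simp add: euclidean_product_topology)
  have cont: "continuous_on UNIV (\<lambda>x. x i)" for i :: nat
    by (rule continuous_on_product_coordinates)
  have contdot: "continuous_on UNIV (\<lambda>x. dot n x x)"
    unfolding dot_def by (intro continuous_intros cont)
  have "closed {x. dot n x x = 1}"
    using continuous_closed_preimage_constant[OF contdot closed_UNIV, of 1] by simp
  then have "compact (B \<inter> {x. dot n x x = 1})"
    using \<open>compact B\<close> by (intro compact_Int_closed)
  also have "B \<inter> {x. dot n x x = 1} = S"
    by (auto simp: B_def S_def PiE_def Pi_def extensional_def)
  finally have "compact S" .
  moreover have "(\<lambda>i. if i = 0 then 1 else 0) \<in> S"
    using assms by (auto simp: S_def dot_def if_distrib cong: if_cong)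
  then have "S \<noteq> {}" by auto
  moreover have "continuous_on S (\<lambda>x. dot n x (mat_vec n a x))"
    unfolding dot_def mat_vec_def
    by (intro continuous_intros continuous_on_subset[OF cont]) auto
  ultimately obtain v where v: "v \<in> S"
      "\<And>x. x \<in> S \<Longrightarrow> dot n x (mat_vec n a x) \<le> dot n v (mat_vec n a v)"
    using continuous_attains_sup[of S "\<lambda>x. dot n x (mat_vec n a x)"] by auto
  have "dot n x (mat_vec n a x) \<le> dot n v (mat_vec n a v) * dot n x x" for x
  proof (cases "dot n x x = 0")
    case True
    then have "dot n x (mat_vec n a x) = 0"
      by (simp add: dot_def[of n x "mat_vec n a x"] dot_self_eq_0D)
    with True show ?thesis by simp
  next
    case False
    define c where "c = 1 / sqrt (dot n x x)"
    have pos: "dot n x x > 0"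
      using False dot_self_nonneg[of n x] by linarith
    have c2: "c * c * dot n x x = 1"
      using pos by (simp add: c_def field_simps)
    define y where "y = (\<lambda>i. if i < n then c * x i else 0)"
    have yx: "dot n y y = c * c * dot n x x"
      "dot n y (mat_vec n a y) = c * c * dot n x (mat_vec n a x)"
      by (auto simp: y_def dot_def mat_vec_def sum_distrib_left mult_ac intro!: sum.cong)
    have "\<bar>y i\<bar> \<le> 1" if "i < n" for i
    proof -
      have "(y i)\<^sup>2 \<le> dot n y y"
        unfolding dot_def power2_eq_square using that
        by (intro member_le_sum) auto
      then show ?thesis
        using yx c2 by (simp add: abs_square_le_1)
    qed
    then have "y \<in> S"
      using yx c2 by (auto simp: S_def abs_le_iff y_def split: if_splits)
    from v(2)[OF this] have "c * c * dot n x (mat_vec n a x) * dot n x x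
        \<le> dot n v (mat_vec n a v) * dot n x x"
      using yx pos by (intro mult_right_mono) auto
    also have "c * c * dot n x (mat_vec n a x) * dot n x x = (c * c * dot n x x) * dot n x (mat_vec n a x)"
      by (simp only: mult_ac)
    finally show ?thesis unfolding c2 by simp
  qed
  with v that show ?thesis by (auto simp: S_def)
qed

text \<open>First variation along the \<open>i\<close>-th unit vector \<open>e\<close>: with
  \<open>c\<close> the \<open>i\<close>-th component of the residual, maximality tested at
  \<open>v + t * e\<close> gives \<open>2 * t * c \<le> t\<^sup>2 * K\<close> for all
  \<open>t\<close>, and a small \<open>t\<close> with the sign of \<open>c\<close> forces
  \<open>c = 0\<close>.\<close>

lemma maximizer_is_eigenvector:
  assumes sym: "\<And>i j. a i j = a j i"
    and v: "dot n v v = 1" "\<And>x. dot n x (mat_vec n a x) \<le> \<mu> * dot n x x"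
      "dot n v (mat_vec n a v) = \<mu>"
    and "i < n"
  shows "mat_vec n a v i = \<mu> * v i"
proof (rule ccontr)
  define e where "e = (\<lambda>j. if j = i then 1 else 0 :: real)"
  define c where "c = mat_vec n a v i - \<mu> * v i"
  define K where "K = \<mu> - dot n e (mat_vec n a e)"
  assume "\<not> ?thesis"
  then have "c \<noteq> 0" by (simp add: c_def)
  have e: "dot n e y = y i" for y
    using \<open>i < n\<close> by (simp add: e_def dot_def if_distrib if_distribR cong: if_cong)
  have quad: "2 * t * c \<le> t\<^sup>2 * K" for t
  proof -
    have vAe: "dot n v (mat_vec n a e) = mat_vec n a v i"
      using mat_vec_sym[of a n v e] sym dot_commute[of n "mat_vec n a v" e] e by simp
    have ve: "dot n v e = v i" and ei: "e i = 1"
      using dot_commute[of n v e] e by (simp_all add: e_def)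
    then have "2 * t * c - t\<^sup>2 * K = dot n (\<lambda>j. v j + t * e j) (mat_vec n a (\<lambda>j. v j + t * e j))
        - \<mu> * dot n (\<lambda>j. v j + t * e j) (\<lambda>j. v j + t * e j)"
      using v(1,3) by (simp add: dot_linear mat_vec_linear e vAe ve ei c_def K_def power2_eq_square algebra_simps)
    also have "\<dots> \<le> 0" using v(2) by simp
    finally show ?thesis by simp
  qed
  \<comment> \<open>Small enough that \<open>s * K < 2\<close> whatever the sign of
    \<open>K\<close>, so that \<open>t = s * c\<close> contradicts \<open>quad\<close>.\<close>
  define s where "s = 1 / (\<bar>K\<bar> + 1)"
  have s: "s > 0" "s * K < 2" by (auto simp: s_def field_simps abs_if)
  have "2 * s * c\<^sup>2 \<le> s * (s * K) * c\<^sup>2"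
    using quad[of "s * c"] by (simp add: power2_eq_square mult_ac)
  then have "2 * (s * c\<^sup>2) \<le> (s * K) * (s * c\<^sup>2)" by (simp add: mult_ac)
  then have "2 \<le> s * K"
    using s \<open>c \<noteq> 0\<close> by (subst (asm) mult_le_cancel_right_pos) auto
  with s show False by simp
qed

text \<open>Ties the maximum over the spectrum to the Rayleigh quotient: the maximum of the quotient
  is an eigenvalue, and every eigenvalue is the quotient at one of its eigenvectors. Later arguments
  use only the eigenvector and the inequality obtained here.\<close>

theorem largest_eigenvalue_variational:
  fixes a :: "nat \<Rightarrow> nat \<Rightarrow> real"
  assumes "n > 0" and sym: "\<And>i j. a i j = a j i"
  obtains v where "dot n v v = 1"
    "\<And>i. i < n \<Longrightarrow> mat_vec n a v i = largest_eigenvalue (mat n n (\<lambda>(i, j). a i j)) * v i"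
    "\<And>x. dot n x (mat_vec n a x) \<le> largest_eigenvalue (mat n n (\<lambda>(i, j). a i j)) * dot n x x"
proof -
  let ?A = "mat n n (\<lambda>(i, j). a i j)"
  obtain v where v: "dot n v v = 1"
      "\<And>x. dot n x (mat_vec n a x) \<le> dot n v (mat_vec n a v) * dot n x x"
    using Rayleigh_quotient_attains_max[OF \<open>n > 0\<close>] by blast
  define \<mu> where "\<mu> = dot n v (mat_vec n a v)"
  have ev: "mat_vec n a v i = \<mu> * v i" if "i < n" for i
    by (rule maximizer_is_eigenvector[OF sym v(1) v(2)[folded \<mu>_def] _ that]) (simp add: \<mu>_def)
  have Av: "?A *\<^sub>v vec n x = vec n (mat_vec n a x)" for x
    by (auto simp: mat_vec_def scalar_prod_def lessThan_atLeast0 intro!: eq_vecI sum.cong)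
  have "vec n v \<noteq> 0\<^sub>v n"
  proof
    assume *: "vec n v = 0\<^sub>v n"
    have "v i = 0" if "i < n" for i
      using arg_cong[OF *, of "\<lambda>x. x $ i"] that by simp
    then have "dot n v v = 0" by (simp add: dot_def)
    with v(1) show False by simp
  qed
  moreover have "?A *\<^sub>v vec n v = \<mu> \<cdot>\<^sub>v vec n v"
    unfolding Av by (rule eq_vecI) (auto simp: ev)
  ultimately have "\<mu> \<in> spectrum ?A"
    by (auto simp: spectrum_def eigenvalue_def eigenvector_def intro!: exI[of _ "vec n v"])
  moreover have "\<nu> \<le> \<mu>" if "\<nu> \<in> spectrum ?A" for \<nu>
  proof -
    obtain w where w: "w \<in> carrier_vec n" "w \<noteq> 0\<^sub>v n" "?A *\<^sub>v w = \<nu> \<cdot>\<^sub>v w"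
      using \<open>\<nu> \<in> spectrum ?A\<close> by (auto simp: spectrum_def eigenvalue_def eigenvector_def)
    define x where "x = (\<lambda>i. w $ i)"
    have wx: "w = vec n x" using w(1) by (auto simp: x_def intro!: eq_vecI)
    have "mat_vec n a x i = \<nu> * x i" if "i < n" for i
      using arg_cong[OF w(3), of "\<lambda>y. y $ i"] that unfolding wx Av by simp
    then have "dot n x (mat_vec n a x) = dot n x (\<lambda>i. \<nu> * x i)"
      by (intro dot_cong) auto
    then have le: "\<nu> * dot n x x \<le> \<mu> * dot n x x"
      using v(2)[of x] by (simp add: \<mu>_def dot_scale_right)
    have "dot n x x \<noteq> 0"
    proof
      assume "dot n x x = 0"
      then have "w = 0\<^sub>v n" unfolding wx by (auto intro!: eq_vecI dest: dot_self_eq_0D)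
      with w(2) show False by simp
    qed
    then have "dot n x x > 0" using dot_self_nonneg[of n x] by linarith
    with le show ?thesis by simp
  qed
  moreover have "finite (spectrum ?A)"
    using card_finite_spectrum(1)[of ?A n] by simp
  ultimately have "largest_eigenvalue ?A = \<mu>"
    unfolding largest_eigenvalue_def by (intro Max_eqI) auto
  with that[of v] v ev show ?thesis by (simp add: \<mu>_def)
qed

section \<open>Operator norm bounds from the entries of matrix powers\<close>

definition op_bound :: "nat \<Rightarrow> (nat \<Rightarrow> nat \<Rightarrow> real) \<Rightarrow> real \<Rightarrow> bool" where
  "op_bound n a r \<longleftrightarrow> (\<forall>x. dot n (mat_vec n a x) (mat_vec n a x) \<le> r\<^sup>2 * dot n x x)"

definition unit_vec_fun :: "nat \<Rightarrow> nat \<Rightarrow> real" where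
  "unit_vec_fun j i = of_bool (i = j)"

text \<open>The squared Frobenius norm of the \<open>k\<close>-th power; for symmetric
  \<open>a\<close> this is the trace of the power \<open>2 * k\<close>, as in the moment method. It
  is kept as a sum of squared entries because each of them is a walk sum with
  \<open>r = 2\<close>.\<close>

definition frob_pow :: "nat \<Rightarrow> (nat \<Rightarrow> nat \<Rightarrow> real) \<Rightarrow> nat \<Rightarrow> real" where
  "frob_pow n a k = (\<Sum>i<n. \<Sum>j<n. ((mat_vec n a ^^ k) (unit_vec_fun j) i)\<^sup>2)"

lemma mat_vec_pow_expand:
  "i < n \<Longrightarrow> (mat_vec n a ^^ k) x i = (\<Sum>j<n. (mat_vec n a ^^ k) (unit_vec_fun j) i * x j)"
proof (induction k arbitrary: i)
  case 0
  then show ?case by (simp add: unit_vec_fun_def)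
next
  case (Suc k)
  have "(mat_vec n a ^^ Suc k) x i = (\<Sum>l<n. a i l * (\<Sum>j<n. (mat_vec n a ^^ k) (unit_vec_fun j) l * x j))"
    using Suc.IH by (simp add: mat_vec_def[of n a "(mat_vec n a ^^ k) x"])
  also have "\<dots> = (\<Sum>l<n. \<Sum>j<n. a i l * (mat_vec n a ^^ k) (unit_vec_fun j) l * x j)"
    by (simp add: sum_distrib_left mult.assoc)
  also have "\<dots> = (\<Sum>j<n. (mat_vec n a ^^ Suc k) (unit_vec_fun j) i * x j)"
    by (subst sum.swap) (simp add: mat_vec_def[of n a "(mat_vec n a ^^ k) _"] sum_distrib_right)
  finally show ?case .
qed

lemma dot_mat_vec_pow_le_frob:
  "dot n ((mat_vec n a ^^ k) x) ((mat_vec n a ^^ k) x) \<le> frob_pow n a k * dot n x x"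
proof -
  have "((mat_vec n a ^^ k) x i)\<^sup>2 \<le> (\<Sum>j<n. ((mat_vec n a ^^ k) (unit_vec_fun j) i)\<^sup>2) * dot n x x"
    if "i < n" for i
    using Cauchy_Schwarz_ineq_sum[of "\<lambda>j. (mat_vec n a ^^ k) (unit_vec_fun j) i" x "{..<n}"]
      mat_vec_pow_expand[OF that, where a = a and k = k and x = x]
    by (simp add: dot_def power2_eq_square)
  then show ?thesis
    unfolding frob_pow_def sum_distrib_right
    by (auto simp: dot_def[of n "(mat_vec n a ^^ k) x"] power2_eq_square[symmetric] intro!: sum_mono)
qed

text \<open>Iterates \<open>|B x|\<^sup>2 = x \<bullet> B (B x) \<le> |x| * |B (B x)|\<close>, where \<open>B\<close> is a power of \<open>a\<close>.\<close>

lemma dot_mat_vec_power: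
  fixes a :: "nat \<Rightarrow> nat \<Rightarrow> real" and n :: nat and x :: "nat \<Rightarrow> real"
  assumes sym: "\<And>i j. a i j = a j i"
  defines "N \<equiv> \<lambda>k. dot n ((mat_vec n a ^^ k) x) ((mat_vec n a ^^ k) x)"
  shows "N 1 ^ (2 ^ l) \<le> N 0 ^ (2 ^ l - 1) * N (2 ^ l)"
proof (induction l)
  case (Suc l)
  define k :: nat where "k = 2 ^ l"
  have k: "k \<ge> 1" "2 ^ Suc l = 2 * k" by (simp_all add: k_def)
  have N0: "N j \<ge> 0" for j by (simp add: N_def)
  have "N k = dot n x ((mat_vec n a ^^ (2 * k)) x)"
    unfolding N_def mult_2 funpow_add o_apply by (rule mat_vec_pow_sym[OF sym, symmetric])
  then have sq: "(N k)\<^sup>2 \<le> N 0 * N (2 * k)"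
    using dot_Cauchy_Schwarz[of n x "(mat_vec n a ^^ (2 * k)) x"] by (simp add: N_def)
  have "N 1 ^ (2 * k) = (N 1 ^ k)\<^sup>2"
    by (rule power_even_eq)
  also have "\<dots> \<le> (N 0 ^ (k - 1) * N k)\<^sup>2"
    using Suc.IH[folded k_def] N0 by (intro power_mono) auto
  also have "\<dots> = N 0 ^ (2 * (k - 1)) * (N k)\<^sup>2"
    by (simp only: power_mult_distrib power_even_eq)
  also have "\<dots> \<le> N 0 ^ (2 * (k - 1)) * (N 0 * N (2 * k))"
    using sq N0 by (intro mult_left_mono) auto
  also have "\<dots> = N 0 ^ Suc (2 * (k - 1)) * N (2 * k)"
    by (simp only: power_Suc mult_ac)
  also have "Suc (2 * (k - 1)) = 2 * k - 1"
    using k by linarith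
  finally show ?case by (simp only: k(2))
next
  case 0
  show ?case by (simp only: power_0 power_one_right diff_self_eq_0 mult_1_left order_refl)
qed

text \<open>Bounds |a x| through |a^k x| with k = \<open>2 ^ l\<close> and takes k-th roots, so no
  spectral decomposition is involved. Powers of two are what the repeated doubling reaches.\<close>

lemma op_bound_of_frob_pow:
  assumes sym: "\<And>i j. a i j = a j i" and "frob_pow n a (2 ^ l) \<le> r ^ (2 * 2 ^ l)"
  shows "op_bound n a r"
  unfolding op_bound_def
proof
  fix x
  let ?k = "2 ^ l :: nat"
  have k: "Suc (?k - 1) = ?k" by (rule Suc_diff_1) (rule zero_less_power, rule pos2)
  have "(dot n (mat_vec n a x) (mat_vec n a x)) ^ ?k
      \<le> dot n x x ^ (?k - 1) * dot n ((mat_vec n a ^^ ?k) x) ((mat_vec n a ^^ ?k) x)"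
    using dot_mat_vec_power[of a n x l] sym by simp
  also have "\<dots> \<le> dot n x x ^ (?k - 1) * (r ^ (2 * ?k) * dot n x x)"
    by (intro mult_left_mono order.trans[OF dot_mat_vec_pow_le_frob] mult_right_mono assms) auto
  also have "\<dots> = r ^ (2 * ?k) * dot n x x ^ (Suc (?k - 1))"
    by (simp only: power_Suc mult_ac)
  also have "\<dots> = (r\<^sup>2 * dot n x x) ^ ?k"
    by (simp only: k power_mult_distrib power_mult)
  finally have "(dot n (mat_vec n a x) (mat_vec n a x)) ^ Suc (?k - 1) \<le> (r\<^sup>2 * dot n x x) ^ Suc (?k - 1)"
    by (simp only: k)
  then show "dot n (mat_vec n a x) (mat_vec n a x) \<le> r\<^sup>2 * dot n x x"
    by (rule power_le_imp_le_base) simp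
qed

section \<open>Moments of a centred Bernoulli matrix\<close>

definition walks :: "nat \<Rightarrow> nat \<Rightarrow> nat list set" where
  "walks n L = {ys. length ys = L \<and> set ys \<subseteq> {..<n}}"

lemma walks_0: "walks n 0 = {[]}"
  by (auto simp: walks_def)

lemma walks_Suc: "walks n (Suc L) = (\<lambda>(ys, v). v # ys) ` (walks n L \<times> {..<n})"
  by (auto simp: walks_def image_iff length_Suc_conv)

lemma finite_walks [simp]: "finite (walks n L)"
  by (induction L) (auto simp: walks_0 walks_Suc)

lemma sum_walks_Suc: "(\<Sum>ys\<in>walks n (Suc L). f ys) = (\<Sum>ys\<in>walks n L. \<Sum>v<n. f (v # ys))"
  unfolding walks_Suc sum.cartesian_product
  by (subst sum.reindex) (auto simp: inj_on_def case_prod_unfold)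

text \<open>A walk is stored with its most recent vertex first; \<open>E ys v\<close> is the edge traversed when
  the walk \<open>ys\<close> is prolonged by \<open>v\<close>.\<close>

primrec walk_edges :: "(nat list \<Rightarrow> nat \<Rightarrow> 'e) \<Rightarrow> nat list \<Rightarrow> 'e list" where
  "walk_edges E [] = []"
| "walk_edges E (v # ys) = E ys v # walk_edges E ys"

lemma length_walk_edges [simp]: "length (walk_edges E ys) = length ys"
  by (induction ys) auto

text \<open>A step along an old edge has at most \<open>L\<close> possible targets, and a step along a new edge
  costs a factor \<open>q\<close>.\<close>

lemma sum_walks_le:
  fixes q :: real
  assumes inj: "\<And>ys. inj (E ys)" and "q \<ge> 0"
  shows "l \<le> L \<Longrightarrow> (\<Sum>ys\<in>walks n l. q ^ card (set (walk_edges E ys))) \<le> (real n * q + real L) ^ l"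
proof (induction l)
  case (Suc l)
  have step: "(\<Sum>v<n. q ^ card (set (walk_edges E (v # ys))))
      \<le> q ^ card (set (walk_edges E ys)) * (real n * q + real L)" if "ys \<in> walks n l" for ys
  proof -
    let ?W = "set (walk_edges E ys)"
    let ?O = "{v \<in> {..<n}. E ys v \<in> ?W}"
    have "card ?O = card (E ys ` ?O)"
      using inj by (subst card_image) (auto simp: inj_on_def inj_def)
    also have "\<dots> \<le> card ?W" by (intro card_mono) auto
    also have "\<dots> \<le> l"
      using card_length[of "walk_edges E ys"] that by (simp add: walks_def)
    finally have O: "real (card ?O) \<le> real L" using Suc.prems by simp
    have "q ^ card (set (walk_edges E (v # ys))) \<le> q ^ card ?W * (q + of_bool (v \<in> ?O))"
      if "v < n" for v
      using that \<open>q \<ge> 0\<close>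
      by (cases "E ys v \<in> ?W") (auto simp: insert_absorb distrib_left algebra_simps)
    then have "(\<Sum>v<n. q ^ card (set (walk_edges E (v # ys))))
        \<le> (\<Sum>v<n. q ^ card ?W * (q + of_bool (v \<in> ?O)))"
      by (intro sum_mono) auto
    also have "\<dots> = q ^ card ?W * (real n * q + (\<Sum>v<n. of_bool (v \<in> ?O)))"
      by (simp add: sum_distrib_left[symmetric] sum.distrib)
    also have "(\<Sum>v<n. of_bool (v \<in> ?O)) = real (card ?O)"
      by (simp add: of_bool_def sum.If_cases Int_def conj_commute)
    also have "q ^ card ?W * (real n * q + real (card ?O)) \<le> q ^ card ?W * (real n * q + real L)"
      using O \<open>q \<ge> 0\<close> by (intro mult_left_mono add_left_mono) auto
    finally show ?thesis .
  qed
  have "(\<Sum>ys\<in>walks n (Suc l). q ^ card (set (walk_edges E ys)))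
      \<le> (\<Sum>ys\<in>walks n l. q ^ card (set (walk_edges E ys)) * (real n * q + real L))"
    unfolding sum_walks_Suc by (intro sum_mono step)
  also have "\<dots> \<le> (real n * q + real L) ^ l * (real n * q + real L)"
    unfolding sum_distrib_right[symmetric] using Suc \<open>q \<ge> 0\<close>
    by (intro mult_right_mono) auto
  finally show ?case by (simp add: mult.commute)
qed (simp add: walks_0)

section \<open>Unordered edges and walks cut into blocks\<close>

definition uedge :: "nat \<Rightarrow> nat \<Rightarrow> nat \<times> nat" where
  "uedge i j = (min i j, max i j)"

lemma uedge_commute: "uedge i j = uedge j i"
  by (simp add: uedge_def min.commute max.commute)

lemma inj_uedge: "inj (uedge i)"
  by (auto simp: inj_def uedge_def min_def max_def split: if_splits)

definition pairs :: "nat \<Rightarrow> (nat \<times> nat) set" where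
  "pairs n = {(i, j). i \<le> j \<and> j < n}"

lemma finite_pairs [simp]: "finite (pairs n)"
  by (rule finite_subset[of _ "{..<n} \<times> {..<n}"]) (auto simp: pairs_def)

lemma uedge_in_pairs: "i < n \<Longrightarrow> j < n \<Longrightarrow> uedge i j \<in> pairs n"
  by (auto simp: uedge_def pairs_def)

text \<open>A walk of length \<open>r * k\<close> is cut into \<open>r\<close> walks of length \<open>k\<close>, all of which start at \<open>i\<close>.\<close>

definition restart :: "nat \<Rightarrow> nat \<Rightarrow> nat list \<Rightarrow> nat" where
  "restart k i ys = (if length ys mod k = 0 then i else hd ys)"

primrec end_weight :: "nat \<Rightarrow> (nat \<Rightarrow> real) \<Rightarrow> nat list \<Rightarrow> real" where
  "end_weight k x [] = 1"
| "end_weight k x (v # ys) = (if Suc (length ys) mod k = 0 then x v else 1) * end_weight k x ys"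

abbreviation restart_edges :: "nat \<Rightarrow> nat \<Rightarrow> nat list \<Rightarrow> (nat \<times> nat) list" where
  "restart_edges k i \<equiv> walk_edges (\<lambda>ys. uedge (restart k i ys))"

text \<open>Concatenating the \<open>r\<close> factors into one walk, with a return to
  \<open>i\<close> after every \<open>k\<close> steps and a factor of \<open>x\<close> at each block
  end, lets a single count serve every \<open>r\<close>. It is used with \<open>r = 2\<close> for
  the operator norm and with \<open>r = 4\<close> for the eigenvector.\<close>

lemma mat_vec_pow_power_eq_sum_walks:
  fixes z :: "nat \<times> nat \<Rightarrow> real"
  assumes "k > 0"
  defines "a \<equiv> \<lambda>i j. z (uedge i j)"
  shows "((mat_vec n a ^^ k) x i) ^ r =
    (\<Sum>ys\<in>walks n (r * k). (\<Prod>e\<leftarrow>restart_edges k i ys. z e) * end_weight k x ys)"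
proof (induction r)
  case 0
  then show ?case by (simp add: walks_0)
next
  case (Suc r)
  let ?w = "\<lambda>ys. (\<Prod>e\<leftarrow>restart_edges k i ys. z e) * end_weight k x ys"
  let ?M = "mat_vec n a"
  \<comment> \<open>Treats \<open>r\<close> finished blocks and \<open>b\<close> further steps. The
    test vector \<open>y\<close> is evaluated at the current vertex and must be arbitrary, since
    removing the last step replaces it by \<open>?M y\<close>.\<close>
  have partial: "(\<Sum>ys\<in>walks n (r * k + b). ?w ys * y (restart k i ys)) =
      ((?M ^^ k) x i) ^ r * (?M ^^ b) y i" if "b < k" for b y
    using that
  proof (induction b arbitrary: y)
    case 0
    have "(\<Sum>ys\<in>walks n (r * k). ?w ys * y (restart k i ys)) = (\<Sum>ys\<in>walks n (r * k). ?w ys) * y i"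
      unfolding sum_distrib_right by (intro sum.cong) (auto simp: walks_def restart_def)
    then show ?case using Suc.IH by simp
  next
    case (Suc b)
    have mod: "Suc (r * k + b) mod k = Suc b"
      using Suc.prems mod_mult_self3[of r k "Suc b"] by simp
    have ndvd: "\<not> k dvd Suc b"
      using Suc.prems by (auto dest: dvd_imp_le)
    have "(\<Sum>ys\<in>walks n (r * k + Suc b). ?w ys * y (restart k i ys)) =
        (\<Sum>ys\<in>walks n (r * k + b). \<Sum>v<n. ?w (v # ys) * y (restart k i (v # ys)))"
      by (simp add: sum_walks_Suc)
    also have "\<dots> = (\<Sum>ys\<in>walks n (r * k + b). ?w ys * ?M y (restart k i ys))"
      by (intro sum.cong refl)
         (auto simp: walks_def mod ndvd restart_def[of k i "_ # _"] mat_vec_def a_def sum_distrib_left mult_ac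
           intro!: sum.cong)
    also have "\<dots> = ((?M ^^ k) x i) ^ r * (?M ^^ b) (?M y) i"
      using Suc by simp
    finally show ?case by (simp only: funpow_Suc_right o_apply)
  qed
  \<comment> \<open>The step that ends a block is handled separately: there
    \<open>end_weight\<close> gains an entry of \<open>x\<close>, and the walk afterwards starts
    from \<open>i\<close> again.\<close>
  obtain b where b: "k = Suc b" using assms(1) by (cases k) auto
  have mod: "Suc (r * k + b) mod k = 0"
    using b mod_mult_self3[of r k k] by simp
  have step: "(\<Sum>v<n. ?w (v # ys)) = ?w ys * ?M x (restart k i ys)" if "ys \<in> walks n (r * k + b)" for ys
  proof -
    have "Suc (length ys) mod k = 0"
      using that mod by (simp only: walks_def mem_Collect_eq)
    then show ?thesis
      by (simp only: walk_edges.simps end_weight.simps list.map prod_list.Cons simp_thms if_True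
          mat_vec_def a_def sum_distrib_left mult_ac)
  qed
  have "(\<Sum>ys\<in>walks n (Suc r * k). ?w ys) = (\<Sum>ys\<in>walks n (r * k + b). \<Sum>v<n. ?w (v # ys))"
  proof -
    have "Suc r * k = Suc (r * k + b)" by (simp add: b)
    then show ?thesis by (simp only: sum_walks_Suc)
  qed
  also have "\<dots> = (\<Sum>ys\<in>walks n (r * k + b). ?w ys * ?M x (restart k i ys))"
    by (intro sum.cong refl step)
  also have "\<dots> = ((?M ^^ k) x i) ^ r * (?M ^^ b) (?M x) i"
    by (rule partial) (simp add: b)
  also have "(?M ^^ b) (?M x) = (?M ^^ k) x"
    by (simp only: b funpow_Suc_right o_apply)
  finally show ?case by (simp add: mult.commute)
qed

lemma abs_end_weight_le:
  assumes "\<And>j. j < n \<Longrightarrow> \<bar>x j\<bar> \<le> X"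
  shows "set ys \<subseteq> {..<n} \<Longrightarrow> \<bar>end_weight k x ys\<bar> \<le> X ^ (length ys div k)"
proof (induction ys)
  case (Cons v ys)
  have "0 \<le> X" "\<bar>x v\<bar> \<le> X" using Cons.prems assms[of v] by auto
  then show ?case
    using Cons by (auto simp: div_Suc abs_mult intro!: mult_mono)
qed simp

section \<open>Expectations along a walk\<close>

lemma prod_list_eq_prod_count_list:
  fixes f :: "'e \<Rightarrow> 'b::comm_monoid_mult"
  assumes "finite S"
  shows "set es \<subseteq> S \<Longrightarrow> (\<Prod>e\<leftarrow>es. f e) = (\<Prod>e\<in>S. f e ^ count_list es e)"
proof (induction es)
  case (Cons a es)
  have "(\<Prod>e\<in>S. f e ^ count_list (a # es) e)
      = (\<Prod>e\<in>S. (if a = e then f e else 1) * f e ^ count_list es e)"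
    by (intro prod.cong) auto
  also have "\<dots> = f a * (\<Prod>e\<in>S. f e ^ count_list es e)"
    using Cons.prems assms by (simp add: prod.distrib)
  finally show ?case using Cons by simp
qed simp

text \<open>Independence factorises the expectation over the distinct edges. An edge used exactly
  once contributes mean zero, so a nonzero value needs every edge at least twice, which gives the
  condition on \<open>card (set es)\<close>; each factor is then at most \<open>q\<close>.\<close>

lemma abs_expectation_prod_centered_le:
  assumes S: "finite S" "set es \<subseteq> S"
    and p: "\<And>e. e \<in> S \<Longrightarrow> 0 \<le> p e \<and> p e \<le> q" and "q \<le> 1"
  shows "\<bar>bern_exp S p (\<lambda>\<eta>. \<Prod>e\<leftarrow>es. of_bool (\<eta> e) - p e)\<bar>
    \<le> (if 2 * card (set es) \<le> length es then q ^ card (set es) else 0)"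
proof -
  let ?c = "count_list es"
  have p1: "0 \<le> p e" "p e \<le> q" "p e \<le> 1" if "e \<in> S" for e
    using p[OF that] \<open>q \<le> 1\<close> by auto
  define m where "m = (\<lambda>e. p e * (1 - p e) ^ ?c e + (1 - p e) * (- p e) ^ ?c e)"
  have "(\<Prod>e\<leftarrow>es. of_bool (\<eta> e) - p e) = (\<Prod>e\<in>S. (of_bool (\<eta> e) - p e) ^ ?c e)" for \<eta>
    by (rule prod_list_eq_prod_count_list[OF S])
  then have "bern_exp S p (\<lambda>\<eta>. \<Prod>e\<leftarrow>es. of_bool (\<eta> e) - p e)
      = (\<Prod>e\<in>S. m e)"
    using expectation_prod_bern_prod[of S p "\<lambda>e b. (of_bool b - p e) ^ ?c e"] S p1
    by (simp add: m_def)
  also have "\<dots> = (\<Prod>e\<in>set es. m e)"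
    using S by (intro prod.mono_neutral_right) (auto simp: m_def count_list_0_iff)
  finally have eq: "bern_exp S p (\<lambda>\<eta>. \<Prod>e\<leftarrow>es. of_bool (\<eta> e) - p e)
      = (\<Prod>e\<in>set es. m e)" .
  show ?thesis
  proof (cases "\<exists>e\<in>set es. ?c e = 1")
    case True
    then obtain e where "e \<in> set es" "m e = 0" by (auto simp: m_def)
    then have z: "(\<Prod>e\<in>set es. m e) = 0" by (intro prod_zero) auto
    have "0 \<le> q"
      using S \<open>e \<in> set es\<close> p[of e] by auto
    then show ?thesis unfolding eq z by simp
  next
    case False
    have c2: "?c e \<ge> 2" if "e \<in> set es" for e
    proof -
      have "?c e \<noteq> 0" "?c e \<noteq> 1" using that False by (auto simp: count_list_0_iff)
      then show ?thesis by linarith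
    qed
    have "\<bar>m e\<bar> \<le> q" if "e \<in> set es" for e
    proof -
      have e: "0 \<le> p e" "p e \<le> q" "p e \<le> 1" using p1 S that by auto
      have "\<bar>m e\<bar> \<le> p e * (1 - p e) ^ ?c e + (1 - p e) * p e ^ ?c e"
        unfolding m_def by (rule order.trans[OF abs_triangle_ineq]) (use e in \<open>simp add: abs_mult power_abs\<close>)
      \<comment> \<open>Lowering the exponents to 1 and 2 is enough: the sum becomes
        \<open>p e * (1 - (p e)\<^sup>2)\<close>.\<close>
      also have "\<dots> \<le> p e * (1 - p e) ^ 1 + (1 - p e) * p e ^ 2"
        using e c2[OF that] by (intro add_mono mult_left_mono power_decreasing) auto
      also have "\<dots> = p e * ((1 - p e) * (1 + p e))"
        by (simp add: power2_eq_square algebra_simps)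
      also have "\<dots> \<le> p e * 1"
        using e by (intro mult_left_mono) (auto simp: algebra_simps)
      finally show ?thesis using e by simp
    qed
    then have "(\<Prod>e\<in>set es. \<bar>m e\<bar>) \<le> (\<Prod>e\<in>set es. q)"
      by (intro prod_mono) auto
    then have "\<bar>\<Prod>e\<in>set es. m e\<bar> \<le> q ^ card (set es)"
      by (simp add: abs_prod)
    moreover have "2 * card (set es) \<le> length es"
    proof -
      have "2 * card (set es) = (\<Sum>e\<in>set es. 2)" by simp
      also have "\<dots> \<le> (\<Sum>e\<in>set es. ?c e)" by (intro sum_mono c2)
      also have "\<dots> = length es" by (simp add: sum_count_set)
      finally show ?thesis .
    qed
    ultimately show ?thesis by (simp add: eq)
  qed
qed

text \<open>The constraint that every edge is used twice is traded for a factor \<open>s\<close> per missing edge.\<close>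

lemma expectation_mat_vec_pow_power_le:
  assumes "k > 0" and x: "\<And>j. j < n \<Longrightarrow> \<bar>x j\<bar> \<le> X" and "i < n"
    and p: "\<And>e. e \<in> pairs n \<Longrightarrow> 0 \<le> p e \<and> p e \<le> q" and "q \<le> 1" "0 \<le> q" "X \<ge> 0"
    and L: "r * k = 2 * h" and h: "h > 0" "2 * real h \<le> real n * q"
  shows "bern_exp (pairs n) p
      (\<lambda>\<eta>. ((mat_vec n (\<lambda>i j. of_bool (\<eta> (uedge i j)) - p (uedge i j)) ^^ k) x i) ^ r)
    \<le> X ^ r * (8 * real h * (real n * q)) ^ h"
proof -
  let ?E = "bern_exp (pairs n) p"
  let ?es = "restart_edges k i"
  let ?P = "\<lambda>\<eta> ys. \<Prod>e\<leftarrow>?es ys. of_bool (\<eta> e) - p e"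
  \<comment> \<open>With this value the new edges, at \<open>real n * (q / s)\<close>, and the old
    ones, at \<open>r * k\<close>, both cost \<open>2 * real h\<close> per step. The hypothesis
    \<open>2 * real h \<le> real n * q\<close> says precisely that \<open>s \<ge> 1\<close>.\<close>
  define s where "s = real n * q / (2 * real h)"
  have s: "s \<ge> 1" using h by (simp add: s_def field_simps)
  have subset: "set (?es ys) \<subseteq> pairs n" if "set ys \<subseteq> {..<n}" for ys
    using that
  proof (induction ys)
    case (Cons v ys)
    have "restart k i ys < n"
      using Cons.prems \<open>i < n\<close> by (cases ys) (auto simp: restart_def)
    with Cons show ?case by (auto intro!: uedge_in_pairs)
  qed simp
  have bound: "\<bar>?E (\<lambda>\<eta>. ?P \<eta> ys)\<bar> \<le> s ^ h * (q / s) ^ card (set (?es ys))" if "ys \<in> walks n (r * k)" for ys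
  proof -
    let ?c = "card (set (?es ys))"
    have "\<bar>?E (\<lambda>\<eta>. ?P \<eta> ys)\<bar> \<le> (if 2 * ?c \<le> length (?es ys) then q ^ ?c else 0)"
      using that p \<open>q \<le> 1\<close> by (intro abs_expectation_prod_centered_le subset) (auto simp: walks_def)
    also have "\<dots> \<le> s ^ h * (q / s) ^ ?c"
    proof (cases "?c \<le> h")
      case True
      then have "s ^ h * (q / s) ^ ?c = q ^ ?c * s ^ (h - ?c)"
        using s by (simp add: power_divide power_diff)
      moreover have "q ^ ?c * 1 \<le> q ^ ?c * s ^ (h - ?c)"
        using s \<open>0 \<le> q\<close> by (intro mult_left_mono one_le_power) auto
      ultimately show ?thesis using s \<open>0 \<le> q\<close> by simp
    next
      case False
      then show ?thesis using that L s \<open>0 \<le> q\<close> by (simp add: walks_def)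
    qed
    finally show ?thesis .
  qed
  have "((mat_vec n (\<lambda>i j. of_bool (\<eta> (uedge i j)) - p (uedge i j)) ^^ k) x i) ^ r
      = (\<Sum>ys\<in>walks n (r * k). ?P \<eta> ys * end_weight k x ys)" for \<eta>
    by (rule mat_vec_pow_power_eq_sum_walks[OF \<open>k > 0\<close>, where z = "\<lambda>e. of_bool (\<eta> e) - p e"])
  then have "?E (\<lambda>\<eta>. ((mat_vec n (\<lambda>i j. of_bool (\<eta> (uedge i j)) - p (uedge i j)) ^^ k) x i) ^ r)
      = ?E (\<lambda>\<eta>. \<Sum>ys\<in>walks n (r * k). ?P \<eta> ys * end_weight k x ys)"
    by (simp only:)
  also have "\<dots> = (\<Sum>ys\<in>walks n (r * k). ?E (\<lambda>\<eta>. ?P \<eta> ys) * end_weight k x ys)"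
    by (simp add: Bochner_Integration.integral_sum)
  also have "\<dots> \<le> (\<Sum>ys\<in>walks n (r * k). (s ^ h * (q / s) ^ card (set (?es ys))) * X ^ r)"
  proof (intro sum_mono)
    fix ys assume ys: "ys \<in> walks n (r * k)"
    have "?E (\<lambda>\<eta>. ?P \<eta> ys) * end_weight k x ys \<le> \<bar>?E (\<lambda>\<eta>. ?P \<eta> ys)\<bar> * \<bar>end_weight k x ys\<bar>"
      by (simp only: abs_mult[symmetric] abs_ge_self)
    also have "\<dots> \<le> (s ^ h * (q / s) ^ card (set (?es ys))) * X ^ r"
    proof (intro mult_mono bound ys)
      have "length ys div k = r" using ys \<open>k > 0\<close> by (simp add: walks_def)
      then show "\<bar>end_weight k x ys\<bar> \<le> X ^ r"
        using abs_end_weight_le[of n x X ys k] x ys by (simp add: walks_def)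
    qed (use s \<open>0 \<le> q\<close> in auto)
    finally show "?E (\<lambda>\<eta>. ?P \<eta> ys) * end_weight k x ys
      \<le> (s ^ h * (q / s) ^ card (set (?es ys))) * X ^ r" .
  qed
  also have "\<dots> = (s ^ h * X ^ r) * (\<Sum>ys\<in>walks n (r * k). (q / s) ^ card (set (?es ys)))"
    by (simp add: sum_distrib_left mult_ac)
  also have "\<dots> \<le> (s ^ h * X ^ r) * (real n * (q / s) + real (r * k)) ^ (r * k)"
    using s \<open>0 \<le> q\<close> \<open>X \<ge> 0\<close> by (intro mult_left_mono sum_walks_le inj_uedge) auto
  also have "real n * (q / s) = 2 * real h"
    using h \<open>i < n\<close> by (auto simp: s_def)
  also have "(2 * real h + real (r * k)) ^ (r * k) = (16 * real h * real h) ^ h"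
  proof -
    have "2 * real h + real (r * k) = 4 * real h" unfolding L by simp
    moreover have "(4 * real h)\<^sup>2 = 16 * real h * real h" by (simp add: power2_eq_square)
    ultimately show ?thesis by (simp only: L power_mult)
  qed
  also have "s ^ h * X ^ r * (16 * real h * real h) ^ h = X ^ r * (s * (16 * real h * real h)) ^ h"
    by (simp add: power_mult_distrib)
  also have "s * (16 * real h * real h) = 8 * real h * (real n * q)"
    using h by (simp add: s_def)
  finally show ?thesis .
qed

section \<open>Perturbation of a rank-one matrix\<close>

text \<open>The fourth power of the l^4 norm. For a unit vector it measures delocalisation: 1/n if
  the entries are flat, 1 if the mass sits at one vertex.\<close>

definition pow4_sum :: "nat \<Rightarrow> (nat \<Rightarrow> real) \<Rightarrow> real" where
  "pow4_sum n x = (\<Sum>i<n. x i ^ 4)"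

lemma pow4_sum_nonneg [simp]: "0 \<le> pow4_sum n x"
  by (simp add: pow4_sum_def sum_nonneg)

lemma dot_squares: "dot n (\<lambda>i. (x i)\<^sup>2) (\<lambda>i. (x i)\<^sup>2) = pow4_sum n x"
  by (simp add: dot_def pow4_sum_def power4_eq_xxxx power2_eq_square mult.assoc)

lemma pow4_sum_le_square: "pow4_sum n x \<le> (dot n x x)\<^sup>2"
proof -
  have "pow4_sum n x = (\<Sum>i<n. (x i)\<^sup>2 * (x i)\<^sup>2)"
    by (simp add: pow4_sum_def power4_eq_xxxx power2_eq_square mult.assoc)
  also have "\<dots> \<le> (\<Sum>i<n. (x i)\<^sup>2 * dot n x x)"
    by (intro sum_mono mult_left_mono)
       (auto simp: dot_def power2_eq_square[symmetric] intro!: member_le_sum)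
  also have "\<dots> = (dot n x x)\<^sup>2"
    by (simp add: dot_def sum_distrib_right[symmetric] power2_eq_square)
  finally show ?thesis .
qed

lemma add_power4_le: "(x + y) ^ 4 \<le> 8 * x ^ 4 + 8 * (y::real) ^ 4"
proof -
  have "(x + y)\<^sup>2 \<le> 2 * x\<^sup>2 + 2 * y\<^sup>2"
    using sum_squares_bound[of x y] by (simp add: power2_sum)
  then have "((x + y)\<^sup>2)\<^sup>2 \<le> (2 * x\<^sup>2 + 2 * y\<^sup>2)\<^sup>2"
    by (intro power_mono) auto
  also have "\<dots> \<le> 2 * (2 * x\<^sup>2)\<^sup>2 + 2 * (2 * y\<^sup>2)\<^sup>2"
    using sum_squares_bound[of "2 * x\<^sup>2" "2 * y\<^sup>2"] by (simp add: power2_sum)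
  finally show ?thesis by (simp add: power_mult_distrib flip: power_mult)
qed

lemma add3_power2_le: "(x + y + z)\<^sup>2 \<le> 3 * (x\<^sup>2 + y\<^sup>2 + (z::real)\<^sup>2)"
  using sum_squares_bound[of x y] sum_squares_bound[of x z] sum_squares_bound[of y z]
  by (simp add: power2_eq_square algebra_simps)

text \<open>Peeling off the terms from the front gives the \<open>k\<close>-th one a weight
  \<open>8 ^ k\<close> that does not depend on \<open>K\<close>. The geometric decay of the terms to
  which this is applied absorbs the weight, so \<open>K\<close> may grow with
  \<open>n\<close>.\<close>

lemma sum_power4_le: "(\<Sum>k=1..K. a k :: real) ^ 4 \<le> (\<Sum>k=1..K. 8 ^ k * a k ^ 4)"
proof (induction K arbitrary: a)
  case (Suc K)
  have split: "(\<Sum>k=1..Suc K. f k) = f 1 + (\<Sum>k=1..K. f (Suc k))" for f :: "nat \<Rightarrow> real"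
    by (induction K) simp_all
  have "(\<Sum>k=1..Suc K. a k) ^ 4 \<le> 8 * a 1 ^ 4 + 8 * (\<Sum>k=1..K. a (Suc k)) ^ 4"
    unfolding split by (rule add_power4_le)
  also have "\<dots> \<le> 8 * a 1 ^ 4 + 8 * (\<Sum>k=1..K. 8 ^ k * a (Suc k) ^ 4)"
    using Suc.IH[of "\<lambda>k. a (Suc k)"] by simp
  also have "\<dots> = (\<Sum>k=1..Suc K. 8 ^ k * a k ^ 4)"
    unfolding split by (simp add: sum_distrib_left mult.assoc)
  finally show ?case .
qed simp

lemma op_bound_bilinear:
  assumes "op_bound n a r" "r \<ge> 0"
  shows "\<bar>dot n x (mat_vec n a y)\<bar> \<le> r * sqrt (dot n x x) * sqrt (dot n y y)"
proof -
  have "\<bar>dot n x (mat_vec n a y)\<bar> \<le> sqrt (dot n x x) * sqrt (dot n (mat_vec n a y) (mat_vec n a y))"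
    by (rule abs_dot_le)
  also have "\<dots> \<le> sqrt (dot n x x) * sqrt (r\<^sup>2 * dot n y y)"
    using assms by (intro mult_left_mono real_sqrt_le_mono) (auto simp: op_bound_def)
  also have "\<dots> = r * sqrt (dot n x x) * sqrt (dot n y y)"
    using assms by (simp add: real_sqrt_mult)
  finally show ?thesis .
qed

lemma op_bound_pow:
  assumes "op_bound n a r"
  shows "dot n ((mat_vec n a ^^ k) x) ((mat_vec n a ^^ k) x) \<le> (r\<^sup>2) ^ k * dot n x x"
proof (induction k)
  case (Suc k)
  have "dot n ((mat_vec n a ^^ Suc k) x) ((mat_vec n a ^^ Suc k) x)
      \<le> r\<^sup>2 * dot n ((mat_vec n a ^^ k) x) ((mat_vec n a ^^ k) x)"
    using assms by (simp add: op_bound_def)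
  also have "\<dots> \<le> r\<^sup>2 * ((r\<^sup>2) ^ k * dot n x x)"
    by (intro mult_left_mono Suc.IH) auto
  finally show ?case by (simp add: mult.assoc)
qed simp

text \<open>The deterministic part of the argument: a rank-one matrix of norm
  \<open>\<theta>\<close>, a symmetric perturbation of relative size \<open>\<epsilon>\<close>, and
  the top eigenpair of the sum, with the sign of \<open>v\<close> fixed by \<open>uv_nonneg\<close>.
  The random matrix enters by interpretation on the good event.\<close>

locale perturbed_rank_one =
  fixes n :: nat and u v :: "nat \<Rightarrow> real" and \<theta> \<epsilon> \<mu> :: real and a h :: "nat \<Rightarrow> nat \<Rightarrow> real"
  assumes a_eq: "\<And>i j. a i j = \<theta> * (u i * u j) + h i j"
    and h_sym: "\<And>i j. h i j = h j i"
    and u_unit: "dot n u u = 1" and \<theta>_pos: "\<theta> > 0"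
    and \<epsilon>: "0 \<le> \<epsilon>" "\<epsilon> \<le> 1/4"
    and h_bound: "op_bound n h (\<epsilon> * \<theta>)"
    and v_unit: "dot n v v = 1"
    and eigen: "\<And>i. i < n \<Longrightarrow> mat_vec n a v i = \<mu> * v i"
    and Rayleigh: "\<And>x. dot n x (mat_vec n a x) \<le> \<mu> * dot n x x"
    and uv_nonneg: "dot n u v \<ge> 0"
begin

abbreviation "M \<equiv> mat_vec n h"

definition "\<alpha> = dot n u v"

lemma mat_vec_a: "mat_vec n a x i = \<theta> * dot n u x * u i + M x i"
  by (simp add: mat_vec_def a_eq dot_def sum.distrib sum_distrib_left sum_distrib_right algebra_simps)

lemma mat_vec_a': "mat_vec n a x = (\<lambda>i. (\<theta> * dot n u x) * u i + M x i)"
  by (simp add: mat_vec_a fun_eq_iff)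

lemma bilinear: "\<bar>dot n x (M y)\<bar> \<le> \<epsilon> * \<theta> * sqrt (dot n x x) * sqrt (dot n y y)"
  using op_bound_bilinear[OF h_bound] \<epsilon> \<theta>_pos by simp

lemma quad_a: "dot n x (mat_vec n a x) = \<theta> * (dot n u x)\<^sup>2 + dot n x (M x)"
  by (simp add: mat_vec_a' dot_linear power2_eq_square dot_commute[of n x u])

lemma quad_v: "dot n v (mat_vec n a v) = \<mu>"
proof -
  have "dot n v (mat_vec n a v) = dot n v (\<lambda>i. \<mu> * v i)"
    by (rule dot_cong) (auto simp: eigen)
  then show ?thesis by (simp add: dot_linear v_unit)
qed

lemma \<alpha>_le_1: "\<alpha>\<^sup>2 \<le> 1" "\<alpha> \<le> 1"
proof -
  show "\<alpha>\<^sup>2 \<le> 1"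
    using dot_Cauchy_Schwarz[of n u v] by (simp add: \<alpha>_def u_unit v_unit)
  then have "\<bar>\<alpha>\<bar> \<le> 1" by (simp only: abs_square_le_1)
  then show "\<alpha> \<le> 1" by linarith
qed

lemma \<mu>_bounds: "(1 - \<epsilon>) * \<theta> \<le> \<mu>" "\<mu> \<le> (1 + \<epsilon>) * \<theta>"
proof -
  have "\<bar>dot n u (M u)\<bar> \<le> \<epsilon> * \<theta>" "\<bar>dot n v (M v)\<bar> \<le> \<epsilon> * \<theta>"
    using bilinear[of u u] bilinear[of v v] by (simp_all add: u_unit v_unit)
  moreover have "\<theta> + dot n u (M u) \<le> \<mu>"
    using Rayleigh[of u] quad_a[of u] by (simp add: u_unit)
  moreover have "\<mu> = \<theta> * \<alpha>\<^sup>2 + dot n v (M v)"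
    using quad_v quad_a[of v] by (simp add: \<alpha>_def)
  moreover have "\<theta> * \<alpha>\<^sup>2 \<le> \<theta> * 1"
    using \<alpha>_le_1 \<theta>_pos by (intro mult_left_mono) auto
  ultimately show "(1 - \<epsilon>) * \<theta> \<le> \<mu>" "\<mu> \<le> (1 + \<epsilon>) * \<theta>"
    by (auto simp: algebra_simps abs_le_iff)
qed

lemma \<mu>_pos: "\<mu> > 0" "\<mu> \<ge> 3/4 * \<theta>"
proof -
  have "3/4 * \<theta> \<le> (1 - \<epsilon>) * \<theta>" using \<epsilon> \<theta>_pos by (intro mult_right_mono) auto
  then show "\<mu> \<ge> 3/4 * \<theta>" using \<mu>_bounds by linarith
  then show "\<mu> > 0" using \<theta>_pos by linarith
qed

text \<open>A rank-one form of the Davis-Kahan bound: the identity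
  \<open>\<mu> = \<theta> * \<alpha>\<^sup>2 + dot n v (M v)\<close> is compared with the lower
  bound \<open>(1 - \<epsilon>) * \<theta>\<close> on \<open>\<mu>\<close>.\<close>

lemma \<alpha>_ge: "1 - 2 * \<epsilon> \<le> \<alpha>\<^sup>2" "1 - 2 * \<epsilon> \<le> \<alpha>" "\<alpha> > 0"
proof -
  have "\<bar>dot n v (M v)\<bar> \<le> \<epsilon> * \<theta>"
    using bilinear[of v v] by (simp add: v_unit)
  moreover have "\<mu> = \<theta> * \<alpha>\<^sup>2 + dot n v (M v)"
    using quad_v quad_a[of v] by (simp add: \<alpha>_def)
  ultimately have "\<theta> * (1 - 2 * \<epsilon>) \<le> \<theta> * \<alpha>\<^sup>2"
    using \<mu>_bounds by (auto simp: algebra_simps abs_le_iff)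
  then show *: "1 - 2 * \<epsilon> \<le> \<alpha>\<^sup>2" using \<theta>_pos by simp
  have "\<alpha> \<ge> 0" using uv_nonneg by (simp add: \<alpha>_def)
  then have "\<alpha>\<^sup>2 \<le> \<alpha>" using \<alpha>_le_1 by (simp add: power2_eq_square mult_left_le)
  with * show "1 - 2 * \<epsilon> \<le> \<alpha>" by linarith
  then show "\<alpha> > 0" using \<epsilon> by linarith
qed

section \<open>Second-order expansion of the top eigenvalue\<close>

definition "s = dot n u (M u)"
definition "b = dot n (M u) (M u)"

lemma b_nonneg: "b \<ge> 0" by (simp add: b_def)

text \<open>Splits \<open>v\<close> into \<open>\<alpha> * u\<close> and an orthogonal part
  \<open>z\<close>, and absorbs the cross term between \<open>z\<close> and \<open>M u\<close> into
  \<open>dot n z z\<close> by completing a square; what is left over is the term in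
  \<open>b\<close>.\<close>

lemma \<mu>_upper: "\<mu> - \<theta> \<le> s + b / ((1 - 2 * \<epsilon>) * \<theta>)"
proof -
  define z where "z = (\<lambda>i. v i - \<alpha> * u i)"
  \<comment> \<open>With this weight the terms in \<open>dot n z z\<close> add up to
    \<open>\<mu> * dot n z z\<close>; since \<open>dot n z z = 1 - \<alpha>\<^sup>2\<close>, the
    whole inequality becomes a multiple of \<open>\<alpha>\<^sup>2\<close>.\<close>
  define g where "g = \<mu> - \<epsilon> * \<theta>"
  have g: "g \<ge> (1 - 2 * \<epsilon>) * \<theta>" "(1 - 2 * \<epsilon>) * \<theta> > 0"
    using \<mu>_bounds \<epsilon> \<theta>_pos by (auto simp: g_def algebra_simps intro!: mult_pos_pos)
  have uz: "dot n u z = 0"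
    by (simp add: z_def dot_linear u_unit \<alpha>_def)
  have v_eq: "v = (\<lambda>i. \<alpha> * u i + z i)" by (simp add: z_def)
  have zz: "\<alpha>\<^sup>2 + dot n z z = 1"
  proof -
    have "dot n z u = 0" using uz by (simp add: dot_commute)
    then have "dot n (\<lambda>i. \<alpha> * u i + z i) (\<lambda>i. \<alpha> * u i + z i) = \<alpha>\<^sup>2 + dot n z z"
      by (simp add: dot_linear u_unit uz power2_eq_square)
    then show ?thesis using v_unit by (simp add: v_eq[symmetric])
  qed
  have "\<mu> = \<theta> * \<alpha>\<^sup>2 + \<alpha>\<^sup>2 * s + 2 * \<alpha> * dot n z (M u) + dot n z (M z)"
  proof -
    have "dot n u (M z) = dot n z (M u)"
      using mat_vec_sym[OF h_sym, where n = n and x = u and y = z] dot_commute[of n z "M u"] by simp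
    then have "dot n (\<lambda>i. \<alpha> * u i + z i) (M (\<lambda>i. \<alpha> * u i + z i))
        = \<alpha>\<^sup>2 * s + 2 * \<alpha> * dot n z (M u) + dot n z (M z)"
      unfolding mat_vec_linear dot_linear by (simp add: s_def power2_eq_square algebra_simps)
    then have "dot n v (M v) = \<alpha>\<^sup>2 * s + 2 * \<alpha> * dot n z (M u) + dot n z (M z)"
      by (simp only: v_eq[symmetric])
    then show ?thesis
      using quad_v quad_a[of v] by (simp add: \<alpha>_def)
  qed
  moreover have "dot n z (M z) \<le> \<epsilon> * \<theta> * dot n z z"
    using bilinear[of z z] by (simp add: mult.assoc)
  moreover have "2 * \<alpha> * dot n z (M u) \<le> g * dot n z z + \<alpha>\<^sup>2 * b / g"
  proof -
    have "g > 0" using g by linarith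
    have "0 \<le> dot n (\<lambda>i. g * z i - \<alpha> * M u i) (\<lambda>i. g * z i - \<alpha> * M u i)"
      by simp
    also have "\<dots> = g * (g * dot n z z + \<alpha>\<^sup>2 * b / g - 2 * \<alpha> * dot n z (M u))"
      using \<open>g > 0\<close> dot_commute[of n "M u" z] unfolding dot_linear
      by (simp add: b_def power2_eq_square algebra_simps)
    finally show ?thesis using \<open>g > 0\<close> by (simp add: zero_le_mult_iff)
  qed
  ultimately have "\<mu> \<le> \<theta> * \<alpha>\<^sup>2 + \<alpha>\<^sup>2 * s + \<mu> * dot n z z + \<alpha>\<^sup>2 * b / g"
    by (simp add: g_def algebra_simps)
  moreover have "dot n z z = 1 - \<alpha>\<^sup>2" using zz by simp
  ultimately have "\<alpha>\<^sup>2 * (\<mu> - \<theta>) \<le> \<alpha>\<^sup>2 * (s + b / g)"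
    by (simp add: algebra_simps)
  then have "\<mu> - \<theta> \<le> s + b / g"
    using \<alpha>_ge by simp
  also have "b / g \<le> b / ((1 - 2 * \<epsilon>) * \<theta>)"
  proof (rule divide_left_mono[OF g(1) b_nonneg])
    show "0 < g * ((1 - 2 * \<epsilon>) * \<theta>)" by (rule mult_pos_pos) (use g in linarith)+
  qed
  finally show ?thesis by simp
qed

text \<open>The test vector \<open>u + M u / \<theta>\<close> is the first-order approximation of the eigenvector.\<close>

lemma \<mu>_lower:
  defines "D \<equiv> 1 + 2 * s / \<theta> + b / \<theta>\<^sup>2"
  shows "(\<mu> - \<theta>) * D \<ge> s + (1 - \<epsilon>) * (b / \<theta>)"
proof -
  define t where "t = 1 / \<theta>"
  define x where "x = (\<lambda>i. u i + t * M u i)"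
  have us: "dot n (M u) u = s" by (simp add: s_def dot_commute)
  have "dot n x x = 1 + 2 * t * s + t * t * b"
    unfolding x_def dot_linear by (simp add: u_unit us b_def s_def[symmetric])
  then have xx: "dot n x x = D"
    by (simp add: D_def t_def power2_eq_square)
  have "dot n u x = 1 + t * s"
    unfolding x_def by (simp add: dot_linear u_unit s_def)
  then have ux: "dot n u x = 1 + s / \<theta>" by (simp add: t_def)
  have "dot n u (M (M u)) = b"
    using mat_vec_sym[OF h_sym, where n = n and x = u and y = "M u"] by (simp add: b_def)
  then have "dot n x (M x) = s + 2 * t * b + t * t * dot n (M u) (M (M u))"
    unfolding x_def mat_vec_linear dot_linear by (simp add: s_def b_def algebra_simps)
  then have "dot n x (M x) = s + 2 * b / \<theta> + dot n (M u) (M (M u)) / \<theta>\<^sup>2"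
    by (simp add: t_def power2_eq_square)
  moreover have "dot n (M u) (M (M u)) / \<theta>\<^sup>2 \<ge> - \<epsilon> * (b / \<theta>)"
  proof -
    have "\<bar>dot n (M u) (M (M u))\<bar> \<le> \<epsilon> * \<theta> * b"
      using bilinear[of "M u" "M u"] b_nonneg by (simp add: b_def mult.assoc)
    then have "- (\<epsilon> * \<theta> * b) / \<theta>\<^sup>2 \<le> dot n (M u) (M (M u)) / \<theta>\<^sup>2"
      using \<theta>_pos by (intro divide_right_mono) auto
    then show ?thesis using \<theta>_pos by (simp add: power2_eq_square field_simps)
  qed
  ultimately have "\<theta> * (1 + s / \<theta>)\<^sup>2 + s + 2 * b / \<theta> - \<epsilon> * (b / \<theta>) \<le> \<mu> * D"
    using Rayleigh[of x] quad_a[of x] by (simp add: xx ux)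
  moreover have "\<theta> * (1 + s / \<theta>)\<^sup>2 \<ge> \<theta> + 2 * s"
    using \<theta>_pos by (simp add: power2_eq_square field_simps)
  moreover have "\<theta> * D = \<theta> + 2 * s + b / \<theta>"
    using \<theta>_pos by (simp add: D_def power2_eq_square field_simps)
  moreover have "(\<mu> - \<theta>) * D = \<mu> * D - \<theta> * D" "(1 - \<epsilon>) * (b / \<theta>) = b / \<theta> - \<epsilon> * (b / \<theta>)"
    "2 * b / \<theta> = 2 * (b / \<theta>)"
    by (simp_all only: left_diff_distrib mult_1_left times_divide_eq_right diff_divide_distrib)
  ultimately show ?thesis by linarith
qed

text \<open>The error is relative to \<open>\<bar>s\<bar> + b / \<theta>\<close>, which has bounded
  expectation for the random matrix, whereas \<open>\<epsilon> * \<theta>\<close> itself may grow.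
  This is why a fixed small \<open>\<epsilon>\<close> yields a small additive error in the
  mean.\<close>

lemma \<mu>_expansion: "\<bar>\<mu> - \<theta> - s - b / \<theta>\<bar> \<le> 7 * \<epsilon> * (\<bar>s\<bar> + b / \<theta>)"
proof -
  define B where "B = b / \<theta>"
  have B: "B \<ge> 0" using b_nonneg \<theta>_pos by (simp add: B_def)
  have abs_s: "\<bar>s\<bar> \<le> \<epsilon> * \<theta>" using bilinear[of u u] by (simp add: s_def u_unit)
  have b_le: "b \<le> (\<epsilon> * \<theta>)\<^sup>2"
    using h_bound by (auto simp: op_bound_def b_def u_unit dest: spec[of _ u])
  have upper: "\<mu> - \<theta> - s - B \<le> 4 * \<epsilon> * B"
  proof -
    have "b / ((1 - 2 * \<epsilon>) * \<theta>) = B * (1 / (1 - 2 * \<epsilon>))" by (simp add: B_def)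
    also have "\<dots> \<le> B * (1 + 4 * \<epsilon>)"
    proof (intro mult_left_mono B)
      have "1 \<le> (1 + 4 * \<epsilon>) * (1 - 2 * \<epsilon>)"
      proof -
        have "(1 + 4 * \<epsilon>) * (1 - 2 * \<epsilon>) = 1 + 2 * (\<epsilon> * (1 - 4 * \<epsilon>))" by (simp add: algebra_simps)
        moreover have "\<epsilon> * (1 - 4 * \<epsilon>) \<ge> 0" using \<epsilon> by (intro mult_nonneg_nonneg) auto
        ultimately show ?thesis by linarith
      qed
      then show "1 / (1 - 2 * \<epsilon>) \<le> 1 + 4 * \<epsilon>" using \<epsilon> by (simp add: pos_divide_le_eq)
    qed
    finally show ?thesis using \<mu>_upper by (simp add: algebra_simps)
  qed
  define D where "D = 1 + 2 * s / \<theta> + b / \<theta>\<^sup>2"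
  define R where "R = s + (1 - \<epsilon>) * B"
  have s\<theta>: "\<bar>s / \<theta>\<bar> \<le> \<epsilon>" using abs_s \<theta>_pos by (simp add: abs_divide pos_divide_le_eq)
  have b\<theta>: "0 \<le> b / \<theta>\<^sup>2" "b / \<theta>\<^sup>2 \<le> \<epsilon>\<^sup>2"
    using b_le b_nonneg \<theta>_pos by (auto simp: power_mult_distrib pos_divide_le_eq)
  have Deq: "D = 1 + 2 * (s / \<theta>) + b / \<theta>\<^sup>2" by (simp add: D_def)
  have "\<epsilon>\<^sup>2 \<le> \<epsilon> * (1/4)"
    using \<epsilon> unfolding power2_eq_square by (intro mult_left_mono) auto
  \<comment> \<open>Division by \<open>D\<close> costs a relative error of at most
    \<open>6 * \<epsilon>\<close>. The lower bound holds because \<open>b / \<theta>\<^sup>2\<close>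
    is nonnegative and \<open>2 * \<epsilon> \<le> 1/2\<close>.\<close>
  then have D: "\<bar>1 - D\<bar> \<le> 3 * \<epsilon>" "D \<ge> 1/2"
    using s\<theta> b\<theta> \<epsilon> unfolding Deq by linarith+
  have RD: "(\<mu> - \<theta>) * D \<ge> R"
    using \<mu>_lower by (simp add: D_def R_def B_def)
  have "\<bar>R\<bar> \<le> \<bar>s\<bar> + B"
  proof -
    have "(1 - \<epsilon>) * B \<le> 1 * B" using \<epsilon> B by (intro mult_right_mono) auto
    moreover have "(1 - \<epsilon>) * B \<ge> 0" using \<epsilon> B by simp
    ultimately show ?thesis unfolding R_def by linarith
  qed
  have "R / D \<le> \<mu> - \<theta>" using RD D by (simp add: pos_divide_le_eq)
  moreover have "R - R / D \<le> 6 * \<epsilon> * (\<bar>s\<bar> + B)"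
  proof -
    have "R - R / D = R * (D - 1) / D" using D by (simp add: field_simps)
    also have "\<dots> \<le> \<bar>R\<bar> * \<bar>1 - D\<bar> / D"
      using D by (intro divide_right_mono) (auto simp: abs_mult[symmetric] abs_le_iff algebra_simps)
    also have "\<dots> \<le> ((\<bar>s\<bar> + B) * (3 * \<epsilon>)) / (1/2)"
      using D B \<epsilon> \<open>\<bar>R\<bar> \<le> \<bar>s\<bar> + B\<close> by (intro frac_le mult_mono) auto
    finally show ?thesis by (simp add: algebra_simps)
  qed
  ultimately have "\<mu> - \<theta> - s - B \<ge> - (6 * \<epsilon> * (\<bar>s\<bar> + B)) - \<epsilon> * B"
    by (simp add: R_def algebra_simps)
  moreover have "\<epsilon> * B \<ge> 0" "\<epsilon> * \<bar>s\<bar> \<ge> 0" using \<epsilon> B by auto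
  ultimately show ?thesis
    using upper unfolding B_def[symmetric] by (auto simp: abs_le_iff algebra_simps)
qed

text \<open>A truncated Neumann series: the eigenvalue equation solved for \<open>v\<close> is
  \<open>(\<theta> * \<alpha> / \<mu>) * u\<close> plus \<open>M v / \<mu>\<close> and is
  substituted into itself. The remainder still contains the unknown \<open>v\<close>, but for
  \<open>K\<close> of order ln n the operator norm alone makes it negligible.\<close>

lemma eigenvector_expansion:
  assumes "i < n"
  shows "v i = (\<theta> * \<alpha> / \<mu>) * (\<Sum>k\<le>K. (M ^^ k) u i / \<mu> ^ k) + (M ^^ Suc K) v i / \<mu> ^ Suc K"
proof -
  have v1: "v i = (\<theta> * \<alpha> / \<mu>) * u i + M v i / \<mu>" if "i < n" for i
    using eigen[OF that] mat_vec_a[of v i] \<mu>_pos by (simp add: \<alpha>_def field_simps)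
  have Mv: "(M ^^ Suc k) v i = (\<theta> * \<alpha> / \<mu>) * (M ^^ Suc k) u i + (M ^^ Suc (Suc k)) v i / \<mu>" for k i
  proof -
    have *: "(M ^^ k) (\<lambda>i. c * x i + d * y i) = (\<lambda>i. c * (M ^^ k) x i + d * (M ^^ k) y i)" for k c d x y
      by (induction k) (simp_all add: mat_vec_linear)
    have "M v = M (\<lambda>i. (\<theta> * \<alpha> / \<mu>) * u i + (1/\<mu>) * M v i)"
      by (rule mat_vec_cong) (use v1 in simp)
    then have "(M ^^ Suc k) v = (M ^^ Suc k) (\<lambda>i. (\<theta> * \<alpha> / \<mu>) * u i + (1/\<mu>) * M v i)"
      by (simp only: funpow_Suc_right o_apply)
    also have "\<dots> = (\<lambda>i. (\<theta> * \<alpha> / \<mu>) * (M ^^ Suc k) u i + (1/\<mu>) * (M ^^ Suc k) (M v) i)"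
      by (rule *)
    also have "(M ^^ Suc k) (M v) = (M ^^ Suc (Suc k)) v"
      by (simp only: funpow_Suc_right o_apply)
    finally show ?thesis
      by (simp only: times_divide_eq_left mult_1_left)
  qed
  show ?thesis
  proof (induction K)
    case 0
    then show ?case using v1[OF assms] by simp
  next
    case (Suc K)
    show ?case
      using Suc.IH Mv[of K i] \<mu>_pos by (simp add: field_simps)
  qed
qed

text \<open>Three contributions: the scalar error in front of \<open>u\<close>, the terms
  \<open>1..K\<close> of the series and the truncation, separated at the cost of a factor 27. Then
  \<open>2187 = 27 * 81\<close> comes from \<open>\<bar>c - 1\<bar> \<le> 3 * \<epsilon>\<close>,
  \<open>108 = 27 * 4\<close> from \<open>c ^ 4 \<le> 4\<close>, \<open>32 = 8 * 4\<close> from the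
  weights \<open>8 ^ k\<close> and \<open>\<theta> ^ 4 \<le> 4 * \<mu> ^ 4\<close>, and
  \<open>2 * \<epsilon>\<close> from \<open>\<theta> \<le> 2 * \<mu>\<close>.\<close>

lemma eigenvector_pow4_le:
  "pow4_sum n (\<lambda>i. v i - u i) \<le> 2187 * \<epsilon> ^ 4 * pow4_sum n u
     + 108 * (\<Sum>k=1..K. 32 ^ k * (pow4_sum n ((M ^^ k) u) / \<theta> ^ (4 * k)))
     + 27 * (2 * \<epsilon>) ^ (4 * Suc K)"
proof -
  define c where "c = \<theta> * \<alpha> / \<mu>"
  define r where "r = (\<lambda>i. (M ^^ Suc K) v i / \<mu> ^ Suc K)"
  have c: "0 \<le> c" "c \<le> 4/3" "\<bar>c - 1\<bar> \<le> 3 * \<epsilon>"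
  proof -
    show "0 \<le> c" using \<theta>_pos \<alpha>_ge \<mu>_pos by (simp add: c_def)
    have "\<theta> * \<alpha> \<le> \<theta> * 1" using \<alpha>_le_1 \<theta>_pos by (intro mult_left_mono) auto
    then show "c \<le> 4/3" using \<mu>_pos by (simp add: c_def pos_divide_le_eq)
    have "\<theta> * \<alpha> \<le> (1 + 3 * \<epsilon>) * \<mu>"
    proof -
      have "1 \<le> (1 + 3 * \<epsilon>) * (1 - \<epsilon>)"
      proof -
        have "(1 + 3 * \<epsilon>) * (1 - \<epsilon>) = 1 + \<epsilon> * (2 - 3 * \<epsilon>)" by (simp add: algebra_simps)
        moreover have "\<epsilon> * (2 - 3 * \<epsilon>) \<ge> 0" using \<epsilon> by (intro mult_nonneg_nonneg) auto
        ultimately show ?thesis by linarith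
      qed
      then have "1 * \<theta> \<le> (1 + 3 * \<epsilon>) * (1 - \<epsilon>) * \<theta>"
        using \<theta>_pos by (intro mult_right_mono) auto
      also have "\<dots> \<le> (1 + 3 * \<epsilon>) * \<mu>"
        using \<mu>_bounds(1) \<epsilon> unfolding mult.assoc by (intro mult_left_mono) auto
      finally show ?thesis using \<open>\<theta> * \<alpha> \<le> \<theta> * 1\<close> by linarith
    qed
    moreover have "(1 - 3 * \<epsilon>) * \<mu> \<le> \<theta> * \<alpha>"
    proof -
      have "(1 - 3 * \<epsilon>) * \<mu> \<le> (1 - 3 * \<epsilon>) * ((1 + \<epsilon>) * \<theta>)"
        using \<mu>_bounds(2) \<epsilon> by (intro mult_left_mono) auto
      also have "\<dots> = \<theta> * ((1 - 2 * \<epsilon>) - 3 * (\<epsilon> * \<epsilon>))" by (simp add: algebra_simps)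
      also have "\<dots> \<le> \<theta> * \<alpha>"
      proof (intro mult_left_mono)
        show "1 - 2 * \<epsilon> - 3 * (\<epsilon> * \<epsilon>) \<le> \<alpha>"
          using \<alpha>_ge(2) mult_nonneg_nonneg[OF \<epsilon>(1) \<epsilon>(1)] by linarith
      qed (use \<theta>_pos in simp)
      finally show ?thesis .
    qed
    ultimately show "\<bar>c - 1\<bar> \<le> 3 * \<epsilon>"
      using \<mu>_pos by (auto simp: c_def abs_le_iff field_simps)
  qed
  have z: "(v i - u i) ^ 4 \<le> 27 * (81 * \<epsilon> ^ 4 * u i ^ 4)
      + 27 * (\<Sum>k=1..K. 4 * (32 ^ k * ((M ^^ k) u i ^ 4 / \<theta> ^ (4 * k)))) + 27 * r i ^ 4" if "i < n" for i
  proof -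
    define S where "S = (\<Sum>k=1..K. (M ^^ k) u i / \<mu> ^ k)"
    have "(\<Sum>k\<le>K. (M ^^ k) u i / \<mu> ^ k) = u i + S"
      unfolding S_def by (simp add: sum.atMost_shift atLeast0AtMost[symmetric] sum.atLeast_Suc_atMost)
    then have "v i = c * (u i + S) + r i"
      using eigenvector_expansion[OF that, of K] by (simp only: c_def r_def)
    then have "v i - u i = (c - 1) * u i + c * S + r i"
      by (simp add: algebra_simps)
    moreover have "(x + y + w) ^ 4 \<le> 27 * (x ^ 4 + y ^ 4 + w ^ 4)" for x y w :: real
    proof -
      have "((x + y + w)\<^sup>2)\<^sup>2 \<le> (3 * (x\<^sup>2 + y\<^sup>2 + w\<^sup>2))\<^sup>2"
        by (intro power_mono add3_power2_le) auto
      also have "\<dots> = 3\<^sup>2 * (x\<^sup>2 + y\<^sup>2 + w\<^sup>2)\<^sup>2" by (rule power_mult_distrib)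
      also have "\<dots> = 9 * (x\<^sup>2 + y\<^sup>2 + w\<^sup>2)\<^sup>2" by simp
      also have "\<dots> \<le> 9 * (3 * ((x\<^sup>2)\<^sup>2 + (y\<^sup>2)\<^sup>2 + (w\<^sup>2)\<^sup>2))"
        by (intro mult_left_mono add3_power2_le) auto
      finally show ?thesis by (simp flip: power_mult)
    qed
    ultimately have "(v i - u i) ^ 4 \<le> 27 * (((c - 1) * u i) ^ 4 + (c * S) ^ 4 + r i ^ 4)"
      by simp
    also have "\<dots> = 27 * ((c - 1) ^ 4 * u i ^ 4) + 27 * (c ^ 4 * S ^ 4) + 27 * r i ^ 4"
      by (simp only: power_mult_distrib distrib_left)
    also have "\<dots> \<le> 27 * (81 * \<epsilon> ^ 4 * u i ^ 4)
        + 27 * (4 * (\<Sum>k=1..K. 8 ^ k * ((M ^^ k) u i / \<mu> ^ k) ^ 4)) + 27 * r i ^ 4"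
    proof (intro add_mono mult_left_mono order_refl)
      have "\<bar>c - 1\<bar> ^ 4 \<le> (3 * \<epsilon>) ^ 4" using c by (intro power_mono) auto
      then have "(c - 1) ^ 4 \<le> 81 * \<epsilon> ^ 4" by (simp add: power_even_abs power_mult_distrib)
      then show "(c - 1) ^ 4 * u i ^ 4 \<le> 81 * \<epsilon> ^ 4 * u i ^ 4"
        by (intro mult_right_mono) auto
      have "c ^ 4 \<le> (4/3) ^ 4" using c by (intro power_mono) auto
      also have "\<dots> \<le> (4::real)" by (simp add: power_divide)
      finally have "c ^ 4 \<le> 4" .
      then show "c ^ 4 * S ^ 4 \<le> 4 * (\<Sum>k=1..K. 8 ^ k * ((M ^^ k) u i / \<mu> ^ k) ^ 4)"
        unfolding S_def by (intro mult_mono sum_power4_le) auto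
    qed auto
    also have "(\<Sum>k=1..K. 8 ^ k * ((M ^^ k) u i / \<mu> ^ k) ^ 4)
        \<le> (\<Sum>k=1..K. 32 ^ k * ((M ^^ k) u i ^ 4 / \<theta> ^ (4 * k)))"
    proof (intro sum_mono)
      fix k
      have "8 ^ k * \<theta> ^ (4 * k) = (8 * \<theta> ^ 4) ^ k"
        by (simp add: power_mult_distrib power_mult)
      also have "\<dots> \<le> (32 * \<mu> ^ 4) ^ k"
      proof (intro power_mono)
        have "(3/4 * \<theta>) ^ 4 \<le> \<mu> ^ 4" using \<mu>_pos \<theta>_pos by (intro power_mono) auto
        then have "81 * \<theta> ^ 4 \<le> 256 * \<mu> ^ 4" by (simp add: power_mult_distrib power_divide)
        moreover have "0 \<le> \<mu> ^ 4" by simp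
        ultimately show "8 * \<theta> ^ 4 \<le> 32 * \<mu> ^ 4" by linarith
      qed auto
      also have "\<dots> = 32 ^ k * \<mu> ^ (4 * k)"
        by (simp add: power_mult_distrib power_mult)
      finally have "8 ^ k / \<mu> ^ (4 * k) \<le> 32 ^ k / \<theta> ^ (4 * k)"
        using \<theta>_pos \<mu>_pos by (simp add: divide_simps mult.commute)
      then have "8 ^ k / \<mu> ^ (4 * k) * (M ^^ k) u i ^ 4 \<le> 32 ^ k / \<theta> ^ (4 * k) * (M ^^ k) u i ^ 4"
        by (intro mult_right_mono) auto
      then show "8 ^ k * ((M ^^ k) u i / \<mu> ^ k) ^ 4 \<le> 32 ^ k * ((M ^^ k) u i ^ 4 / \<theta> ^ (4 * k))"
        by (simp add: power_divide power_mult[symmetric] mult.commute)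
    qed
    finally show ?thesis by (simp add: sum_distrib_left)
  qed
  have r: "pow4_sum n r \<le> (2 * \<epsilon>) ^ (4 * Suc K)"
  proof -
    have "dot n r r = dot n ((M ^^ Suc K) v) ((M ^^ Suc K) v) / (\<mu>\<^sup>2) ^ Suc K"
    proof -
      have "r = (\<lambda>i. (1 / \<mu> ^ Suc K) * (M ^^ Suc K) v i)" by (simp add: r_def)
      moreover have "(\<mu>\<^sup>2) ^ Suc K = \<mu> ^ Suc K * \<mu> ^ Suc K"
        by (simp only: power_mult[symmetric] mult_2 power_add)
      ultimately show ?thesis
        by (simp only: dot_scale_left dot_scale_right) (simp only: times_divide_eq_left mult_1_left divide_divide_eq_left)
    qed
    also have "\<dots> \<le> (((\<epsilon> * \<theta>)\<^sup>2) ^ Suc K) / (\<mu>\<^sup>2) ^ Suc K"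
      using op_bound_pow[OF h_bound, of "Suc K" v] by (intro divide_right_mono) (auto simp: v_unit)
    also have "\<dots> = ((\<epsilon> * \<theta> / \<mu>)\<^sup>2) ^ Suc K"
      by (simp only: power_divide)
    also have "\<dots> \<le> ((2 * \<epsilon>)\<^sup>2) ^ Suc K"
    proof (intro power_mono)
      have "\<epsilon> * \<theta> \<le> \<epsilon> * (2 * \<mu>)" using \<mu>_pos \<theta>_pos \<epsilon> by (intro mult_left_mono) auto
      then show "\<epsilon> * \<theta> / \<mu> \<le> 2 * \<epsilon>" using \<mu>_pos by (simp add: pos_divide_le_eq)
    qed (use \<epsilon> \<theta>_pos \<mu>_pos in auto)
    finally have "(dot n r r)\<^sup>2 \<le> (((2 * \<epsilon>)\<^sup>2) ^ Suc K)\<^sup>2"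
      by (intro power_mono) auto
    also have "\<dots> = (2 * \<epsilon>) ^ (4 * Suc K)"
    proof -
      have "2 * Suc K * 2 = 4 * Suc K" by simp
      then show ?thesis by (simp only: power_mult[symmetric])
    qed
    finally show ?thesis using pow4_sum_le_square[of n r] by linarith
  qed
  have "pow4_sum n (\<lambda>i. v i - u i) \<le> (\<Sum>i<n. 27 * (81 * \<epsilon> ^ 4 * u i ^ 4)
      + 27 * (\<Sum>k=1..K. 4 * (32 ^ k * ((M ^^ k) u i ^ 4 / \<theta> ^ (4 * k)))) + 27 * r i ^ 4)"
    unfolding pow4_sum_def by (intro sum_mono z) auto
  also have "\<dots> = 2187 * \<epsilon> ^ 4 * pow4_sum n u
     + 108 * (\<Sum>k=1..K. 32 ^ k * (pow4_sum n ((M ^^ k) u) / \<theta> ^ (4 * k))) + 27 * pow4_sum n r"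
  proof -
    have "(\<Sum>i<n. \<Sum>k=Suc 0..K. f i k) = (\<Sum>k=Suc 0..K. \<Sum>i<n. f i k)" for f :: "nat \<Rightarrow> nat \<Rightarrow> real"
      by (rule sum.swap)
    then show ?thesis
      by (simp add: sum.distrib pow4_sum_def sum_distrib_left sum_divide_distrib mult.assoc)
  qed
  finally show ?thesis using r by linarith
qed

text \<open>With \<open>z = v - u\<close>, each square is at most a combination of products of
  \<open>(z i)\<^sup>2\<close> and \<open>(u j)\<^sup>2\<close>; the nonnegative weights preserve
  this. The weight matrix is \<open>2 * \<theta>\<close> times a projection plus \<open>h\<close>,
  hence of norm at most \<open>3 * \<theta>\<close>, and it acts on vectors of squares, whose
  Euclidean norms are the square roots of \<open>pow4_sum\<close>. The parameter
  \<open>\<eta>\<close> is that of Young's inequality for the mixed terms.\<close>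

lemma weighted_projection_diff_le:
  assumes nonneg: "\<And>i j. i < n \<Longrightarrow> j < n \<Longrightarrow> a i j + \<theta> * (u i * u j) \<ge> 0" and "\<eta> > 0"
  shows "(\<Sum>i<n. \<Sum>j<n. (a i j + \<theta> * (u i * u j)) * (v i * v j - u i * u j)\<^sup>2)
    \<le> 9 * \<theta> * ((1 + 1 / \<eta>) * pow4_sum n (\<lambda>i. v i - u i) + \<eta> * pow4_sum n u)"
proof -
  let ?B = "\<lambda>i j. a i j + \<theta> * (u i * u j)"
  define z where "z = (\<lambda>i. v i - u i)"
  let ?sq = "\<lambda>x i. (x i)\<^sup>2 :: real"
  have form: "(\<Sum>i<n. \<Sum>j<n. ?B i j * (x i * y j)) \<le> 3 * \<theta> * (sqrt (dot n x x) * sqrt (dot n y y))" for x y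
  proof -
    have "(\<Sum>i<n. \<Sum>j<n. ?B i j * (x i * y j)) = 2 * \<theta> * (dot n u x * dot n u y) + dot n x (M y)"
    proof -
      have "(\<Sum>i<n. \<Sum>j<n. ?B i j * (x i * y j))
          = (\<Sum>i<n. \<Sum>j<n. 2 * \<theta> * ((u i * x i) * (u j * y j)) + x i * (h i j * y j))"
        by (intro sum.cong refl) (simp add: a_eq algebra_simps)
      also have "\<dots> = 2 * \<theta> * (\<Sum>i<n. \<Sum>j<n. (u i * x i) * (u j * y j))
          + (\<Sum>i<n. \<Sum>j<n. x i * (h i j * y j))"
        by (simp only: sum.distrib sum_distrib_left)
      also have "(\<Sum>i<n. \<Sum>j<n. (u i * x i) * (u j * y j)) = dot n u x * dot n u y"
        by (simp only: dot_def sum_product)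
      also have "(\<Sum>i<n. \<Sum>j<n. x i * (h i j * y j)) = dot n x (M y)"
        by (simp only: dot_def mat_vec_def sum_distrib_left)
      finally show ?thesis .
    qed
    also have "\<dots> \<le> 2 * \<theta> * (sqrt (dot n x x) * sqrt (dot n y y)) + \<epsilon> * \<theta> * sqrt (dot n x x) * sqrt (dot n y y)"
    proof (intro add_mono mult_left_mono)
      have "dot n u x * dot n u y \<le> \<bar>dot n u x\<bar> * \<bar>dot n u y\<bar>"
        by (simp only: abs_mult[symmetric] abs_ge_self)
      also have "\<dots> \<le> sqrt (dot n x x) * sqrt (dot n y y)"
        using abs_dot_le[of n u x] abs_dot_le[of n u y] by (intro mult_mono) (auto simp: u_unit)
      finally show "dot n u x * dot n u y \<le> sqrt (dot n x x) * sqrt (dot n y y)" .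
    qed (use bilinear[of x y] \<theta>_pos in auto)
    also have "\<dots> = (2 + \<epsilon>) * (\<theta> * (sqrt (dot n x x) * sqrt (dot n y y)))"
      by (simp add: algebra_simps)
    also have "\<dots> \<le> 3 * (\<theta> * (sqrt (dot n x x) * sqrt (dot n y y)))"
      using \<epsilon> \<theta>_pos by (intro mult_right_mono) auto
    finally show ?thesis by (simp add: mult.assoc)
  qed
  have "(v i * v j - u i * u j)\<^sup>2 \<le> 3 * ((?sq z i * ?sq u j + ?sq u i * ?sq z j) + ?sq z i * ?sq z j)" for i j
  proof -
    have "v i * v j - u i * u j = z i * u j + u i * z j + z i * z j"
      by (simp add: z_def algebra_simps)
    then show ?thesis using add3_power2_le[of "z i * u j" "u i * z j" "z i * z j"] by (simp add: power_mult_distrib)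
  qed
  then have "(\<Sum>i<n. \<Sum>j<n. ?B i j * (v i * v j - u i * u j)\<^sup>2)
      \<le> (\<Sum>i<n. \<Sum>j<n. ?B i j * (3 * ((?sq z i * ?sq u j + ?sq u i * ?sq z j) + ?sq z i * ?sq z j)))"
    using nonneg by (intro sum_mono mult_left_mono) auto
  also have "\<dots> = 3 * ((\<Sum>i<n. \<Sum>j<n. ?B i j * (?sq z i * ?sq u j))
      + (\<Sum>i<n. \<Sum>j<n. ?B i j * (?sq u i * ?sq z j)) + (\<Sum>i<n. \<Sum>j<n. ?B i j * (?sq z i * ?sq z j)))"
  proof -
    have "?B i j * (3 * ((?sq z i * ?sq u j + ?sq u i * ?sq z j) + ?sq z i * ?sq z j))
        = 3 * (?B i j * (?sq z i * ?sq u j)) + 3 * (?B i j * (?sq u i * ?sq z j))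
          + 3 * (?B i j * (?sq z i * ?sq z j))" for i j
      by (simp add: distrib_left mult_ac)
    then show ?thesis
      by (simp only: sum.distrib sum_distrib_left[symmetric] distrib_left)
  qed
  also have "\<dots> \<le> 3 * (3 * \<theta> * (sqrt (pow4_sum n z) * sqrt (pow4_sum n u))
      + 3 * \<theta> * (sqrt (pow4_sum n u) * sqrt (pow4_sum n z)) + 3 * \<theta> * (sqrt (pow4_sum n z) * sqrt (pow4_sum n z)))"
    using form[of "?sq z" "?sq u"] form[of "?sq u" "?sq z"] form[of "?sq z" "?sq z"]
    unfolding dot_squares by (intro mult_left_mono add_mono) auto
  also have "\<dots> = 9 * \<theta> * (2 * (sqrt (pow4_sum n z) * sqrt (pow4_sum n u)) + pow4_sum n z)"
    by (simp add: algebra_simps)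
  also have "\<dots> \<le> 9 * \<theta> * ((pow4_sum n z / \<eta> + \<eta> * pow4_sum n u) + pow4_sum n z)"
  proof (intro mult_left_mono add_right_mono)
    define p q where "p = sqrt (pow4_sum n z / \<eta>)" and "q = sqrt (\<eta> * pow4_sum n u)"
    have "2 * p * q \<le> p\<^sup>2 + q\<^sup>2" by (rule sum_squares_bound)
    moreover have "p * q = sqrt (pow4_sum n z) * sqrt (pow4_sum n u)"
      using \<open>\<eta> > 0\<close> by (simp add: p_def q_def real_sqrt_mult real_sqrt_divide)
    moreover have "p\<^sup>2 = pow4_sum n z / \<eta>" "q\<^sup>2 = \<eta> * pow4_sum n u"
      using \<open>\<eta> > 0\<close> by (simp_all add: p_def q_def)
    ultimately show "2 * (sqrt (pow4_sum n z) * sqrt (pow4_sum n u)) \<le> pow4_sum n z / \<eta> + \<eta> * pow4_sum n u"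
      by simp
  qed (use \<theta>_pos in auto)
  finally show ?thesis
    unfolding z_def by (simp add: algebra_simps)
qed

end

section \<open>The Chung-Lu matrix of a fixed size\<close>

lemma expectation_bern_prod_coordinate:
  fixes g :: "bool \<Rightarrow> real"
  assumes "finite S" "\<And>e. e \<in> S \<Longrightarrow> 0 \<le> p e \<and> p e \<le> 1" "e \<in> S"
  shows "bern_exp S p (\<lambda>\<eta>. g (\<eta> e)) = p e * g True + (1 - p e) * g False"
proof -
  have "bern_exp S p (\<lambda>\<eta>. \<Prod>x\<in>S. (if x = e then g (\<eta> x) else 1)) =
      (\<Prod>x\<in>S. of_real (p x) * (if x = e then g True else 1) + of_real (1 - p x) * (if x = e then g False else 1))"
    using assms by (intro expectation_prod_bern_prod) auto
  also have "\<dots> = (\<Prod>x\<in>S. if x = e then p e * g True + (1 - p e) * g False else 1)"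
    by (intro prod.cong) auto
  finally show ?thesis
    using assms by simp
qed

lemma covariance_bern_prod:
  assumes "finite S" and p: "\<And>e. e \<in> S \<Longrightarrow> 0 \<le> p e \<and> p e \<le> 1" and "e \<in> S" "e' \<in> S"
  shows "bern_exp S p (\<lambda>\<eta>. (of_bool (\<eta> e) - p e) * (of_bool (\<eta> e') - p e'))
    = (if e = e' then p e * (1 - p e) else 0)"
proof (cases "e = e'")
  case True
  have "bern_exp S p (\<lambda>\<eta>. (of_bool (\<eta> e) - p e) * (of_bool (\<eta> e) - p e))
      = p e * ((of_bool True - p e) * (of_bool True - p e))
        + (1 - p e) * ((of_bool False - p e) * (of_bool False - p e))"
    using assms by (intro expectation_bern_prod_coordinate[where g = "\<lambda>x. (of_bool x - p e) * (of_bool x - p e)"])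
  also have "\<dots> = p e * (1 - p e)" by (simp add: algebra_simps)
  finally show ?thesis using True by simp
next
  case False
  \<comment> \<open>For distinct edges the list \<open>[e, e']\<close> has two distinct elements and
    length 2, so the bound on the absolute value is 0.\<close>
  then show ?thesis
    using abs_expectation_prod_centered_le[of S "[e, e']" p 1] assms by simp
qed

text \<open>The number of ordered pairs that represent \<open>e\<close>. It mediates between the
  double sums of linear algebra and sums over independent entries, and its value 2 off the diagonal
  is the source of the limiting variance 2.\<close>

definition pair_mult :: "nat \<times> nat \<Rightarrow> real" where
  "pair_mult e = (if fst e = snd e then 1 else 2)"

lemma pair_mult_bounds: "1 \<le> pair_mult e" "pair_mult e \<le> 2"
  by (simp_all add: pair_mult_def)

lemma sum_uedge:
  fixes F :: "nat \<times> nat \<Rightarrow> real"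
  shows "(\<Sum>i<n. \<Sum>j<n. F (uedge i j)) = (\<Sum>e\<in>pairs n. pair_mult e * F e)"
proof -
  have fiber: "{x \<in> {..<n} \<times> {..<n}. uedge (fst x) (snd x) = e} = {e, (snd e, fst e)}" if "e \<in> pairs n" for e
    using that by (auto simp: pairs_def uedge_def min_def max_def split: if_splits)
  have "(\<Sum>i<n. \<Sum>j<n. F (uedge i j)) = (\<Sum>x\<in>{..<n} \<times> {..<n}. F (uedge (fst x) (snd x)))"
    by (simp add: sum.cartesian_product case_prod_unfold)
  also have "\<dots> = (\<Sum>e\<in>pairs n. \<Sum>x\<in>{x \<in> {..<n} \<times> {..<n}. uedge (fst x) (snd x) = e}. F (uedge (fst x) (snd x)))"
    by (rule sum.group[symmetric]) (auto intro!: uedge_in_pairs)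
  also have "\<dots> = (\<Sum>e\<in>pairs n. \<Sum>x\<in>{e, (snd e, fst e)}. F e)"
  proof (rule sum.cong[OF refl])
    fix e assume e: "e \<in> pairs n"
    have "(\<Sum>x\<in>{x \<in> {..<n} \<times> {..<n}. uedge (fst x) (snd x) = e}. F (uedge (fst x) (snd x)))
        = (\<Sum>x\<in>{x \<in> {..<n} \<times> {..<n}. uedge (fst x) (snd x) = e}. F e)"
      by (intro sum.cong) auto
    then show "(\<Sum>x\<in>{x \<in> {..<n} \<times> {..<n}. uedge (fst x) (snd x) = e}. F (uedge (fst x) (snd x)))
        = (\<Sum>x\<in>{e, (snd e, fst e)}. F e)"
      by (simp only: fiber[OF e])
  qed
  also have "\<dots> = (\<Sum>e\<in>pairs n. pair_mult e * F e)"
    by (intro sum.cong refl) (auto simp: pair_mult_def prod_eq_iff card_insert_if)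
  finally show ?thesis .
qed

text \<open>The degree conditions with explicit constants: all degrees lie between
  \<open>c * m\<close> and \<open>m\<close>. The assumption \<open>sparse\<close> keeps every edge
  probability at most 1/2, so the truncation in \<open>bernoulli_pmf\<close> never acts.\<close>

locale chung_lu_bounds =
  fixes n :: nat and d :: "nat \<Rightarrow> nat" and c m :: real
  assumes n_pos: "n > 0" and c: "0 < c" "c \<le> 1" and m: "m \<ge> 1"
    and d_bounds: "\<And>i. i < n \<Longrightarrow> c * m \<le> real (d i)" "\<And>i. i < n \<Longrightarrow> real (d i) \<le> m"
    and sparse: "m \<le> c * real n / 2"
begin

definition "\<theta> = deg_sum 2 n d / deg_sum 1 n d"
definition "u i = real (d i) / sqrt (deg_sum 2 n d)"
definition "P e = edge_prob n d (fst e) (snd e)"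
text \<open>A common upper bound for the edge probabilities: \<open>m * m\<close> divided by the
  lower bound \<open>c * m * real n\<close> for the sum of the degrees.\<close>

definition "q = m / (c * real n)"
definition "adj \<eta> i j = (of_bool (\<eta> (uedge i j)) :: real)"
definition "ctr \<eta> i j = of_bool (\<eta> (uedge i j)) - P (uedge i j)"
definition "good \<epsilon> \<eta> \<longleftrightarrow> op_bound n (ctr \<eta>) (\<epsilon> * \<theta>)"

abbreviation "G \<equiv> bern_prod (pairs n) P"
abbreviation "E \<equiv> measure_pmf.expectation G"

lemma chung_lu_eq: "chung_lu n d = G"
  by (simp add: chung_lu_def pairs_def P_def case_prod_unfold)

lemma expected_lambda1_eq: "expected_lambda1 n d = E (lambda1 n)"
  by (simp add: expected_lambda1_def chung_lu_eq)

lemma integrable_G [simp]: "integrable (measure_pmf G) (f :: _ \<Rightarrow> real)"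
  by simp

lemma E_mono: "(\<And>\<eta>. f \<eta> \<le> g \<eta>) \<Longrightarrow> E f \<le> E g" for f g :: "_ \<Rightarrow> real"
  by (intro integral_mono) auto

lemma d_pos: "i < n \<Longrightarrow> real (d i) > 0"
  using d_bounds(1)[of i] c m by (smt (verit) mult_pos_pos)

lemma deg_sum_Suc_bounds:
  "c * m * deg_sum k n d \<le> deg_sum (Suc k) n d" "deg_sum (Suc k) n d \<le> m * deg_sum k n d"
  unfolding deg_sum_def sum_distrib_left
  by (auto intro!: sum_mono mult_right_mono d_bounds)

lemma deg_sum_0: "deg_sum 0 n d = real n"
  by (simp add: deg_sum_def)

lemma cm_pos: "c * m > 0"
  using c m by simp

lemma deg_sum_pos: "deg_sum k n d > 0"
proof (induction k)
  case (Suc k)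
  then have "0 < c * m * deg_sum k n d" using cm_pos by simp
  then show ?case using deg_sum_Suc_bounds(1)[of k] by linarith
qed (use n_pos in \<open>simp add: deg_sum_0\<close>)

lemma deg_sum_1_bounds: "c * m * real n \<le> deg_sum 1 n d" "deg_sum 1 n d \<le> m * real n"
  using deg_sum_Suc_bounds[of 0] by (simp_all add: deg_sum_0)

lemma \<theta>_bounds: "c * m \<le> \<theta>" "\<theta> \<le> m"
  using deg_sum_Suc_bounds[of 1] deg_sum_pos[of 1]
  by (simp_all add: \<theta>_def pos_le_divide_eq pos_divide_le_eq numeral_2_eq_2)

lemma \<theta>_pos: "\<theta> > 0"
  using \<theta>_bounds cm_pos by linarith

lemma u_unit: "dot n u u = 1"
proof -
  have "dot n u u = (\<Sum>i<n. (real (d i))\<^sup>2) / deg_sum 2 n d"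
    using deg_sum_pos[of 2]
    by (simp add: dot_def u_def sum_divide_distrib power2_eq_square)
  then show ?thesis using deg_sum_pos[of 2] by (simp add: deg_sum_def)
qed

lemma u_sq_le: "i < n \<Longrightarrow> (u i)\<^sup>2 \<le> 1 / (c\<^sup>2 * real n)"
proof -
  assume i: "i < n"
  have "c * m * (c * m * real n) \<le> c * m * deg_sum 1 n d"
    using cm_pos deg_sum_1_bounds by (intro mult_left_mono) auto
  also have "\<dots> \<le> deg_sum 2 n d"
    using deg_sum_Suc_bounds(1)[of 1] by (simp add: numeral_2_eq_2)
  finally have m2: "m\<^sup>2 * (c\<^sup>2 * real n) \<le> deg_sum 2 n d"
    by (simp add: power2_eq_square mult_ac)
  have "(u i)\<^sup>2 = (real (d i))\<^sup>2 / deg_sum 2 n d"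
    using deg_sum_pos[of 2] by (simp add: u_def power_divide)
  also have "\<dots> \<le> m\<^sup>2 / (m\<^sup>2 * (c\<^sup>2 * real n))"
    using m2 d_bounds(2)[OF i] m c n_pos by (intro frac_le power_mono mult_pos_pos) auto
  also have "\<dots> = 1 / (c\<^sup>2 * real n)"
    using m by simp
  finally show ?thesis .
qed

lemma abs_u_le: "i < n \<Longrightarrow> \<bar>u i\<bar> \<le> 1 / (c * sqrt (real n))"
  using real_sqrt_le_mono[OF u_sq_le[of i]] c
  by (simp add: real_sqrt_divide real_sqrt_mult)

lemma pow4_u: "pow4_sum n u \<le> 1 / (c ^ 4 * real n)"
proof -
  have "u i ^ 4 \<le> (1 / (c\<^sup>2 * real n))\<^sup>2" if "i < n" for i
    using power_mono[OF u_sq_le[OF that], of 2] by (simp flip: power_mult)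
  then have "pow4_sum n u \<le> (\<Sum>i<n. (1 / (c\<^sup>2 * real n))\<^sup>2)"
    unfolding pow4_sum_def by (intro sum_mono) auto
  also have "\<dots> = 1 / (c ^ 4 * real n)"
    using n_pos c by (simp add: power2_eq_square power4_eq_xxxx field_simps)
  finally show ?thesis .
qed

lemma edge_prob_eq: "edge_prob n d i j = \<theta> * (u i * u j)"
  using deg_sum_pos[of 1] deg_sum_pos[of 2]
  by (simp add: edge_prob_def \<theta>_def u_def field_simps)

lemma P_uedge: "P (uedge i j) = \<theta> * (u i * u j)"
  by (auto simp: P_def uedge_def edge_prob_eq min_def max_def mult.commute)

lemma q_bounds: "0 < q" "q \<le> 1/2" "real n * q = m / c"
proof -
  show "0 < q" using n_pos c m by (simp add: q_def)
  show "q \<le> 1/2" using sparse n_pos c by (simp add: q_def pos_divide_le_eq)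
  show "real n * q = m / c" using n_pos by (simp add: q_def)
qed

lemma edge_prob_bounds:
  assumes "i < n" "j < n"
  shows "0 < edge_prob n d i j" "edge_prob n d i j \<le> q"
proof -
  show "0 < edge_prob n d i j"
    using assms d_pos deg_sum_pos[of 1] by (simp add: edge_prob_def)
  have "edge_prob n d i j \<le> (m * m) / (c * m * real n)"
    unfolding edge_prob_def using deg_sum_1_bounds d_bounds assms cm_pos n_pos m
    by (intro frac_le mult_mono) auto
  then show "edge_prob n d i j \<le> q" using m by (simp add: q_def)
qed

lemma P_bounds: "e \<in> pairs n \<Longrightarrow> 0 \<le> P e \<and> P e \<le> q"
  using edge_prob_bounds[of "fst e" "snd e"] by (auto simp: P_def pairs_def intro: less_imp_le)

lemma P_le_1: "e \<in> pairs n \<Longrightarrow> 0 \<le> P e \<and> P e \<le> 1"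
  using P_bounds[of e] q_bounds by auto

lemma adj_eq: "adj \<eta> i j = \<theta> * (u i * u j) + ctr \<eta> i j"
  by (simp add: adj_def ctr_def P_uedge)

lemma adj_mat_eq: "adj_mat n \<eta> = mat n n (\<lambda>(i, j). adj \<eta> i j)"
  by (simp add: adj_mat_def adj_def uedge_def)

lemma adj_sym: "adj \<eta> i j = adj \<eta> j i"
  by (simp add: adj_def uedge_commute)

lemma ctr_sym: "ctr \<eta> i j = ctr \<eta> j i"
  by (simp add: ctr_def uedge_commute)

text \<open>Chosen for every graph, also off the good event, because the flip argument compares top
  eigenvectors of arbitrary configurations. The law is discrete, so the choice raises no question of
  measurability.\<close>

definition "top_vec \<eta> = (SOME v. dot n v v = 1 \<and> dot n u v \<ge> 0 \<and>
   (\<forall>i<n. mat_vec n (adj \<eta>) v i = lambda1 n \<eta> * v i))"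

lemma top_vec:
  "dot n (top_vec \<eta>) (top_vec \<eta>) = 1" "dot n u (top_vec \<eta>) \<ge> 0"
  "i < n \<Longrightarrow> mat_vec n (adj \<eta>) (top_vec \<eta>) i = lambda1 n \<eta> * top_vec \<eta> i"
  and Rayleigh: "dot n x (mat_vec n (adj \<eta>) x) \<le> lambda1 n \<eta> * dot n x x"
proof -
  obtain v where v: "dot n v v = 1"
      "\<And>i. i < n \<Longrightarrow> mat_vec n (adj \<eta>) v i = lambda1 n \<eta> * v i"
    and R: "\<And>x. dot n x (mat_vec n (adj \<eta>) x) \<le> lambda1 n \<eta> * dot n x x"
    unfolding lambda1_def adj_mat_eq
    by (rule largest_eigenvalue_variational[OF n_pos, of "adj \<eta>"]) (auto simp: adj_sym)
  show "dot n x (mat_vec n (adj \<eta>) x) \<le> lambda1 n \<eta> * dot n x x" by (rule R)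
  define s :: real where "s = (if dot n u v \<ge> 0 then 1 else -1)"
  have s: "s * s = 1" "s * dot n u v \<ge> 0" by (auto simp: s_def)
  have w: "dot n (\<lambda>i. s * v i) (\<lambda>i. s * v i) = 1 \<and> dot n u (\<lambda>i. s * v i) \<ge> 0 \<and>
      (\<forall>i<n. mat_vec n (adj \<eta>) (\<lambda>i. s * v i) i = lambda1 n \<eta> * (s * v i))"
    using s v unfolding dot_linear mat_vec_linear by (auto simp: mult.assoc[symmetric])
  have "\<exists>v. dot n v v = 1 \<and> dot n u v \<ge> 0 \<and> (\<forall>i<n. mat_vec n (adj \<eta>) v i = lambda1 n \<eta> * v i)"
    by (rule exI[of _ "\<lambda>i. s * v i"]) (rule w)
  then have "dot n (top_vec \<eta>) (top_vec \<eta>) = 1 \<and> dot n u (top_vec \<eta>) \<ge> 0 \<and>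
      (\<forall>i<n. mat_vec n (adj \<eta>) (top_vec \<eta>) i = lambda1 n \<eta> * top_vec \<eta> i)"
    unfolding top_vec_def by (rule someI_ex)
  then show "dot n (top_vec \<eta>) (top_vec \<eta>) = 1" "dot n u (top_vec \<eta>) \<ge> 0"
    "i < n \<Longrightarrow> mat_vec n (adj \<eta>) (top_vec \<eta>) i = lambda1 n \<eta> * top_vec \<eta> i"
    by auto
qed

abbreviation "bad_prob \<epsilon> \<equiv> E (\<lambda>\<eta>. of_bool (\<not> good \<epsilon> \<eta>) :: real)"

abbreviation "dev4 \<epsilon> \<equiv> E (\<lambda>\<eta>. of_bool (good \<epsilon> \<eta>) * pow4_sum n (\<lambda>i. top_vec \<eta> i - u i))"

lemma quad_top_vec: "dot n (top_vec \<eta>) (mat_vec n (adj \<eta>) (top_vec \<eta>)) = lambda1 n \<eta>"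
proof -
  have "dot n (top_vec \<eta>) (mat_vec n (adj \<eta>) (top_vec \<eta>)) = dot n (top_vec \<eta>) (\<lambda>i. lambda1 n \<eta> * top_vec \<eta> i)"
    by (rule dot_cong) (auto simp: top_vec)
  then show ?thesis by (simp add: dot_linear top_vec)
qed

lemma good_perturbed:
  assumes "good \<epsilon> \<eta>" "0 \<le> \<epsilon>" "\<epsilon> \<le> 1/4"
  shows "perturbed_rank_one n u (top_vec \<eta>) \<theta> \<epsilon> (lambda1 n \<eta>) (adj \<eta>) (ctr \<eta>)"
  by unfold_locales
     (use assms in \<open>auto simp: good_def u_unit \<theta>_pos top_vec Rayleigh intro: adj_eq ctr_sym\<close>)

lemma moment_bound:
  assumes "k > 0" "\<And>j. j < n \<Longrightarrow> \<bar>x j\<bar> \<le> X" "X \<ge> 0" "i < n" "r * k = 2 * h" "h > 0" "2 * real h \<le> m / c"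
  shows "E (\<lambda>\<eta>. ((mat_vec n (ctr \<eta>) ^^ k) x i) ^ r) \<le> X ^ r * (8 * real h * (m / c)) ^ h"
proof -
  have "E (\<lambda>\<eta>. ((mat_vec n (ctr \<eta>) ^^ k) x i) ^ r) \<le> X ^ r * (8 * real h * (real n * q)) ^ h"
    unfolding ctr_def[abs_def] using assms q_bounds P_bounds
    by (intro expectation_mat_vec_pow_power_le) auto
  then show ?thesis by (simp add: q_bounds)
qed

text \<open>Markov's inequality for \<open>frob_pow\<close> at exponent \<open>K\<close>: each of
  the \<open>n\<^sup>2\<close> squared entries has mean at most
  \<open>(8 * real K * (m / c)) ^ K\<close>, to be compared with
  \<open>(\<epsilon> * (c * m)) ^ (2 * K)\<close>.\<close>

lemma prob_bad:
  assumes "\<epsilon> > 0" and K: "K = 2 ^ l" "2 * real K \<le> m / c"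
  shows "bad_prob \<epsilon> \<le> (real n)\<^sup>2 * (8 * real K / (c ^ 3 * \<epsilon>\<^sup>2 * m)) ^ K"
proof -
  have "K > 0" using K by simp
  let ?F = "\<lambda>\<eta>. frob_pow n (ctr \<eta>) K"
  have pos: "(\<epsilon> * \<theta>) ^ (2 * K) > 0" using assms \<theta>_pos by simp
  have ind: "of_bool (\<not> good \<epsilon> \<eta>) \<le> ?F \<eta> / (\<epsilon> * \<theta>) ^ (2 * K)" for \<eta>
  proof (cases "good \<epsilon> \<eta>")
    case True
    then show ?thesis using pos by (simp add: frob_pow_def sum_nonneg)
  next
    case False
    then have "\<not> ?F \<eta> \<le> (\<epsilon> * \<theta>) ^ (2 * K)"
      unfolding good_def K(1) using op_bound_of_frob_pow[of "ctr \<eta>" n l "\<epsilon> * \<theta>", OF ctr_sym] by blast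
    then show ?thesis using pos False by (simp add: pos_le_divide_eq)
  qed
  have "E ?F = (\<Sum>i<n. \<Sum>j<n. E (\<lambda>\<eta>. ((mat_vec n (ctr \<eta>) ^^ K) (unit_vec_fun j) i)\<^sup>2))"
    unfolding frob_pow_def by (simp add: Bochner_Integration.integral_sum)
  also have "\<dots> \<le> (\<Sum>i<n. \<Sum>j<n. 1 ^ 2 * (8 * real K * (m / c)) ^ K)"
    using K \<open>K > 0\<close> by (intro sum_mono moment_bound) (auto simp: unit_vec_fun_def)
  also have "\<dots> = (real n)\<^sup>2 * (8 * real K * (m / c)) ^ K"
    by (simp add: power2_eq_square)
  finally have EF: "E ?F \<le> (real n)\<^sup>2 * (8 * real K * (m / c)) ^ K" .
  have "bad_prob \<epsilon> \<le> E (\<lambda>\<eta>. ?F \<eta> / (\<epsilon> * \<theta>) ^ (2 * K))"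
    by (intro E_mono ind)
  also have "\<dots> = E ?F / (\<epsilon> * \<theta>) ^ (2 * K)"
    by simp
  also have "\<dots> \<le> ((real n)\<^sup>2 * (8 * real K * (m / c)) ^ K) / (\<epsilon> * (c * m)) ^ (2 * K)"
    using EF \<theta>_bounds assms cm_pos c m
    by (intro frac_le power_mono mult_left_mono zero_less_power mult_pos_pos) auto
  also have "(\<epsilon> * (c * m)) ^ (2 * K) = ((\<epsilon> * (c * m))\<^sup>2) ^ K"
    by (simp only: power_mult)
  also have "((real n)\<^sup>2 * (8 * real K * (m / c)) ^ K) / ((\<epsilon> * (c * m))\<^sup>2) ^ K
      = (real n)\<^sup>2 * ((8 * real K * (m / c)) / (\<epsilon> * (c * m))\<^sup>2) ^ K"
    by (simp only: power_divide times_divide_eq_right)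
  also have "(8 * real K * (m / c)) / (\<epsilon> * (c * m))\<^sup>2 = 8 * real K / (c ^ 3 * \<epsilon>\<^sup>2 * m)"
    using c m by (simp add: power2_eq_square power3_eq_cube)
  finally show ?thesis .
qed

text \<open>The flatness of \<open>u\<close> survives in the moments: \<open>n\<close> entries, each
  with the factor \<open>X ^ 4\<close> for \<open>X = 1 / (c * sqrt (real n))\<close>, leave an
  overall factor of order 1/n.\<close>

lemma pow4_moment:
  assumes "k > 0" "4 * real k \<le> m / c"
  shows "E (\<lambda>\<eta>. pow4_sum n ((mat_vec n (ctr \<eta>) ^^ k) u)) \<le> (16 * real k * (m / c)) ^ (2 * k) / (c ^ 4 * real n)"
proof -
  have "E (\<lambda>\<eta>. pow4_sum n ((mat_vec n (ctr \<eta>) ^^ k) u)) =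
      (\<Sum>i<n. E (\<lambda>\<eta>. ((mat_vec n (ctr \<eta>) ^^ k) u i) ^ 4))"
    unfolding pow4_sum_def by (simp add: Bochner_Integration.integral_sum)
  also have "\<dots> \<le> (\<Sum>i<n. (1 / (c * sqrt (real n))) ^ 4 * (8 * real (2 * k) * (m / c)) ^ (2 * k))"
    using assms c by (intro sum_mono moment_bound abs_u_le) auto
  also have "\<dots> = real n * (1 / (c * sqrt (real n))) ^ 4 * (16 * real k * (m / c)) ^ (2 * k)"
    by simp
  also have "real n * (1 / (c * sqrt (real n))) ^ 4 = 1 / (c ^ 4 * real n)"
  proof -
    have "sqrt (real n) ^ 4 = (sqrt (real n) ^ 2) ^ 2" by (simp only: power_mult[symmetric]) simp
    also have "\<dots> = real n ^ 2" by simp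
    finally have "(c * sqrt (real n)) ^ 4 = c ^ 4 * (real n * real n)"
      by (simp add: power_mult_distrib power2_eq_square)
    then show ?thesis using n_pos by (simp add: power_divide)
  qed
  finally show ?thesis by simp
qed

text \<open>The \<open>k\<close>-th term of the series has mean at most
  \<open>y ^ k / (c ^ 4 * real n)\<close>: \<open>8192 = 32 * 256\<close> joins the weight
  \<open>32 ^ k\<close> to the square of the 16 in the moment bound, and replacing \<open>k\<close>
  by \<open>K\<close> makes the ratio uniform. Only the truncation term comes without the factor
  1/n.\<close>

lemma pow4_eigenvector:
  assumes \<epsilon>: "0 \<le> \<epsilon>" "\<epsilon> \<le> 1/4" and K: "4 * real K \<le> m / c"
    and y: "8192 * (real K)\<^sup>2 / (c ^ 6 * m\<^sup>2) \<le> y" "y \<le> 1/2"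
  shows "dev4 \<epsilon>
    \<le> (2187 * \<epsilon> ^ 4 + 216 * y) / (c ^ 4 * real n) + 27 * (2 * \<epsilon>) ^ (4 * Suc K)"
proof -
  let ?z4 = "\<lambda>\<eta>. pow4_sum n (\<lambda>i. top_vec \<eta> i - u i)"
  let ?Mk = "\<lambda>\<eta> k. pow4_sum n ((mat_vec n (ctr \<eta>) ^^ k) u)"
  define R where "R = 27 * (2 * \<epsilon>) ^ (4 * Suc K)"
  have R: "R \<ge> 0" using \<epsilon> by (simp add: R_def)
  have "0 \<le> 8192 * (real K)\<^sup>2 / (c ^ 6 * m\<^sup>2)" using c m by simp
  then have y0: "y \<ge> 0" using y(1) by linarith
  have "of_bool (good \<epsilon> \<eta>) * ?z4 \<eta> \<le> 2187 * \<epsilon> ^ 4 * pow4_sum n u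
      + 108 * (\<Sum>k=1..K. 32 ^ k * (?Mk \<eta> k / \<theta> ^ (4 * k))) + R" (is "_ \<le> ?rhs \<eta>") for \<eta>
  proof (cases "good \<epsilon> \<eta>")
    case True
    then interpret perturbed_rank_one n u "top_vec \<eta>" \<theta> \<epsilon> "lambda1 n \<eta>" "adj \<eta>" "ctr \<eta>"
      using good_perturbed \<epsilon> by blast
    show ?thesis using eigenvector_pow4_le[of K] True by (simp add: R_def)
  next
    case False
    have "0 \<le> ?rhs \<eta>"
      using \<epsilon> \<theta>_pos R by (intro add_nonneg_nonneg mult_nonneg_nonneg sum_nonneg divide_nonneg_nonneg) auto
    then show ?thesis using False by simp
  qed
  then have "E (\<lambda>\<eta>. of_bool (good \<epsilon> \<eta>) * ?z4 \<eta>) \<le> E ?rhs"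
    by (rule E_mono)
  also have "\<dots> = 2187 * \<epsilon> ^ 4 * pow4_sum n u
      + 108 * (\<Sum>k=1..K. 32 ^ k * (E (\<lambda>\<eta>. ?Mk \<eta> k) / \<theta> ^ (4 * k))) + R"
    by (simp add: Bochner_Integration.integral_sum)
  also have "\<dots> \<le> 2187 * \<epsilon> ^ 4 * (1 / (c ^ 4 * real n)) + 108 * (2 * y / (c ^ 4 * real n)) + R"
  proof (intro add_mono mult_left_mono order_refl pow4_u)
    have term_le: "32 ^ k * (E (\<lambda>\<eta>. ?Mk \<eta> k) / \<theta> ^ (4 * k)) \<le> (1 / (c ^ 4 * real n)) * y ^ k"
      if k: "k \<in> {1..K}" for k
    proof -
      have kK: "0 < k" "real k \<le> real K" using k by auto
      have "E (\<lambda>\<eta>. ?Mk \<eta> k) / \<theta> ^ (4 * k) \<le>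
          ((16 * real k * (m / c)) ^ (2 * k) / (c ^ 4 * real n)) / (c * m) ^ (4 * k)"
        using pow4_moment[of k] kK K \<theta>_bounds cm_pos n_pos c m
        by (intro frac_le power_mono) auto
      also have "\<dots> = (1 / (c ^ 4 * real n)) * ((16 * real k * (m / c)) ^ (2 * k) / (c * m) ^ (4 * k))"
        by simp
      also have "(16 * real k * (m / c)) ^ (2 * k) / (c * m) ^ (4 * k) = (256 * (real k)\<^sup>2 / (c ^ 6 * m\<^sup>2)) ^ k"
      proof -
        have "(16 * real k * (m / c)) ^ (2 * k) / (c * m) ^ (4 * k)
            = ((16 * real k * (m / c))\<^sup>2 / (c * m) ^ 4) ^ k"
          by (simp only: power_mult power_divide)
        also have "(16 * real k * (m / c))\<^sup>2 / (c * m) ^ 4 = 256 * (real k)\<^sup>2 / (c ^ 6 * m\<^sup>2)"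
          using c m by (simp add: field_simps power2_eq_square power4_eq_xxxx eval_nat_numeral)
        finally show ?thesis .
      qed
      finally have "32 ^ k * (E (\<lambda>\<eta>. ?Mk \<eta> k) / \<theta> ^ (4 * k)) \<le>
          32 ^ k * ((1 / (c ^ 4 * real n)) * (256 * (real k)\<^sup>2 / (c ^ 6 * m\<^sup>2)) ^ k)"
        by (intro mult_left_mono) auto
      also have "\<dots> = (1 / (c ^ 4 * real n)) * (32 ^ k * (256 * (real k)\<^sup>2 / (c ^ 6 * m\<^sup>2)) ^ k)"
        by (simp only: mult_ac)
      also have "32 ^ k * (256 * (real k)\<^sup>2 / (c ^ 6 * m\<^sup>2)) ^ k = (8192 * (real k)\<^sup>2 / (c ^ 6 * m\<^sup>2)) ^ k"
        unfolding power_mult_distrib[symmetric] by simp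
      also have "(1 / (c ^ 4 * real n)) * (8192 * (real k)\<^sup>2 / (c ^ 6 * m\<^sup>2)) ^ k \<le> (1 / (c ^ 4 * real n)) * y ^ k"
      proof (intro mult_left_mono power_mono)
        have "8192 * (real k)\<^sup>2 / (c ^ 6 * m\<^sup>2) \<le> 8192 * (real K)\<^sup>2 / (c ^ 6 * m\<^sup>2)"
          using kK c m by (intro divide_right_mono mult_left_mono power_mono) auto
        then show "8192 * (real k)\<^sup>2 / (c ^ 6 * m\<^sup>2) \<le> y" using y by linarith
      qed (use c m in auto)
      finally show ?thesis .
    qed
    \<comment> \<open>The factor \<open>1 - (1/2) ^ N\<close> is a strengthening that closes the
      induction; the bare bound \<open>2 * y\<close> is not inductive.\<close>
    have geom: "(\<Sum>k=1..N. y ^ k) \<le> 2 * y * (1 - (1/2) ^ N)" for N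
    proof (induction N)
      case (Suc N)
      have "y ^ Suc N \<le> y * (1/2) ^ N"
        using y0 y(2) by (simp add: power_mono mult_left_mono)
      then show ?case using Suc by (simp add: algebra_simps)
    qed simp
    have "(\<Sum>k=1..K. 32 ^ k * (E (\<lambda>\<eta>. ?Mk \<eta> k) / \<theta> ^ (4 * k))) \<le> (\<Sum>k=1..K. (1 / (c ^ 4 * real n)) * y ^ k)"
      by (intro sum_mono term_le)
    also have "\<dots> = (1 / (c ^ 4 * real n)) * (\<Sum>k=1..K. y ^ k)"
      by (simp only: sum_distrib_left)
    also have "\<dots> \<le> (1 / (c ^ 4 * real n)) * (2 * y)"
    proof (intro mult_left_mono)
      have "2 * y * (1 - (1/2) ^ K) \<le> 2 * y * 1"
        using y0 by (intro mult_left_mono) auto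
      then show "(\<Sum>k=1..K. y ^ k) \<le> 2 * y" using geom[of K] by linarith
    qed (use c in auto)
    finally show "(\<Sum>k=1..K. 32 ^ k * (E (\<lambda>\<eta>. ?Mk \<eta> k) / \<theta> ^ (4 * k))) \<le> 2 * y / (c ^ 4 * real n)"
      by simp
  qed (use \<epsilon> in auto)
  also have "\<dots> = (2187 * \<epsilon> ^ 4 + 216 * y) / (c ^ 4 * real n) + R"
    by (simp add: add_divide_distrib)
  finally show ?thesis by (simp add: R_def)
qed

end

section \<open>Variance and mean of the largest eigenvalue\<close>

text \<open>Efron-Stein produces functions of configurations with one coordinate forced. Read from
  right to left, these identities turn them back into expectations under the law itself, at the
  price of an indicator.\<close>

lemma bern_prod_condition:
  fixes F :: "('a \<Rightarrow> bool) \<Rightarrow> real"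
  assumes "finite S" "e \<in> S" "0 \<le> p e" "p e \<le> 1"
  shows "bern_exp S p (\<lambda>\<eta>. of_bool (\<eta> e) * F \<eta>)
      = p e * bern_exp S p (\<lambda>\<eta>. F (\<eta>(e := True)))"
    and "bern_exp S p (\<lambda>\<eta>. of_bool (\<not> \<eta> e) * F \<eta>)
      = (1 - p e) * bern_exp S p (\<lambda>\<eta>. F (\<eta>(e := False)))"
proof -
  have S: "insert e (S - {e}) = S" using assms by auto
  have split: "bern_exp S p h =
      p e * bern_exp (S - {e}) p (\<lambda>\<eta>. h (\<eta>(e := True)))
      + (1 - p e) * bern_exp (S - {e}) p (\<lambda>\<eta>. h (\<eta>(e := False)))"
    for h :: "_ \<Rightarrow> real"
    using expectation_bern_prod_insert[of "S - {e}" e p h] assms unfolding S by simp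
  show "bern_exp S p (\<lambda>\<eta>. of_bool (\<eta> e) * F \<eta>)
      = p e * bern_exp S p (\<lambda>\<eta>. F (\<eta>(e := True)))"
    by (simp add: split algebra_simps)
  show "bern_exp S p (\<lambda>\<eta>. of_bool (\<not> \<eta> e) * F \<eta>)
      = (1 - p e) * bern_exp S p (\<lambda>\<eta>. F (\<eta>(e := False)))"
    by (simp add: split algebra_simps)
qed

lemma linear_form_moments:
  assumes S: "finite S" and p: "\<And>e. e \<in> S \<Longrightarrow> 0 \<le> p e \<and> p e \<le> 1"
  shows "bern_exp S p (\<lambda>\<eta>. \<Sum>e\<in>S. t e * (of_bool (\<eta> e) - p e)) = 0"
    and "bern_exp S p (\<lambda>\<eta>. (\<Sum>e\<in>S. t e * (of_bool (\<eta> e) - p e))\<^sup>2)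
      = (\<Sum>e\<in>S. (t e)\<^sup>2 * (p e * (1 - p e)))"
proof -
  have "bern_exp S p (\<lambda>\<eta>. of_bool (\<eta> e) - p e) = 0" if "e \<in> S" for e
  proof -
    have "bern_exp S p (\<lambda>\<eta>. of_bool (\<eta> e) - p e)
        = p e * (of_bool True - p e) + (1 - p e) * (of_bool False - p e)"
      using assms that by (intro expectation_bern_prod_coordinate[where g = "\<lambda>b. of_bool b - p e"])
    also have "\<dots> = 0" by (simp add: algebra_simps)
    finally show ?thesis .
  qed
  then show "bern_exp S p (\<lambda>\<eta>. \<Sum>e\<in>S. t e * (of_bool (\<eta> e) - p e)) = 0"
    using S by (simp add: Bochner_Integration.integral_sum)
  have "bern_exp S p (\<lambda>\<eta>. (\<Sum>e\<in>S. t e * (of_bool (\<eta> e) - p e))\<^sup>2)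
      = bern_exp S p
         (\<lambda>\<eta>. \<Sum>e\<in>S. \<Sum>e'\<in>S. (t e * t e') * ((of_bool (\<eta> e) - p e) * (of_bool (\<eta> e') - p e')))"
    by (simp only: power2_eq_square sum_product mult_ac)
  also have "\<dots> = (\<Sum>e\<in>S. \<Sum>e'\<in>S. (t e * t e') * (if e = e' then p e * (1 - p e) else 0))"
  proof -
    have "bern_exp S p (\<lambda>\<eta>. (of_bool (\<eta> e) - p e) * (of_bool (\<eta> e') - p e'))
        = (if e = e' then p e * (1 - p e) else 0)" if "e \<in> S" "e' \<in> S" for e e'
      using assms that by (intro covariance_bern_prod)
    then show ?thesis using S by (simp add: Bochner_Integration.integral_sum)
  qed
  also have "\<dots> = (\<Sum>e\<in>S. (t e)\<^sup>2 * (p e * (1 - p e)))"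
    using S by (simp add: if_distrib power2_eq_square cong: if_cong)
  finally show "bern_exp S p (\<lambda>\<eta>. (\<Sum>e\<in>S. t e * (of_bool (\<eta> e) - p e))\<^sup>2)
      = (\<Sum>e\<in>S. (t e)\<^sup>2 * (p e * (1 - p e)))" .
qed

text \<open>The trivial norm bound, used where the good event fails.\<close>

lemma op_bound_of_entries_le_1:
  assumes "\<And>i j. i < n \<Longrightarrow> j < n \<Longrightarrow> \<bar>a i j\<bar> \<le> 1"
  shows "op_bound n a (real n)"
  unfolding op_bound_def
proof
  fix x
  have "(mat_vec n a x i)\<^sup>2 \<le> real n * dot n x x" if "i < n" for i
  proof -
    have "(mat_vec n a x i)\<^sup>2 \<le> (\<Sum>j<n. (a i j)\<^sup>2) * (\<Sum>j<n. (x j)\<^sup>2)"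
      using Cauchy_Schwarz_ineq_sum[of "a i" x "{..<n}"] by (simp add: mat_vec_def)
    also have "\<dots> \<le> (\<Sum>j<n. 1) * (\<Sum>j<n. (x j)\<^sup>2)"
      using assms that by (intro mult_right_mono sum_mono sum_nonneg) (auto simp: abs_square_le_1)
    finally show ?thesis by (simp add: dot_def power2_eq_square)
  qed
  then have "dot n (mat_vec n a x) (mat_vec n a x) \<le> (\<Sum>i<n. real n * dot n x x)"
    unfolding dot_def[of n "mat_vec n a x"] power2_eq_square[symmetric] by (intro sum_mono) auto
  then show "dot n (mat_vec n a x) (mat_vec n a x) \<le> (real n)\<^sup>2 * dot n x x"
    by (simp add: power2_eq_square)
qed

lemma uedge_sym_apply:
  assumes "\<And>i j. F i j = F j i"
  shows "F (fst (uedge i j)) (snd (uedge i j)) = F i j"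
  using assms by (auto simp: uedge_def min_def max_def)

lemma quad_pairs:
  "dot n x (mat_vec n (\<lambda>i j. \<phi> (uedge i j)) x)
    = (\<Sum>e\<in>pairs n. pair_mult e * (\<phi> e * (x (fst e) * x (snd e))))"
proof -
  have "dot n x (mat_vec n (\<lambda>i j. \<phi> (uedge i j)) x) = (\<Sum>i<n. \<Sum>j<n. \<phi> (uedge i j) * (x i * x j))"
    by (simp add: dot_def mat_vec_def sum_distrib_left mult_ac)
  also have "\<dots> = (\<Sum>i<n. \<Sum>j<n. \<phi> (uedge i j) * (x (fst (uedge i j)) * x (snd (uedge i j))))"
    by (simp only: uedge_sym_apply[of "\<lambda>i j. x i * x j", OF mult.commute])
  also have "\<dots> = (\<Sum>e\<in>pairs n. pair_mult e * (\<phi> e * (x (fst e) * x (snd e))))"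
    by (rule sum_uedge)
  finally show ?thesis .
qed

lemma square_between_le: "a \<le> t \<Longrightarrow> t \<le> b \<Longrightarrow> t\<^sup>2 \<le> a\<^sup>2 + (b::real)\<^sup>2"
proof -
  assume "a \<le> t" "t \<le> b"
  then have "\<bar>t\<bar> \<le> \<bar>b\<bar> \<or> \<bar>t\<bar> \<le> \<bar>a\<bar>" by linarith
  then have "t\<^sup>2 \<le> b\<^sup>2 \<or> t\<^sup>2 \<le> a\<^sup>2" by (simp only: abs_le_square_iff)
  moreover have "0 \<le> a\<^sup>2" "0 \<le> b\<^sup>2" by simp_all
  ultimately show ?thesis by linarith
qed

section \<open>Variance of the nonlinear part\<close>

context chung_lu_bounds
begin

abbreviation "quad \<eta> x \<equiv> dot n x (mat_vec n (adj \<eta>) x)"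

lemma quad_flip:
  assumes "e \<in> pairs n"
  shows "quad (\<eta>(e := True)) x - quad (\<eta>(e := False)) x = pair_mult e * (x (fst e) * x (snd e))"
proof -
  have q: "quad \<eta> x = (\<Sum>e\<in>pairs n. pair_mult e * (of_bool (\<eta> e) * (x (fst e) * x (snd e))))" for \<eta>
    unfolding adj_def[abs_def] by (rule quad_pairs)
  have "quad (\<eta>(e := True)) x - quad (\<eta>(e := False)) x
      = (\<Sum>e'\<in>pairs n. if e' = e then pair_mult e * (x (fst e) * x (snd e)) else 0)"
    unfolding q sum_subtractf[symmetric] by (intro sum.cong) auto
  then show ?thesis using assms by simp
qed

text \<open>Subtracting the quadratic form at the fixed vector \<open>u\<close> removes the linear
  fluctuation, so a flip only sees the difference between the projections onto the top eigenvector
  and onto \<open>u\<close>.\<close>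

definition "remainder \<eta> = lambda1 n \<eta> - quad \<eta> u"

definition "gap \<eta> e = (top_vec \<eta> (fst e) * top_vec \<eta> (snd e) - u (fst e) * u (snd e))\<^sup>2"

lemma gap_nonneg: "0 \<le> gap \<eta> e"
  by (simp add: gap_def)

text \<open>The Rayleigh quotient bounds the increment of the largest eigenvalue from both sides, so
  no second-order perturbation theory is needed.\<close>

lemma remainder_flip_le:
  assumes e: "e \<in> pairs n"
  shows "(remainder (\<eta>(e := True)) - remainder (\<eta>(e := False)))\<^sup>2
    \<le> 4 * (gap (\<eta>(e := True)) e + gap (\<eta>(e := False)) e)"
proof -
  let ?\<eta>1 = "\<eta>(e := True)" and ?\<eta>0 = "\<eta>(e := False)"
  let ?v1 = "top_vec ?\<eta>1" and ?v0 = "top_vec ?\<eta>0"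
  let ?pr = "\<lambda>x. x (fst e) * x (snd e) :: real"
  let ?t = "remainder ?\<eta>1 - remainder ?\<eta>0"
  have "quad ?\<eta>1 ?v0 \<le> lambda1 n ?\<eta>1" "quad ?\<eta>0 ?v1 \<le> lambda1 n ?\<eta>0"
    using Rayleigh[of ?v0 ?\<eta>1] Rayleigh[of ?v1 ?\<eta>0] top_vec(1) by simp_all
  moreover have "quad ?\<eta>1 ?v1 = lambda1 n ?\<eta>1" "quad ?\<eta>0 ?v0 = lambda1 n ?\<eta>0"
    by (rule quad_top_vec)+
  moreover note quad_flip[OF e, of ?v0 \<eta>] quad_flip[OF e, of ?v1 \<eta>] quad_flip[OF e, of u \<eta>]
  ultimately have "pair_mult e * ?pr ?v0 - pair_mult e * ?pr u \<le> ?t"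
      "?t \<le> pair_mult e * ?pr ?v1 - pair_mult e * ?pr u"
    unfolding remainder_def by linarith+
  then have "?t\<^sup>2 \<le> (pair_mult e * ?pr ?v0 - pair_mult e * ?pr u)\<^sup>2 + (pair_mult e * ?pr ?v1 - pair_mult e * ?pr u)\<^sup>2"
    by (rule square_between_le)
  also have "\<dots> = (pair_mult e)\<^sup>2 * (gap ?\<eta>1 e + gap ?\<eta>0 e)"
    unfolding right_diff_distrib[symmetric] gap_def power_mult_distrib by (simp add: distrib_left)
  also have "\<dots> \<le> 2\<^sup>2 * (gap ?\<eta>1 e + gap ?\<eta>0 e)"
    using pair_mult_bounds[of e] gap_nonneg by (intro mult_right_mono power_mono add_nonneg_nonneg) auto
  finally show ?thesis by simp
qed

definition "spread \<eta> = (\<Sum>i<n. \<Sum>j<n. (adj \<eta> i j + \<theta> * (u i * u j)) *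
   (top_vec \<eta> i * top_vec \<eta> j - u i * u j)\<^sup>2)"

lemma spread_eq: "spread \<eta> = (\<Sum>e\<in>pairs n. pair_mult e * ((of_bool (\<eta> e) + P e) * gap \<eta> e))"
proof -
  let ?F = "\<lambda>i j. (top_vec \<eta> i * top_vec \<eta> j - u i * u j)\<^sup>2"
  have "?F i j = gap \<eta> (uedge i j)" for i j
    using uedge_sym_apply[of ?F i j] unfolding gap_def by (simp add: mult.commute)
  then have "spread \<eta> = (\<Sum>i<n. \<Sum>j<n. (of_bool (\<eta> (uedge i j)) + P (uedge i j)) * gap \<eta> (uedge i j))"
    unfolding spread_def by (simp only: adj_def P_uedge)
  also have "\<dots> = (\<Sum>e\<in>pairs n. pair_mult e * ((of_bool (\<eta> e) + P e) * gap \<eta> e))"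
    by (rule sum_uedge)
  finally show ?thesis .
qed

text \<open>The weight \<open>P e * (1 - P e)\<close> splits: the factor \<open>P e\<close> turns
  the term with \<open>e\<close> present into an expectation over graphs containing
  \<open>e\<close>, and \<open>1 - P e\<close> does the same for its absence.\<close>

lemma variance_remainder_le_spread:
  "E (\<lambda>\<eta>. (remainder \<eta>)\<^sup>2) - (E remainder)\<^sup>2 \<le> 4 * E spread"
proof -
  have step: "P e * (1 - P e) * E (\<lambda>\<eta>. (remainder (\<eta>(e := True)) - remainder (\<eta>(e := False)))\<^sup>2)
      \<le> 4 * E (\<lambda>\<eta>. pair_mult e * ((of_bool (\<eta> e) + P e) * gap \<eta> e))" if e: "e \<in> pairs n" for e
  proof -
    have P: "0 \<le> P e" "P e \<le> 1" using P_le_1[OF e] by auto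
    have nn: "0 \<le> E (\<lambda>\<eta>. F \<eta> * gap \<eta> e)" if "\<And>\<eta>. 0 \<le> F \<eta>" for F
      by (intro Bochner_Integration.integral_nonneg mult_nonneg_nonneg that gap_nonneg)
    have "P e * (1 - P e) * E (\<lambda>\<eta>. (remainder (\<eta>(e := True)) - remainder (\<eta>(e := False)))\<^sup>2)
        \<le> P e * (1 - P e) * E (\<lambda>\<eta>. 4 * (gap (\<eta>(e := True)) e + gap (\<eta>(e := False)) e))"
      using P by (intro mult_left_mono E_mono remainder_flip_le e) auto
    also have "\<dots> = 4 * ((1 - P e) * (P e * E (\<lambda>\<eta>. gap (\<eta>(e := True)) e))
        + P e * ((1 - P e) * E (\<lambda>\<eta>. gap (\<eta>(e := False)) e)))"
      by (simp add: algebra_simps)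
    also have "\<dots> = 4 * ((1 - P e) * E (\<lambda>\<eta>. of_bool (\<eta> e) * gap \<eta> e)
        + P e * E (\<lambda>\<eta>. of_bool (\<not> \<eta> e) * gap \<eta> e))"
      using bern_prod_condition[of "pairs n" e P "\<lambda>\<eta>. gap \<eta> e"] e P by simp
    \<comment> \<open>Here \<open>1 - P e\<close> is bounded by 1 and the indicator of absence is
      dropped. The surviving weights are the adjacency matrix plus its mean, which has norm at most
      \<open>3 * \<theta>\<close> on the good event.\<close>
    also have "\<dots> \<le> 4 * (1 * E (\<lambda>\<eta>. of_bool (\<eta> e) * gap \<eta> e) + P e * E (\<lambda>\<eta>. gap \<eta> e))"
      using P gap_nonneg
      by (intro mult_left_mono add_mono mult_right_mono E_mono nn) (auto simp: of_bool_def)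
    also have "\<dots> = 4 * E (\<lambda>\<eta>. 1 * ((of_bool (\<eta> e) + P e) * gap \<eta> e))"
      by (simp add: distrib_right)
    also have "\<dots> \<le> 4 * E (\<lambda>\<eta>. pair_mult e * ((of_bool (\<eta> e) + P e) * gap \<eta> e))"
      using P gap_nonneg pair_mult_bounds
      by (intro mult_left_mono E_mono mult_right_mono mult_nonneg_nonneg) auto
    finally show ?thesis .
  qed
  have "E (\<lambda>\<eta>. (remainder \<eta>)\<^sup>2) - (E remainder)\<^sup>2
      \<le> (\<Sum>e\<in>pairs n. P e * (1 - P e) * E (\<lambda>\<eta>. (remainder (\<eta>(e := True)) - remainder (\<eta>(e := False)))\<^sup>2))"
    by (rule bern_prod_Efron_Stein) (auto simp: P_le_1)
  also have "\<dots> \<le> (\<Sum>e\<in>pairs n. 4 * E (\<lambda>\<eta>. pair_mult e * ((of_bool (\<eta> e) + P e) * gap \<eta> e)))"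
    by (intro sum_mono step)
  also have "\<dots> = 4 * E spread"
    unfolding spread_eq by (simp only: sum_distrib_left Bochner_Integration.integral_sum integrable_G)
  finally show ?thesis .
qed

lemma adj_bounds: "0 \<le> adj \<eta> i j" "adj \<eta> i j \<le> 1"
  by (simp_all add: adj_def)

text \<open>Valid on every graph: the weights are at most 2, and the squared entries of the
  difference of two rank-one projections sum to at most \<open>2 * 1 + 2 * 1\<close>.\<close>

lemma spread_le_8: "spread \<eta> \<le> 8"
proof -
  let ?v = "top_vec \<eta>"
  have "spread \<eta> \<le> (\<Sum>i<n. \<Sum>j<n. 2 * (2 * ((?v i * ?v i) * (?v j * ?v j)) + 2 * ((u i * u i) * (u j * u j))))"
    unfolding spread_def
  proof (intro sum_mono)
    fix i j assume ij: "i \<in> {..<n}" "j \<in> {..<n}"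
    have "0 \<le> \<theta> * (u i * u j)" "\<theta> * (u i * u j) \<le> 1"
      using edge_prob_bounds[of i j] ij q_bounds unfolding edge_prob_eq by auto
    then have B: "0 \<le> adj \<eta> i j + \<theta> * (u i * u j)" "adj \<eta> i j + \<theta> * (u i * u j) \<le> 2"
      using adj_bounds[of \<eta> i j] by linarith+
    have "0 \<le> (?v i * ?v j + u i * u j)\<^sup>2" by simp
    then have "(?v i * ?v j - u i * u j)\<^sup>2 \<le> 2 * (?v i * ?v j)\<^sup>2 + 2 * (u i * u j)\<^sup>2"
      by (simp add: power2_sum power2_diff)
    also have "\<dots> = 2 * ((?v i * ?v i) * (?v j * ?v j)) + 2 * ((u i * u i) * (u j * u j))"
      by (simp add: power2_eq_square mult_ac)
    finally show "(adj \<eta> i j + \<theta> * (u i * u j)) * (?v i * ?v j - u i * u j)\<^sup>2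
        \<le> 2 * (2 * ((?v i * ?v i) * (?v j * ?v j)) + 2 * ((u i * u i) * (u j * u j)))"
      using B by (intro mult_mono) auto
  qed
  also have "\<dots> = 2 * (2 * (dot n ?v ?v * dot n ?v ?v) + 2 * (dot n u u * dot n u u))"
    by (simp only: sum.distrib sum_distrib_left[symmetric] sum_distrib_right[symmetric] dot_def)
  finally show ?thesis by (simp add: top_vec u_unit)
qed

text \<open>\<open>36 = 4 * 9\<close> combines Efron-Stein with the bound on the good event,
  \<open>32 = 4 * 8\<close> with the deterministic bound off it. The Young parameter
  \<open>\<kappa>\<close> stays free so that it can be matched to \<open>\<epsilon>\<close>
  later.\<close>

lemma variance_remainder_le:
  assumes \<epsilon>: "0 \<le> \<epsilon>" "\<epsilon> \<le> 1/4" and "\<kappa> > 0"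
    and Z: "dev4 \<epsilon> \<le> Z"
  shows "E (\<lambda>\<eta>. (remainder \<eta>)\<^sup>2) - (E remainder)\<^sup>2
    \<le> 36 * m * ((1 + 1 / \<kappa>) * Z + \<kappa> / (c ^ 4 * real n)) + 32 * bad_prob \<epsilon>"
proof -
  let ?z4 = "\<lambda>\<eta>. pow4_sum n (\<lambda>i. top_vec \<eta> i - u i)"
  have k: "1 + 1 / \<kappa> \<ge> 0" using \<open>\<kappa> > 0\<close> by simp
  have "spread \<eta> \<le> 9 * \<theta> * ((1 + 1 / \<kappa>) * (of_bool (good \<epsilon> \<eta>) * ?z4 \<eta>) + \<kappa> * pow4_sum n u)
      + 8 * of_bool (\<not> good \<epsilon> \<eta>)" for \<eta>
  proof (cases "good \<epsilon> \<eta>")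
    case True
    then interpret perturbed_rank_one n u "top_vec \<eta>" \<theta> \<epsilon> "lambda1 n \<eta>" "adj \<eta>" "ctr \<eta>"
      using good_perturbed \<epsilon> by blast
    have "0 \<le> adj \<eta> i j + \<theta> * (u i * u j)" if "i < n" "j < n" for i j
      using adj_bounds[of \<eta> i j] edge_prob_bounds[OF that] unfolding edge_prob_eq by linarith
    from weighted_projection_diff_le[OF this \<open>\<kappa> > 0\<close>] show ?thesis
      using True by (simp add: spread_def)
  next
    case False
    have "0 \<le> 9 * \<theta> * (\<kappa> * pow4_sum n u)"
      using \<theta>_pos \<open>\<kappa> > 0\<close> by (intro mult_nonneg_nonneg) auto
    moreover have "9 * \<theta> * ((1 + 1 / \<kappa>) * (of_bool (good \<epsilon> \<eta>) * ?z4 \<eta>) + \<kappa> * pow4_sum n u)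
        + 8 * of_bool (\<not> good \<epsilon> \<eta>) = 9 * \<theta> * (\<kappa> * pow4_sum n u) + 8"
      using False by simp
    ultimately show ?thesis using spread_le_8[of \<eta>] by linarith
  qed
  then have "E spread \<le> E (\<lambda>\<eta>. 9 * \<theta> * ((1 + 1 / \<kappa>) * (of_bool (good \<epsilon> \<eta>) * ?z4 \<eta>) + \<kappa> * pow4_sum n u)
      + 8 * of_bool (\<not> good \<epsilon> \<eta>))"
    by (rule E_mono)
  also have "\<dots> = 9 * \<theta> * ((1 + 1 / \<kappa>) * E (\<lambda>\<eta>. of_bool (good \<epsilon> \<eta>) * ?z4 \<eta>) + \<kappa> * pow4_sum n u)
      + 8 * bad_prob \<epsilon>"
    by (simp only: Bochner_Integration.integral_add integrable_G integral_mult_right_zero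
        measure_pmf.prob_space lebesgue_integral_const scaleR_one measure_pmf_UNIV)
  also have "\<dots> \<le> 9 * m * ((1 + 1 / \<kappa>) * Z + \<kappa> * (1 / (c ^ 4 * real n)))
      + 8 * bad_prob \<epsilon>"
    using \<theta>_bounds Z k \<open>\<kappa> > 0\<close> pow4_u m
    by (intro add_right_mono mult_mono add_mono mult_left_mono add_nonneg_nonneg mult_nonneg_nonneg
        Bochner_Integration.integral_nonneg) auto
  finally have "4 * E spread \<le> 4 * (9 * m * ((1 + 1 / \<kappa>) * Z + \<kappa> * (1 / (c ^ 4 * real n)))
      + 8 * bad_prob \<epsilon>)"
    by (intro mult_left_mono) auto
  also have "\<dots> = 36 * m * ((1 + 1 / \<kappa>) * Z + \<kappa> / (c ^ 4 * real n)) + 32 * bad_prob \<epsilon>"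
    by (simp only: distrib_left) simp
  finally show ?thesis using variance_remainder_le_spread by linarith
qed

section \<open>Mean of the largest eigenvalue\<close>

definition "lin \<eta> = dot n u (mat_vec n (ctr \<eta>) u)"
definition "sq \<eta> = dot n (mat_vec n (ctr \<eta>) u) (mat_vec n (ctr \<eta>) u)"

lemma lin_eq: "lin \<eta> = (\<Sum>e\<in>pairs n. (pair_mult e * (u (fst e) * u (snd e))) * (of_bool (\<eta> e) - P e))"
  unfolding lin_def ctr_def[abs_def] quad_pairs[of n u "\<lambda>e. of_bool (\<eta> e) - P e"]
  by (simp only: mult_ac)

lemma quad_u: "quad \<eta> u = \<theta> + lin \<eta>"
proof -
  have "mat_vec n (adj \<eta>) u = (\<lambda>i. \<theta> * u i + mat_vec n (ctr \<eta>) u i)"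
  proof
    fix i
    have "mat_vec n (adj \<eta>) u i = (\<Sum>j<n. \<theta> * u i * (u j * u j) + ctr \<eta> i j * u j)"
      unfolding mat_vec_def by (intro sum.cong refl) (simp add: adj_eq algebra_simps)
    also have "\<dots> = \<theta> * u i * dot n u u + mat_vec n (ctr \<eta>) u i"
      by (simp only: sum.distrib sum_distrib_left dot_def mat_vec_def)
    finally show "mat_vec n (adj \<eta>) u i = \<theta> * u i + mat_vec n (ctr \<eta>) u i"
      by (simp add: u_unit)
  qed
  then show ?thesis by (simp add: dot_linear u_unit lin_def)
qed

lemma E_lin: "E lin = 0"
  unfolding lin_eq[abs_def] by (rule linear_form_moments) (auto simp: P_le_1)

lemma E_lin_sq: "E (\<lambda>\<eta>. (lin \<eta>)\<^sup>2) \<le> 1"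
proof -
  let ?uu = "\<lambda>e. u (fst e) * u (snd e)"
  have "E (\<lambda>\<eta>. (lin \<eta>)\<^sup>2) = (\<Sum>e\<in>pairs n. (pair_mult e * ?uu e)\<^sup>2 * (P e * (1 - P e)))"
    unfolding lin_eq by (rule linear_form_moments) (auto simp: P_le_1)
  also have "\<dots> \<le> (\<Sum>e\<in>pairs n. pair_mult e * (2 * q * (?uu e)\<^sup>2))"
  proof (intro sum_mono)
    fix e assume e: "e \<in> pairs n"
    have "P e * (1 - P e) \<le> q * 1" using P_bounds[OF e] P_le_1[OF e] by (intro mult_mono) auto
    then have "(pair_mult e * ?uu e)\<^sup>2 * (P e * (1 - P e)) \<le> (pair_mult e * ?uu e)\<^sup>2 * q"
      by (intro mult_left_mono) auto
    also have "\<dots> = pair_mult e * (pair_mult e * (q * (?uu e)\<^sup>2))"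
      by (simp add: power2_eq_square)
    also have "\<dots> \<le> pair_mult e * (2 * (q * (?uu e)\<^sup>2))"
      using pair_mult_bounds[of e] q_bounds by (intro mult_left_mono mult_right_mono) auto
    finally show "(pair_mult e * ?uu e)\<^sup>2 * (P e * (1 - P e)) \<le> pair_mult e * (2 * q * (?uu e)\<^sup>2)"
      by (simp only: mult.assoc)
  qed
  also have "\<dots> = (\<Sum>i<n. \<Sum>j<n. 2 * q * (?uu (uedge i j))\<^sup>2)"
    by (rule sum_uedge[symmetric])
  also have "\<dots> = (\<Sum>i<n. \<Sum>j<n. 2 * q * ((u i * u i) * (u j * u j)))"
    by (simp only: uedge_sym_apply[of "\<lambda>i j. u i * u j", OF mult.commute]) (simp only: power2_eq_square mult_ac)
  also have "\<dots> = 2 * q * (dot n u u * dot n u u)"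
    by (simp only: sum_distrib_left[symmetric] sum_distrib_right[symmetric] dot_def)
  finally show ?thesis using q_bounds by (simp add: u_unit)
qed

lemma E_abs_lin: "E (\<lambda>\<eta>. \<bar>lin \<eta>\<bar>) \<le> 1"
proof -
  have "\<bar>x\<bar> \<le> 1/2 * (1 + x\<^sup>2)" for x :: real
    using sum_squares_bound[of 1 "\<bar>x\<bar>"] by simp
  then have "E (\<lambda>\<eta>. \<bar>lin \<eta>\<bar>) \<le> E (\<lambda>\<eta>. 1/2 * (1 + (lin \<eta>)\<^sup>2))"
    by (intro E_mono)
  also have "\<dots> = 1/2 * (1 + E (\<lambda>\<eta>. (lin \<eta>)\<^sup>2))" by simp
  finally show ?thesis using E_lin_sq by simp
qed

text \<open>The entries of one row belong to distinct edges, hence are uncorrelated.\<close>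

lemma E_sq_eq: "E sq = (\<Sum>i<n. \<Sum>j<n. (u j)\<^sup>2 * (edge_prob n d i j * (1 - edge_prob n d i j)))"
proof -
  have "E (\<lambda>\<eta>. (mat_vec n (ctr \<eta>) u i)\<^sup>2) = (\<Sum>j<n. (u j)\<^sup>2 * (edge_prob n d i j * (1 - edge_prob n d i j)))"
    if i: "i < n" for i
  proof -
    let ?c = "\<lambda>\<eta> j. of_bool (\<eta> (uedge i j)) - P (uedge i j)"
    have "E (\<lambda>\<eta>. (mat_vec n (ctr \<eta>) u i)\<^sup>2) = E (\<lambda>\<eta>. \<Sum>j<n. \<Sum>j'<n. (u j * u j') * (?c \<eta> j * ?c \<eta> j'))"
      by (simp only: mat_vec_def ctr_def power2_eq_square sum_product mult_ac)
    also have "\<dots> = (\<Sum>j<n. \<Sum>j'<n. (u j * u j') * E (\<lambda>\<eta>. ?c \<eta> j * ?c \<eta> j'))"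
      by (simp add: Bochner_Integration.integral_sum)
    also have "\<dots> = (\<Sum>j<n. \<Sum>j'<n. (u j * u j') * (if j = j' then P (uedge i j) * (1 - P (uedge i j)) else 0))"
    proof (intro sum.cong refl arg_cong2[where f = "(*)"])
      fix j j' assume "j \<in> {..<n}" "j' \<in> {..<n}"
      then have "E (\<lambda>\<eta>. ?c \<eta> j * ?c \<eta> j')
          = (if uedge i j = uedge i j' then P (uedge i j) * (1 - P (uedge i j)) else 0)"
        using i by (intro covariance_bern_prod) (auto simp: P_le_1 intro: uedge_in_pairs)
      moreover have "uedge i j = uedge i j' \<longleftrightarrow> j = j'"
        using inj_uedge[of i] by (auto simp: inj_def)
      ultimately show "E (\<lambda>\<eta>. ?c \<eta> j * ?c \<eta> j') = (if j = j' then P (uedge i j) * (1 - P (uedge i j)) else 0)"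
        by simp
    qed
    also have "\<dots> = (\<Sum>j<n. (u j)\<^sup>2 * (P (uedge i j) * (1 - P (uedge i j))))"
      by (simp add: if_distrib power2_eq_square cong: if_cong)
    finally show ?thesis by (simp add: P_uedge edge_prob_eq)
  qed
  then show ?thesis
    unfolding sq_def[abs_def] dot_def power2_eq_square[symmetric]
    by (simp add: Bochner_Integration.integral_sum)
qed

text \<open>With loops included, the edge probabilities at vertex \<open>j\<close> sum to exactly
  \<open>d j\<close>. Division of the result by \<open>\<theta>\<close> gives the second term of
  part (I).\<close>

lemma sum_u_sq_edge_prob: "(\<Sum>i<n. \<Sum>j<n. (u j)\<^sup>2 * edge_prob n d i j) = deg_sum 3 n d / deg_sum 2 n d"
proof -
  have "(\<Sum>i<n. edge_prob n d i j) = real (d j)" for j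
  proof -
    have "(\<Sum>i<n. edge_prob n d i j) = (\<Sum>i<n. real (d i)) * real (d j) / deg_sum 1 n d"
      by (simp add: edge_prob_def sum_distrib_right sum_divide_distrib)
    then show ?thesis using deg_sum_pos[of 1] by (simp add: deg_sum_def)
  qed
  then have "(\<Sum>j<n. \<Sum>i<n. (u j)\<^sup>2 * edge_prob n d i j) = (\<Sum>j<n. (u j)\<^sup>2 * real (d j))"
    by (simp only: sum_distrib_left[symmetric])
  also have "\<dots> = deg_sum 3 n d / deg_sum 2 n d"
    using deg_sum_pos[of 2]
    by (simp add: u_def power_divide deg_sum_def[of 3] sum_divide_distrib power2_eq_square power3_eq_cube)
  finally show ?thesis by (subst sum.swap)
qed

lemma E_sq_bounds:
  "E sq \<le> deg_sum 3 n d / deg_sum 2 n d" "(1 - q) * (deg_sum 3 n d / deg_sum 2 n d) \<le> E sq"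
proof -
  show "E sq \<le> deg_sum 3 n d / deg_sum 2 n d"
    unfolding E_sq_eq sum_u_sq_edge_prob[symmetric]
    using edge_prob_bounds by (intro sum_mono mult_left_mono) (auto simp: mult_left_le less_imp_le)
  show "(1 - q) * (deg_sum 3 n d / deg_sum 2 n d) \<le> E sq"
    unfolding E_sq_eq sum_u_sq_edge_prob[symmetric] sum_distrib_left
  proof (intro sum_mono)
    fix i j assume "i \<in> {..<n}" "j \<in> {..<n}"
    then have p: "0 < edge_prob n d i j" "edge_prob n d i j \<le> q" using edge_prob_bounds by auto
    have "(1 - q) * ((u j)\<^sup>2 * edge_prob n d i j) \<le> (1 - edge_prob n d i j) * ((u j)\<^sup>2 * edge_prob n d i j)"
      using p by (intro mult_right_mono) auto
    then show "(1 - q) * ((u j)\<^sup>2 * edge_prob n d i j) \<le> (u j)\<^sup>2 * (edge_prob n d i j * (1 - edge_prob n d i j))"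
      by (simp only: mult_ac)
  qed
qed

lemma abs_bounds_any:
  "\<bar>lambda1 n \<eta>\<bar> \<le> real n" "\<bar>lin \<eta>\<bar> \<le> real n" "0 \<le> sq \<eta>" "sq \<eta> \<le> (real n)\<^sup>2"
proof -
  have "op_bound n (adj \<eta>) (real n)"
    using adj_bounds[of \<eta>] by (intro op_bound_of_entries_le_1) auto
  from op_bound_bilinear[OF this, of "top_vec \<eta>" "top_vec \<eta>"]
  show "\<bar>lambda1 n \<eta>\<bar> \<le> real n"
    by (simp add: quad_top_vec top_vec)
  have "\<bar>ctr \<eta> i j\<bar> \<le> 1" if "i < n" "j < n" for i j
    using P_le_1[OF uedge_in_pairs[OF that]] by (auto simp: ctr_def abs_le_iff of_bool_def)
  then have ob: "op_bound n (ctr \<eta>) (real n)"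
    by (rule op_bound_of_entries_le_1)
  from op_bound_bilinear[OF this, of u u] show "\<bar>lin \<eta>\<bar> \<le> real n"
    by (simp add: lin_def u_unit)
  show "0 \<le> sq \<eta>" by (simp add: sq_def)
  show "sq \<eta> \<le> (real n)\<^sup>2"
    using ob by (auto simp: op_bound_def sq_def u_unit dest: spec[of _ u])
qed

text \<open>The linear term is centred and the quadratic one is known up to a factor between
  \<open>1 - q\<close> and 1, which accounts for \<open>q / c\<close>. Off the good event a
  deterministic bound of order \<open>(real n)\<^sup>2 / c\<close> is charged to the
  probability.\<close>

lemma E_lambda1_expansion:
  assumes \<epsilon>: "0 \<le> \<epsilon>" "\<epsilon> \<le> 1/4"
  shows "\<bar>E (lambda1 n) - (deg_sum 2 n d / deg_sum 1 n d
      + deg_sum 1 n d * deg_sum 3 n d / (deg_sum 2 n d)\<^sup>2)\<bar>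
    \<le> 7 * \<epsilon> * (1 + 1 / c) + 5 * (real n)\<^sup>2 / c * bad_prob \<epsilon> + q / c"
proof -
  let ?R = "\<lambda>\<eta>. lambda1 n \<eta> - \<theta> - lin \<eta> - sq \<eta> / \<theta>"
  let ?bad = "\<lambda>\<eta>. of_bool (\<not> good \<epsilon> \<eta>) :: real"
  define D where "D = deg_sum 3 n d / deg_sum 2 n d / \<theta>"
  have D: "D \<le> 1 / c" "D \<ge> 0"
  proof -
    have "deg_sum 3 n d / deg_sum 2 n d \<le> m"
      using deg_sum_Suc_bounds(2)[of 2] deg_sum_pos[of 2] by (simp add: pos_divide_le_eq numeral_3_eq_3 numeral_2_eq_2)
    then have "D \<le> m / (c * m)"
      unfolding D_def using \<theta>_bounds cm_pos m deg_sum_pos[of 3] deg_sum_pos[of 2] by (intro frac_le) auto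
    then show "D \<le> 1 / c" using m by simp
    show "D \<ge> 0" using deg_sum_pos[of 3] deg_sum_pos[of 2] \<theta>_pos by (simp add: D_def)
  qed
  have D': "deg_sum 1 n d * deg_sum 3 n d / (deg_sum 2 n d)\<^sup>2 = D"
    using deg_sum_pos[of 1] deg_sum_pos[of 2] by (simp add: D_def \<theta>_def power2_eq_square)
  have Esq: "E sq / \<theta> \<le> D" "(1 - q) * D \<le> E sq / \<theta>"
    using divide_right_mono[OF E_sq_bounds(1), of \<theta>] divide_right_mono[OF E_sq_bounds(2), of \<theta>] \<theta>_pos
    by (simp_all only: D_def times_divide_eq_right less_imp_le)
  have n1: "real n \<ge> 1" using n_pos by simp
  have "\<bar>?R \<eta>\<bar> \<le> 7 * \<epsilon> * (\<bar>lin \<eta>\<bar> + sq \<eta> / \<theta>) + 5 * (real n)\<^sup>2 / c * ?bad \<eta>" for \<eta>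
  proof (cases "good \<epsilon> \<eta>")
    case True
    then interpret perturbed_rank_one n u "top_vec \<eta>" \<theta> \<epsilon> "lambda1 n \<eta>" "adj \<eta>" "ctr \<eta>"
      using good_perturbed \<epsilon> by blast
    show ?thesis using \<mu>_expansion True by (simp add: lin_def sq_def s_def b_def)
  next
    case False
    have \<theta>n: "\<theta> \<le> real n"
    proof -
      have "c * real n / 2 \<le> 1 * real n / 2" using c by (intro divide_right_mono mult_right_mono) auto
      then show ?thesis using \<theta>_bounds sparse by simp
    qed
    have "c * 1 \<le> c * m" using c m by (intro mult_left_mono) auto
    then have "c \<le> \<theta>" using \<theta>_bounds by linarith
    then have sq\<theta>: "0 \<le> sq \<eta> / \<theta>" "sq \<eta> / \<theta> \<le> (real n)\<^sup>2 / c"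
      using abs_bounds_any[of \<eta>] c \<theta>_pos by (auto intro!: frac_le)
    have "real n * 1 \<le> real n * (real n / c)"
      using n1 c by (intro mult_left_mono) (auto simp: pos_le_divide_eq)
    then have nn: "real n \<le> (real n)\<^sup>2 / c" by (simp add: power2_eq_square)
    \<comment> \<open>Each of the four terms of \<open>?R\<close> is at most
      \<open>(real n)\<^sup>2 / c\<close> in absolute value.\<close>
    have "\<bar>?R \<eta>\<bar> \<le> 4 * ((real n)\<^sup>2 / c)"
      using abs_bounds_any(1,2)[of \<eta>] sq\<theta> \<theta>n nn \<theta>_pos by linarith
    also have "\<dots> \<le> 5 * (real n)\<^sup>2 / c" using c by (simp add: divide_right_mono)
    moreover have "0 \<le> 7 * \<epsilon> * (\<bar>lin \<eta>\<bar> + sq \<eta> / \<theta>)"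
      using \<epsilon> sq\<theta> by (intro mult_nonneg_nonneg add_nonneg_nonneg) auto
    ultimately show ?thesis using False by simp
  qed
  then have "E (\<lambda>\<eta>. \<bar>?R \<eta>\<bar>) \<le> E (\<lambda>\<eta>. 7 * \<epsilon> * (\<bar>lin \<eta>\<bar> + sq \<eta> / \<theta>) + 5 * (real n)\<^sup>2 / c * ?bad \<eta>)"
    by (rule E_mono)
  also have "\<dots> = 7 * \<epsilon> * (E (\<lambda>\<eta>. \<bar>lin \<eta>\<bar>) + E sq / \<theta>) + 5 * (real n)\<^sup>2 / c * E ?bad"
    by simp
  also have "\<dots> \<le> 7 * \<epsilon> * (1 + 1 / c) + 5 * (real n)\<^sup>2 / c * E ?bad"
    using E_abs_lin Esq D \<epsilon> by (intro add_right_mono mult_left_mono add_mono) auto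
  finally have "E (\<lambda>\<eta>. \<bar>?R \<eta>\<bar>) \<le> 7 * \<epsilon> * (1 + 1 / c) + 5 * (real n)\<^sup>2 / c * E ?bad" .
  moreover have "\<bar>E ?R\<bar> \<le> E (\<lambda>\<eta>. \<bar>?R \<eta>\<bar>)" by (rule integral_abs_bound)
  moreover have "E ?R = E (lambda1 n) - \<theta> - E sq / \<theta>"
    by (simp add: E_lin)
  moreover have "\<bar>E sq / \<theta> - D\<bar> \<le> q / c"
  proof -
    have "q * D \<le> q * (1 / c)" using q_bounds D by (intro mult_left_mono) auto
    then show ?thesis using Esq by (simp add: algebra_simps abs_le_iff)
  qed
  ultimately show ?thesis
    unfolding D' \<theta>_def[symmetric] by linarith
qed

end

section \<open>The Gaussian limit of the linear part\<close>

lemma exp_minus_approx: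
  assumes "y \<ge> (0::real)"
  shows "\<bar>exp (- y) - (1 - y)\<bar> \<le> y\<^sup>2"
proof -
  have "exp (- y) \<ge> 1 - y" using exp_ge_add_one_self[of "- y"] by simp
  moreover have "exp (- y) \<le> 1 - y + y\<^sup>2"
  proof -
    \<comment> \<open>The product equals \<open>1 + y ^ 3\<close>.\<close>
    have "1 \<le> (1 - y + y\<^sup>2) * (1 + y)"
      using assms by (simp add: power2_eq_square algebra_simps)
    also have "\<dots> \<le> (1 - y + y\<^sup>2) * exp y"
    proof (rule mult_left_mono)
      have "1 - y + y\<^sup>2 = (1 - y / 2)\<^sup>2 + 3 / 4 * y\<^sup>2" by (simp add: power2_eq_square algebra_simps)
      also have "\<dots> \<ge> 0" by simp
      finally show "0 \<le> 1 - y + y\<^sup>2" .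
    qed (rule exp_ge_add_one_self)
    finally show ?thesis by (simp add: exp_minus field_simps)
  qed
  ultimately show ?thesis by (simp add: abs_le_iff)
qed

text \<open>Third-order Taylor expansion. The third absolute moment of a centred Bernoulli variable
  is at most its variance \<open>p * (1 - p)\<close>, so the error is the variance times a small
  factor and sums over the edges to the total variance.\<close>

lemma char_centered_bernoulli:
  fixes t p :: real
  assumes p: "0 \<le> p" "p \<le> 1"
  defines "\<phi> \<equiv> of_real p * iexp (t * (1 - p)) + of_real (1 - p) * iexp (t * (0 - p))"
  shows "cmod \<phi> \<le> 1"
    and "cmod (\<phi> - of_real (exp (- (t\<^sup>2 * (p * (1 - p)) / 2)))) \<le> (\<bar>t\<bar> + t\<^sup>2) * (t\<^sup>2 * (p * (1 - p)))"
proof -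
  have "cmod \<phi> \<le> cmod (of_real p * iexp (t * (1 - p))) + cmod (of_real (1 - p) * iexp (t * (0 - p)))"
    unfolding \<phi>_def by (rule norm_triangle_ineq)
  also have "\<dots> = 1" using p by (simp add: norm_mult del: of_real_diff)
  finally show "cmod \<phi> \<le> 1" .
  define r where "r = (\<lambda>x. iexp x - (1 + \<i> * of_real x - of_real (x\<^sup>2 / 2)))"
  have r: "cmod (r x) \<le> \<bar>x\<bar> ^ 3" for x
  proof -
    have "(\<Sum>k \<le> 2. (\<i> * of_real x) ^ k / fact k) = 1 + \<i> * of_real x - of_real (x\<^sup>2 / 2)"
      by (simp add: numeral_2_eq_2 power_mult_distrib)
    then have "cmod (r x) \<le> \<bar>x\<bar> ^ 3 / 6"
      using iexp_approx1[of x 2] by (simp add: r_def eval_nat_numeral)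
    also have "\<dots> \<le> \<bar>x\<bar> ^ 3" by simp
    finally show ?thesis .
  qed
  let ?v = "p * (1 - p)"
  have "\<phi> = of_real (1 - t\<^sup>2 * ?v / 2) + (of_real p * r (t * (1 - p)) + of_real (1 - p) * r (t * (0 - p)))"
    unfolding \<phi>_def r_def by (simp add: power2_eq_square algebra_simps) (simp add: field_simps)
  then have "\<phi> - of_real (exp (- (t\<^sup>2 * ?v / 2))) = of_real (1 - t\<^sup>2 * ?v / 2 - exp (- (t\<^sup>2 * ?v / 2)))
      + (of_real p * r (t * (1 - p)) + of_real (1 - p) * r (t * (0 - p)))"
    by simp
  then have "cmod (\<phi> - of_real (exp (- (t\<^sup>2 * ?v / 2)))) \<le> cmod (of_real (1 - t\<^sup>2 * ?v / 2 - exp (- (t\<^sup>2 * ?v / 2))))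
      + (cmod (of_real p * r (t * (1 - p))) + cmod (of_real (1 - p) * r (t * (0 - p))))"
    by (simp only:) (intro order.trans[OF norm_triangle_ineq add_left_mono[OF norm_triangle_ineq]])
  also have "\<dots> = \<bar>exp (- (t\<^sup>2 * ?v / 2)) - (1 - t\<^sup>2 * ?v / 2)\<bar> + (p * cmod (r (t * (1 - p))) + (1 - p) * cmod (r (t * (0 - p))))"
    unfolding norm_mult norm_of_real using p by (simp add: abs_minus_commute)
  also have "\<dots> \<le> (t\<^sup>2 * ?v / 2)\<^sup>2 + (p * \<bar>t * (1 - p)\<bar> ^ 3 + (1 - p) * \<bar>t * (0 - p)\<bar> ^ 3)"
    using p by (intro add_mono exp_minus_approx mult_left_mono r) auto
  also have "p * \<bar>t * (1 - p)\<bar> ^ 3 + (1 - p) * \<bar>t * (0 - p)\<bar> ^ 3 \<le> \<bar>t\<bar> * (t\<^sup>2 * ?v)"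
  proof -
    have "p * \<bar>t * (1 - p)\<bar> ^ 3 + (1 - p) * \<bar>t * (0 - p)\<bar> ^ 3 = \<bar>t\<bar> ^ 3 * (?v * ((1 - p)\<^sup>2 + p\<^sup>2))"
    proof -
      have "\<bar>t * (1 - p)\<bar> = \<bar>t\<bar> * (1 - p)" "\<bar>t * (0 - p)\<bar> = \<bar>t\<bar> * p"
        using p by (simp_all add: abs_mult)
      then show ?thesis
        by (simp only: power_mult_distrib power3_eq_cube power2_eq_square) (simp add: algebra_simps)
    qed
    also have "\<dots> \<le> \<bar>t\<bar> ^ 3 * (?v * 1)"
    proof (intro mult_left_mono)
      have "(1 - p)\<^sup>2 + p\<^sup>2 = 1 - 2 * ?v" by (simp add: power2_eq_square algebra_simps)
      then show "(1 - p)\<^sup>2 + p\<^sup>2 \<le> 1" using p by simp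
    qed (use p in auto)
    also have "\<bar>t\<bar> ^ 3 = \<bar>t\<bar> * t\<^sup>2" by (simp add: power3_eq_cube power2_eq_square)
    finally show ?thesis by simp
  qed
  also have "(t\<^sup>2 * ?v / 2)\<^sup>2 \<le> t\<^sup>2 * (t\<^sup>2 * ?v)"
  proof -
    have v: "0 \<le> ?v" "?v \<le> 1" using p by (auto intro: mult_le_one)
    have "(t\<^sup>2 * ?v / 2)\<^sup>2 = t\<^sup>2 * (t\<^sup>2 * (?v * (?v / 4)))"
      by (simp add: power2_eq_square)
    also have "\<dots> \<le> t\<^sup>2 * (t\<^sup>2 * (?v * 1))"
      using v by (intro mult_left_mono) auto
    finally show ?thesis by simp
  qed
  finally show "cmod (\<phi> - of_real (exp (- (t\<^sup>2 * (p * (1 - p)) / 2)))) \<le> (\<bar>t\<bar> + t\<^sup>2) * (t\<^sup>2 * (p * (1 - p)))"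
    by (simp add: distrib_right)
qed

text \<open>Both sides are products of factors of modulus at most 1, so their distance is at most
  the sum of the distances of the factors. This replaces a central limit theorem for triangular
  arrays by an explicit error.\<close>

lemma char_linear_form:
  fixes p t :: "'a \<Rightarrow> real"
  assumes S: "finite S" and p: "\<And>e. e \<in> S \<Longrightarrow> 0 \<le> p e \<and> p e \<le> 1"
    and \<tau>: "\<And>e. e \<in> S \<Longrightarrow> \<bar>t e\<bar> \<le> \<tau>"
  defines "V \<equiv> \<Sum>e\<in>S. (t e)\<^sup>2 * (p e * (1 - p e))"
  shows "cmod (bern_exp S p (\<lambda>\<eta>. iexp (\<Sum>e\<in>S. t e * (of_bool (\<eta> e) - p e)))
      - of_real (exp (- (V / 2)))) \<le> (\<tau> + \<tau>\<^sup>2) * V"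
proof -
  let ?\<phi> = "\<lambda>e. of_real (p e) * iexp (t e * (1 - p e)) + of_real (1 - p e) * iexp (t e * (0 - p e))"
  let ?w = "\<lambda>e. (t e)\<^sup>2 * (p e * (1 - p e))"
  have "iexp (\<Sum>e\<in>S. t e * (of_bool (\<eta> e) - p e)) = (\<Prod>e\<in>S. iexp (t e * (of_bool (\<eta> e) - p e)))" for \<eta>
    using S by (simp add: exp_sum[symmetric] sum_distrib_left del: of_real_mult of_real_diff)
  then have "bern_exp S p (\<lambda>\<eta>. iexp (\<Sum>e\<in>S. t e * (of_bool (\<eta> e) - p e)))
      = bern_exp S p (\<lambda>\<eta>. \<Prod>e\<in>S. iexp (t e * (of_bool (\<eta> e) - p e)))"
    by (simp only:)
  also have "\<dots> = (\<Prod>e\<in>S. of_real (p e) * iexp (t e * (of_bool True - p e))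
      + of_real (1 - p e) * iexp (t e * (of_bool False - p e)))"
    by (rule expectation_prod_bern_prod[OF S p])
  also have "\<dots> = (\<Prod>e\<in>S. ?\<phi> e)"
    by (simp only: of_bool_eq)
  finally have E: "bern_exp S p (\<lambda>\<eta>. iexp (\<Sum>e\<in>S. t e * (of_bool (\<eta> e) - p e)))
      = (\<Prod>e\<in>S. ?\<phi> e)" .
  have X: "complex_of_real (exp (- (V / 2))) = (\<Prod>e\<in>S. of_real (exp (- (?w e / 2))))"
    unfolding of_real_prod[symmetric] using S
    by (simp add: V_def exp_sum[symmetric] sum_negf sum_divide_distrib)
  have "cmod ((\<Prod>e\<in>S. ?\<phi> e) - (\<Prod>e\<in>S. of_real (exp (- (?w e / 2)))))
      \<le> (\<Sum>e\<in>S. cmod (?\<phi> e - of_real (exp (- (?w e / 2)))))"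
  proof (rule norm_prod_diff)
    fix e assume e: "e \<in> S"
    show "cmod (?\<phi> e) \<le> 1" using p[OF e] by (intro char_centered_bernoulli) auto
    have "?w e \<ge> 0" using p[OF e] by simp
    then show "cmod (of_real (exp (- (?w e / 2)))) \<le> 1" by simp
  qed
  also have "\<dots> \<le> (\<Sum>e\<in>S. (\<tau> + \<tau>\<^sup>2) * ?w e)"
  proof (intro sum_mono)
    fix e assume e: "e \<in> S"
    have "cmod (?\<phi> e - of_real (exp (- (?w e / 2)))) \<le> (\<bar>t e\<bar> + (t e)\<^sup>2) * ?w e"
      using p[OF e] by (intro char_centered_bernoulli) auto
    also have "\<dots> \<le> (\<tau> + \<tau>\<^sup>2) * ?w e"
    proof (intro mult_right_mono add_mono)
      show "(t e)\<^sup>2 \<le> \<tau>\<^sup>2" using power_mono[OF \<tau>[OF e], of 2] by simp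
    qed (use \<tau>[OF e] p[OF e] in auto)
    finally show "cmod (?\<phi> e - of_real (exp (- (?w e / 2)))) \<le> (\<tau> + \<tau>\<^sup>2) * ?w e" .
  qed
  also have "\<dots> = (\<tau> + \<tau>\<^sup>2) * V"
    by (simp only: V_def sum_distrib_left)
  finally show ?thesis unfolding E X .
qed

section \<open>Normalisation and characteristic function of the statistic\<close>

context chung_lu_bounds
begin

definition "\<sigma> = sigma1 n d"

lemma sum_edge_prob_cube: "(\<Sum>i<n. \<Sum>j<n. edge_prob n d i j ^ 3) = (deg_sum 3 n d)\<^sup>2 / (deg_sum 1 n d) ^ 3"
proof -
  have "(\<Sum>i<n. \<Sum>j<n. edge_prob n d i j ^ 3) = (\<Sum>i<n. \<Sum>j<n. real (d i) ^ 3 * real (d j) ^ 3) / (deg_sum 1 n d) ^ 3"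
    by (simp add: edge_prob_def power_divide power_mult_distrib sum_divide_distrib)
  also have "(\<Sum>i<n. \<Sum>j<n. real (d i) ^ 3 * real (d j) ^ 3) = (deg_sum 3 n d)\<^sup>2"
    by (simp only: deg_sum_def sum_product power2_eq_square)
  finally show ?thesis .
qed

lemma \<sigma>_sq_eq: "\<sigma>\<^sup>2 = (\<Sum>i<n. \<Sum>j<n. edge_prob n d i j ^ 3 * (1 - edge_prob n d i j))"
proof -
  have "edge_prob n d i j ^ 3 * (1 - edge_prob n d i j) \<ge> 0" if "i < n" "j < n" for i j
    using edge_prob_bounds[OF that] q_bounds by (intro mult_nonneg_nonneg) auto
  then show ?thesis
    unfolding \<sigma>_def sigma1_def by (intro real_sqrt_pow2 sum_nonneg) auto
qed

lemma \<sigma>_sq_bounds: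
  "\<sigma>\<^sup>2 \<le> (deg_sum 3 n d)\<^sup>2 / (deg_sum 1 n d) ^ 3"
  "(1 - q) * ((deg_sum 3 n d)\<^sup>2 / (deg_sum 1 n d) ^ 3) \<le> \<sigma>\<^sup>2"
proof -
  show "\<sigma>\<^sup>2 \<le> (deg_sum 3 n d)\<^sup>2 / (deg_sum 1 n d) ^ 3"
    unfolding \<sigma>_sq_eq sum_edge_prob_cube[symmetric]
    using edge_prob_bounds by (intro sum_mono mult_left_le) (auto simp: less_imp_le)
  show "(1 - q) * ((deg_sum 3 n d)\<^sup>2 / (deg_sum 1 n d) ^ 3) \<le> \<sigma>\<^sup>2"
    unfolding \<sigma>_sq_eq sum_edge_prob_cube[symmetric] sum_distrib_left
  proof (intro sum_mono)
    fix i j assume "i \<in> {..<n}" "j \<in> {..<n}"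
    then have p: "0 < edge_prob n d i j" "edge_prob n d i j \<le> q" using edge_prob_bounds by auto
    have "(1 - q) * edge_prob n d i j ^ 3 \<le> (1 - edge_prob n d i j) * edge_prob n d i j ^ 3"
      using p by (intro mult_right_mono) auto
    then show "(1 - q) * edge_prob n d i j ^ 3 \<le> edge_prob n d i j ^ 3 * (1 - edge_prob n d i j)"
      by (simp only: mult_ac)
  qed
qed

lemma \<sigma>_sq_ge: "c ^ 6 * m ^ 3 / (2 * real n) \<le> \<sigma>\<^sup>2"
proof -
  have "(c * m) * ((c * m) * ((c * m) * real n)) \<le> (c * m) * ((c * m) * deg_sum 1 n d)"
    using cm_pos deg_sum_1_bounds by (intro mult_left_mono) auto
  also have "\<dots> \<le> (c * m) * deg_sum 2 n d"
    using cm_pos deg_sum_Suc_bounds(1)[of 1] by (intro mult_left_mono) (auto simp: numeral_2_eq_2)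
  also have "\<dots> \<le> deg_sum 3 n d"
    using deg_sum_Suc_bounds(1)[of 2] by (simp add: numeral_3_eq_3 numeral_2_eq_2)
  finally have m3: "(c * m) * ((c * m) * ((c * m) * real n)) \<le> deg_sum 3 n d" .
  have "c ^ 6 * m ^ 3 / real n = ((c * m) * ((c * m) * ((c * m) * real n)))\<^sup>2 / (m * real n) ^ 3"
    using m n_pos by (simp add: power2_eq_square power3_eq_cube eval_nat_numeral)
  also have "\<dots> \<le> (deg_sum 3 n d)\<^sup>2 / (deg_sum 1 n d) ^ 3"
    using m3 deg_sum_1_bounds deg_sum_pos[of 1] cm_pos by (intro frac_le power_mono) auto
  finally have "1/2 * (c ^ 6 * m ^ 3 / real n) \<le> (1 - q) * ((deg_sum 3 n d)\<^sup>2 / (deg_sum 1 n d) ^ 3)"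
    using q_bounds c m by (intro mult_mono) auto
  with \<sigma>_sq_bounds(2) show ?thesis by simp
qed

lemma \<sigma>_pos: "\<sigma> > 0"
proof -
  have "c ^ 6 * m ^ 3 / (2 * real n) > 0" using c m n_pos by simp
  then have "\<sigma>\<^sup>2 > 0" using \<sigma>_sq_ge by linarith
  moreover have "\<sigma> = sqrt (\<sigma>\<^sup>2)"
    unfolding \<sigma>_sq_eq by (simp only: \<sigma>_def sigma1_def)
  then have "\<sigma> \<ge> 0" by simp
  ultimately show ?thesis by (simp add: less_le)
qed

text \<open>The weights of the linear form after scaling by \<open>\<theta> / \<sigma>\<close>:
  since \<open>\<theta> * (u i * u j)\<close> is the edge probability, the probabilities themselves
  become the weights, and their variance contains the cube seen in \<open>sigma1\<close>.\<close>

definition "coef e = pair_mult e * P e / \<sigma>"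
definition "V = (\<Sum>e\<in>pairs n. (coef e)\<^sup>2 * (P e * (1 - P e)))"

lemma abs_coef_le: "e \<in> pairs n \<Longrightarrow> \<bar>coef e\<bar> \<le> 2 * q / \<sigma>"
  using P_bounds[of e] pair_mult_bounds[of e] \<sigma>_pos
  by (auto simp: coef_def abs_mult intro!: divide_right_mono mult_mono)

text \<open>Without loops the value would be exactly 2, because \<open>sigma1\<close> counts every
  other edge twice while the variance counts it four times. The \<open>n\<close> loops cost at most
  \<open>real n * q ^ 3\<close>, of relative order 1/n by the lower bound on
  \<open>\<sigma>\<^sup>2\<close>.\<close>

lemma V_bounds: "V \<le> 2" "2 - 2 / (c ^ 9 * real n) \<le> V"
proof -
  let ?f = "\<lambda>e. P e ^ 3 * (1 - P e)"
  have f: "0 \<le> ?f e" "?f e \<le> q ^ 3" if "e \<in> pairs n" for e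
  proof -
    have P: "0 \<le> P e" "P e \<le> q" "P e \<le> 1" using P_bounds[OF that] P_le_1[OF that] by auto
    show "0 \<le> ?f e" using P by simp
    have "P e ^ 3 * (1 - P e) \<le> q ^ 3 * 1" using P by (intro mult_mono power_mono) auto
    then show "?f e \<le> q ^ 3" by simp
  qed
  have V: "V * \<sigma>\<^sup>2 = (\<Sum>e\<in>pairs n. (pair_mult e)\<^sup>2 * ?f e)"
    unfolding V_def sum_distrib_right using \<sigma>_pos
    by (intro sum.cong refl) (simp add: coef_def power2_eq_square power3_eq_cube)
  have "P (uedge i j) = edge_prob n d i j" for i j by (simp add: P_uedge edge_prob_eq)
  then have "\<sigma>\<^sup>2 = (\<Sum>i<n. \<Sum>j<n. ?f (uedge i j))" by (simp only: \<sigma>_sq_eq)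
  also have "\<dots> = (\<Sum>e\<in>pairs n. pair_mult e * ?f e)"
    by (rule sum_uedge[where F = ?f])
  finally have s: "\<sigma>\<^sup>2 = (\<Sum>e\<in>pairs n. pair_mult e * ?f e)" .
  have diag: "(pair_mult e)\<^sup>2 * x = 2 * (pair_mult e * x) - of_bool (fst e = snd e) * x" for e and x :: real
    by (simp add: pair_mult_def)
  have "(\<Sum>e\<in>pairs n. (pair_mult e)\<^sup>2 * ?f e) = 2 * (\<Sum>e\<in>pairs n. pair_mult e * ?f e)
      - (\<Sum>e\<in>pairs n. of_bool (fst e = snd e) * ?f e)"
    unfolding diag by (simp only: sum_subtractf sum_distrib_left)
  then have "V * \<sigma>\<^sup>2 = 2 * \<sigma>\<^sup>2 - (\<Sum>e\<in>pairs n. of_bool (fst e = snd e) * ?f e)"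
    by (simp only: V[symmetric] s[symmetric])
  moreover have "(\<Sum>e\<in>pairs n. of_bool (fst e = snd e) * ?f e) \<le> real n * q ^ 3"
  proof -
    have "(\<Sum>e\<in>pairs n. of_bool (fst e = snd e) * ?f e) \<le> (\<Sum>e\<in>pairs n. of_bool (fst e = snd e) * q ^ 3)"
      by (intro sum_mono mult_left_mono f) auto
    also have "\<dots> = real (card {e \<in> pairs n. fst e = snd e}) * q ^ 3"
      by (simp add: sum_distrib_right[symmetric] of_bool_def sum.If_cases Int_def)
    also have "{e \<in> pairs n. fst e = snd e} = (\<lambda>i. (i, i)) ` {..<n}"
      by (auto simp: pairs_def)
    also have "card \<dots> = n" by (subst card_image) (auto simp: inj_on_def)
    finally show ?thesis .
  qed
  moreover have "(\<Sum>e\<in>pairs n. of_bool (fst e = snd e) * ?f e) \<ge> 0"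
    by (rule sum_nonneg, rule mult_nonneg_nonneg[OF _ f(1)]) auto
  moreover have "real n * q ^ 3 \<le> 2 / (c ^ 9 * real n) * \<sigma>\<^sup>2"
  proof -
    have "real n * q ^ 3 = 2 / (c ^ 9 * real n) * (c ^ 6 * m ^ 3 / (2 * real n))"
      using c n_pos by (simp add: q_def power_divide power_mult_distrib field_simps eval_nat_numeral)
    also have "\<dots> \<le> 2 / (c ^ 9 * real n) * \<sigma>\<^sup>2"
      using \<sigma>_sq_ge c by (intro mult_left_mono) auto
    finally show ?thesis .
  qed
  ultimately have "V * \<sigma>\<^sup>2 \<le> 2 * \<sigma>\<^sup>2" "(2 - 2 / (c ^ 9 * real n)) * \<sigma>\<^sup>2 \<le> V * \<sigma>\<^sup>2"
    by (simp_all add: left_diff_distrib)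
  then show "V \<le> 2" "2 - 2 / (c ^ 9 * real n) \<le> V"
    using \<sigma>_pos by simp_all
qed

definition "stat \<eta> = deg_sum 2 n d / deg_sum 1 n d * ((lambda1 n \<eta> - expected_lambda1 n d) / sigma1 n d)"

lemma stat_decomp:
  "stat \<eta> = (\<Sum>e\<in>pairs n. coef e * (of_bool (\<eta> e) - P e)) + \<theta> / \<sigma> * (remainder \<eta> - E remainder)"
proof -
  have "E remainder = E (\<lambda>\<eta>. lambda1 n \<eta> - (\<theta> + lin \<eta>))"
    by (simp only: remainder_def[abs_def] quad_u)
  also have "\<dots> = expected_lambda1 n d - \<theta>"
    by (simp add: E_lin expected_lambda1_eq)
  finally have eq: "lambda1 n \<eta> - expected_lambda1 n d = lin \<eta> + (remainder \<eta> - E remainder)"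
    by (simp add: remainder_def quad_u)
  have "stat \<eta> = \<theta> / \<sigma> * (lambda1 n \<eta> - expected_lambda1 n d)"
    by (simp add: stat_def \<theta>_def \<sigma>_def)
  also have "\<dots> = \<theta> / \<sigma> * lin \<eta> + \<theta> / \<sigma> * (remainder \<eta> - E remainder)"
    by (simp only: eq distrib_left)
  also have "\<theta> / \<sigma> * lin \<eta> = (\<Sum>e\<in>pairs n. coef e * (of_bool (\<eta> e) - P e))"
    unfolding lin_eq sum_distrib_left
    by (intro sum.cong refl) (simp add: coef_def P_def edge_prob_eq)
  finally show ?thesis .
qed

text \<open>Three errors: dropping the remainder, whose mean absolute value after scaling is at most
  \<open>W\<close>; replacing the linear form by a Gaussian of the same variance \<open>V\<close>;
  replacing \<open>V\<close> by 2, for which the characteristic function is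
  \<open>exp (- (t\<^sup>2))\<close>. The factor \<open>2 * real n / (c ^ 6 * m)\<close> is an upper
  bound for \<open>(\<theta> / \<sigma>)\<^sup>2\<close>.\<close>

lemma char_stat_bound:
  assumes W: "2 * real n / (c ^ 6 * m) * (E (\<lambda>\<eta>. (remainder \<eta>)\<^sup>2) - (E remainder)\<^sup>2) \<le> W\<^sup>2" "W \<ge> 0"
  shows "cmod (E (\<lambda>\<eta>. iexp (t * stat \<eta>)) - of_real (exp (- (t\<^sup>2))))
    \<le> \<bar>t\<bar> * W + 2 * t\<^sup>2 * (\<bar>t\<bar> * (2 * q / \<sigma>) + t\<^sup>2 * (2 * q / \<sigma>)\<^sup>2) + t\<^sup>2 / (c ^ 9 * real n)"
proof -
  define X where "X = (\<lambda>\<eta>. \<Sum>e\<in>pairs n. coef e * (of_bool (\<eta> e) - P e))"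
  define Y where "Y = (\<lambda>\<eta>. \<theta> / \<sigma> * (remainder \<eta> - E remainder))"
  have I: "integrable (measure_pmf G) (f :: _ \<Rightarrow> complex)" for f by simp
  have EY: "E (\<lambda>\<eta>. \<bar>Y \<eta>\<bar>) \<le> W"
  proof -
    have "E (\<lambda>\<eta>. (Y \<eta>)\<^sup>2) = (\<theta> / \<sigma>)\<^sup>2 * (E (\<lambda>\<eta>. (remainder \<eta>)\<^sup>2) - (E remainder)\<^sup>2)"
    proof -
      have "E (\<lambda>\<eta>. (Y \<eta>)\<^sup>2) = E (\<lambda>\<eta>. (\<theta> / \<sigma>)\<^sup>2 * (remainder \<eta> - E remainder)\<^sup>2)"
        by (simp only: Y_def power_mult_distrib)
      also have "\<dots> = (\<theta> / \<sigma>)\<^sup>2 * E (\<lambda>\<eta>. (remainder \<eta> - E remainder)\<^sup>2)"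
        by (rule integral_mult_right_zero)
      also have "E (\<lambda>\<eta>. (remainder \<eta> - E remainder)\<^sup>2) = E (\<lambda>\<eta>. (remainder \<eta>)\<^sup>2) - (E remainder)\<^sup>2"
        by (rule measure_pmf.variance_eq) auto
      finally show ?thesis .
    qed
    also have "\<dots> \<le> 2 * real n / (c ^ 6 * m) * (E (\<lambda>\<eta>. (remainder \<eta>)\<^sup>2) - (E remainder)\<^sup>2)"
    proof (intro mult_right_mono)
      have "(\<theta> / \<sigma>)\<^sup>2 \<le> m\<^sup>2 / (c ^ 6 * m ^ 3 / (2 * real n))"
        unfolding power_divide using \<theta>_bounds \<theta>_pos \<sigma>_sq_ge c m n_pos
        by (intro frac_le power_mono) auto
      also have "\<dots> = 2 * real n / (c ^ 6 * m)"
        using m c by (simp add: power2_eq_square power3_eq_cube)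
      finally show "(\<theta> / \<sigma>)\<^sup>2 \<le> 2 * real n / (c ^ 6 * m)" .
      show "0 \<le> E (\<lambda>\<eta>. (remainder \<eta>)\<^sup>2) - (E remainder)\<^sup>2"
        using measure_pmf.variance_positive[of G remainder] measure_pmf.variance_eq[of G remainder] by simp
    qed
    also have "\<dots> \<le> W\<^sup>2" by (rule W)
    finally have "E (\<lambda>\<eta>. (Y \<eta>)\<^sup>2) \<le> W\<^sup>2" .
    \<comment> \<open>Nonnegativity of the variance of the absolute value of
      \<open>Y\<close>.\<close>
    moreover have "(E (\<lambda>\<eta>. \<bar>Y \<eta>\<bar>))\<^sup>2 \<le> E (\<lambda>\<eta>. (Y \<eta>)\<^sup>2)"
      using measure_pmf.variance_positive[of G "\<lambda>\<eta>. \<bar>Y \<eta>\<bar>"] measure_pmf.variance_eq[of G "\<lambda>\<eta>. \<bar>Y \<eta>\<bar>"]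
      by simp
    ultimately have "(E (\<lambda>\<eta>. \<bar>Y \<eta>\<bar>))\<^sup>2 \<le> W\<^sup>2" by linarith
    then show ?thesis using W(2) by (rule power2_le_imp_le)
  qed
  have A: "cmod (E (\<lambda>\<eta>. iexp (t * stat \<eta>)) - E (\<lambda>\<eta>. iexp (t * X \<eta>))) \<le> \<bar>t\<bar> * W"
  proof -
    have "cmod (iexp (t * stat \<eta>) - iexp (t * X \<eta>)) \<le> \<bar>t\<bar> * \<bar>Y \<eta>\<bar>" for \<eta>
    proof -
      have "t * stat \<eta> = t * X \<eta> + t * Y \<eta>"
        by (simp only: stat_decomp X_def Y_def distrib_left)
      then have "iexp (t * stat \<eta>) - iexp (t * X \<eta>) = iexp (t * X \<eta>) * (iexp (t * Y \<eta>) - 1)"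
        by (simp only: of_real_add distrib_left exp_add right_diff_distrib mult_1_right)
      then have "cmod (iexp (t * stat \<eta>) - iexp (t * X \<eta>)) = cmod (iexp (t * Y \<eta>) - 1)"
        by (simp add: norm_mult)
      also have "\<dots> \<le> \<bar>t * Y \<eta>\<bar>"
        using iexp_approx1[of "t * Y \<eta>" 0] by simp
      finally show ?thesis by (simp add: abs_mult)
    qed
    then have "E (\<lambda>\<eta>. cmod (iexp (t * stat \<eta>) - iexp (t * X \<eta>))) \<le> E (\<lambda>\<eta>. \<bar>t\<bar> * \<bar>Y \<eta>\<bar>)"
      by (rule E_mono)
    also have "\<dots> = \<bar>t\<bar> * E (\<lambda>\<eta>. \<bar>Y \<eta>\<bar>)" by simp
    also have "\<dots> \<le> \<bar>t\<bar> * W" by (intro mult_left_mono EY) auto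
    finally have "E (\<lambda>\<eta>. cmod (iexp (t * stat \<eta>) - iexp (t * X \<eta>))) \<le> \<bar>t\<bar> * W" .
    moreover have "cmod (E (\<lambda>\<eta>. iexp (t * stat \<eta>) - iexp (t * X \<eta>)))
        \<le> E (\<lambda>\<eta>. cmod (iexp (t * stat \<eta>) - iexp (t * X \<eta>)))"
      by (rule integral_norm_bound)
    ultimately show ?thesis
      by (simp only: Bochner_Integration.integral_diff[OF I I])
  qed
  have B: "cmod (E (\<lambda>\<eta>. iexp (t * X \<eta>)) - of_real (exp (- (t\<^sup>2 * V / 2))))
      \<le> 2 * t\<^sup>2 * (\<bar>t\<bar> * (2 * q / \<sigma>) + t\<^sup>2 * (2 * q / \<sigma>)\<^sup>2)"
  proof -
    have tX: "t * X \<eta> = (\<Sum>e\<in>pairs n. (t * coef e) * (of_bool (\<eta> e) - P e))" for \<eta>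
      by (simp only: X_def sum_distrib_left mult.assoc)
    have tV: "(\<Sum>e\<in>pairs n. (t * coef e)\<^sup>2 * (P e * (1 - P e))) = t\<^sup>2 * V"
      by (simp only: V_def sum_distrib_left power_mult_distrib mult.assoc)
    have "cmod (E (\<lambda>\<eta>. iexp (t * X \<eta>)) - of_real (exp (- (t\<^sup>2 * V / 2))))
        \<le> (\<bar>t\<bar> * (2 * q / \<sigma>) + (\<bar>t\<bar> * (2 * q / \<sigma>))\<^sup>2) * (t\<^sup>2 * V)"
      unfolding tX tV[symmetric]
    proof (rule char_linear_form)
      show "\<bar>t * coef e\<bar> \<le> \<bar>t\<bar> * (2 * q / \<sigma>)" if "e \<in> pairs n" for e
        unfolding abs_mult using abs_coef_le[OF that] by (rule mult_left_mono) simp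
    qed (use P_le_1 in auto)
    also have "\<dots> \<le> (\<bar>t\<bar> * (2 * q / \<sigma>) + (\<bar>t\<bar> * (2 * q / \<sigma>))\<^sup>2) * (t\<^sup>2 * 2)"
      using V_bounds q_bounds \<sigma>_pos by (intro mult_left_mono) auto
    also have "\<dots> = 2 * t\<^sup>2 * (\<bar>t\<bar> * (2 * q / \<sigma>) + t\<^sup>2 * (2 * q / \<sigma>)\<^sup>2)"
      by (simp only: power_mult_distrib power2_abs mult_ac)
    finally show ?thesis .
  qed
  have C: "cmod (of_real (exp (- (t\<^sup>2 * V / 2))) - of_real (exp (- (t\<^sup>2)))) \<le> t\<^sup>2 / (c ^ 9 * real n)"
  proof -
    have V0: "0 \<le> V"
      unfolding V_def using P_le_1 by (intro sum_nonneg mult_nonneg_nonneg) auto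
    define \<delta> where "\<delta> = t\<^sup>2 - t\<^sup>2 * V / 2"
    have \<delta>: "\<delta> = t\<^sup>2 * (1 - V / 2)" by (simp add: \<delta>_def algebra_simps)
    then have "0 \<le> \<delta>" using V_bounds(1) by simp
    have "\<delta> \<le> t\<^sup>2 * (1 / (c ^ 9 * real n))"
      unfolding \<delta> using V_bounds(2) by (intro mult_left_mono) auto
    have "exp (- (t\<^sup>2)) = exp (- (t\<^sup>2 * V / 2)) * exp (- \<delta>)"
      by (simp add: \<delta>_def exp_add[symmetric])
    then have "exp (- (t\<^sup>2 * V / 2)) - exp (- (t\<^sup>2)) = exp (- (t\<^sup>2 * V / 2)) * (1 - exp (- \<delta>))"
      by (simp add: algebra_simps)
    also have "\<dots> \<le> 1 * \<delta>"
      using exp_ge_add_one_self[of "- \<delta>"] \<open>0 \<le> \<delta>\<close> V0 by (intro mult_mono) auto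
    finally have "exp (- (t\<^sup>2 * V / 2)) - exp (- (t\<^sup>2)) \<le> \<delta>" by simp
    moreover have "exp (- (t\<^sup>2)) \<le> exp (- (t\<^sup>2 * V / 2))" using \<open>0 \<le> \<delta>\<close> by (simp add: \<delta>_def)
    ultimately have "\<bar>exp (- (t\<^sup>2 * V / 2)) - exp (- (t\<^sup>2))\<bar> \<le> \<delta>" by linarith
    then show ?thesis
      using \<open>\<delta> \<le> t\<^sup>2 * (1 / (c ^ 9 * real n))\<close>
      by (simp only: of_real_diff[symmetric] norm_of_real) simp
  qed
  have tri: "cmod (x - w) \<le> cmod (x - y) + cmod (y - z) + cmod (z - w)" for x y z w
  proof -
    have "x - w = (x - y) + (y - z) + (z - w)" by simp
    then have "cmod (x - w) \<le> cmod ((x - y) + (y - z)) + cmod (z - w)"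
      by (simp only: norm_triangle_ineq)
    moreover have "cmod ((x - y) + (y - z)) \<le> cmod (x - y) + cmod (y - z)"
      by (rule norm_triangle_ineq)
    ultimately show ?thesis by linarith
  qed
  show ?thesis
    by (rule order.trans[OF tri[of _ _ "E (\<lambda>\<eta>. iexp (t * X \<eta>))" "of_real (exp (- (t\<^sup>2 * V / 2)))"]
          add_mono[OF add_mono[OF A B] C]])
qed

text \<open>Lindeberg smallness: no single edge carries a noticeable share of the linear
  form.\<close>

lemma coef_sq_bound: "(2 * q / \<sigma>)\<^sup>2 \<le> 8 / (c ^ 8 * real n)"
proof -
  have "(2 * q / \<sigma>)\<^sup>2 = 4 * q\<^sup>2 / \<sigma>\<^sup>2" by (simp add: power_divide power_mult_distrib)
  also have "\<dots> \<le> 4 * q\<^sup>2 / (c ^ 6 * m ^ 3 / (2 * real n))"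
    using \<sigma>_sq_ge c m n_pos \<sigma>_pos by (intro divide_left_mono mult_pos_pos) auto
  also have "\<dots> = 8 / (c ^ 8 * real n) * (1 / m)"
    using c m n_pos by (simp add: q_def power_divide power_mult_distrib field_simps eval_nat_numeral)
  also have "\<dots> \<le> 8 / (c ^ 8 * real n) * 1"
    using c m by (intro mult_left_mono) auto
  finally show ?thesis by simp
qed

text \<open>\<open>K\<close> is a power of two between ln n and 2 ln n. The base
  \<open>exp (-6)\<close> leaves \<open>n ^ 2 / n ^ 6\<close> for the bad event, and
  \<open>\<epsilon> \<le> 1/6\<close> gives \<open>2 * \<epsilon> \<le> 1/3 \<le> 1 / exp 1\<close>,
  so that \<open>(2 * \<epsilon>) ^ K \<le> 1 / real n\<close> in the truncation. Since
  \<open>K \<le> 2 * \<delta> * m\<close>, the bound \<open>\<delta> \<le> 1/8\<close> ensures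
  \<open>4 * K \<le> m\<close>, and \<open>32768 = 4 * 8192\<close>. Finally
  \<open>2430 = 2187 + 216 + 27\<close>.\<close>

lemma scale_choice:
  assumes \<epsilon>: "0 < \<epsilon>" "\<epsilon> \<le> 1/6" and n3: "n \<ge> 3"
    and \<delta>: "ln (real n) \<le> \<delta> * m" "\<delta> \<le> 1/8" "32768 * \<delta>\<^sup>2 \<le> c ^ 6 * \<epsilon> ^ 4" "16 * \<delta> \<le> exp (-6) * (c ^ 3 * \<epsilon>\<^sup>2)"
  shows "bad_prob \<epsilon> \<le> 1 / real n ^ 4"
    and "dev4 \<epsilon> \<le> 2430 * \<epsilon> ^ 4 / (c ^ 4 * real n)"
proof -
  define L where "L = ln (real n)"
  have e3: "exp 1 \<le> (3::real)" by (rule exp_le)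
  have L1: "L \<ge> 1"
  proof -
    have "exp 1 \<le> real n" using e3 n3 by linarith
    then show ?thesis using n_pos by (simp add: L_def ln_ge_iff)
  qed
  have expL: "exp L = real n" using n_pos by (simp add: L_def)
  obtain l where l: "L \<le> 2 ^ l" "2 ^ l \<le> 2 * L"
  proof -
    \<comment> \<open>The least power of two above \<open>L\<close>: either its half is still below
      \<open>L\<close>, or it is 1, which \<open>L \<ge> 1\<close> covers.\<close>
    define l where "l = (LEAST l. L \<le> 2 ^ l)"
    obtain l0 where "L \<le> 2 ^ l0" using real_arch_pow[of 2 L] by (auto intro: less_imp_le)
    then have l: "L \<le> 2 ^ l" unfolding l_def by (rule LeastI)
    have "2 ^ l \<le> 2 * L"
    proof (cases l)
      case 0
      then have "(2::real) ^ l = 1" by simp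
      then show ?thesis using L1 by linarith
    next
      case (Suc l')
      then have "l' < (LEAST l. L \<le> 2 ^ l)" unfolding l_def by simp
      then have "\<not> L \<le> 2 ^ l'" by (rule not_less_Least)
      moreover have "(2::real) ^ l = 2 * 2 ^ l'" unfolding Suc by (rule power_Suc)
      ultimately show ?thesis by linarith
    qed
    then show ?thesis by (rule that[OF l])
  qed
  define K :: nat where "K = 2 ^ l"
  have K: "L \<le> real K" "real K \<le> 2 * \<delta> * m" using l \<delta>(1) by (auto simp: K_def L_def)
  have mc: "m \<le> m / c" using c m by (simp add: pos_le_divide_eq)
  have "\<delta> * m \<le> 1/8 * m" using \<delta>(2) m by (intro mult_right_mono) auto
  then have K4: "4 * real K \<le> m / c" using K mc by linarith
  have \<delta>0: "\<delta> \<ge> 0"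
  proof (rule ccontr)
    assume "\<not> \<delta> \<ge> 0"
    then have "\<delta> * m < 0" using m by (intro mult_neg_pos) auto
    then show False using K L1 by linarith
  qed
  have K0: "0 \<le> real K" by simp
  have "bad_prob \<epsilon> \<le> (real n)\<^sup>2 * (8 * real K / (c ^ 3 * \<epsilon>\<^sup>2 * m)) ^ K"
  proof (rule prob_bad[OF \<epsilon>(1) K_def])
    show "2 * real K \<le> m / c" using K4 K0 by linarith
  qed
  also have "\<dots> \<le> (real n)\<^sup>2 * exp (-6) ^ K"
  proof (intro mult_left_mono power_mono)
    have "8 * real K \<le> (16 * \<delta>) * m" using K by simp
    also have "\<dots> \<le> (exp (-6) * (c ^ 3 * \<epsilon>\<^sup>2)) * m" using \<delta>(4) m by (intro mult_right_mono) auto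
    finally show "8 * real K / (c ^ 3 * \<epsilon>\<^sup>2 * m) \<le> exp (-6)"
      using c \<epsilon> m by (simp add: pos_divide_le_eq mult_ac)
  qed (use c m in auto)
  also have "exp (-6) ^ K = (exp (- real K) :: real) ^ 6"
    by (simp add: exp_of_nat_mult[symmetric] mult.commute)
  also have "(real n)\<^sup>2 * exp (- real K) ^ 6 \<le> (real n)\<^sup>2 * (1 / real n) ^ 6"
  proof (intro mult_left_mono power_mono)
    have "exp (- real K) \<le> exp (- L)" using K by simp
    then show "exp (- real K) \<le> 1 / real n" by (simp add: exp_minus expL inverse_eq_divide)
  qed auto
  also have "(real n)\<^sup>2 * (1 / real n) ^ 6 = 1 / real n ^ 4"
    using n_pos by (simp add: power_divide field_simps eval_nat_numeral)
  finally show "bad_prob \<epsilon> \<le> 1 / real n ^ 4" .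
  have y: "8192 * (real K)\<^sup>2 / (c ^ 6 * m\<^sup>2) \<le> \<epsilon> ^ 4"
  proof -
    have "(real K)\<^sup>2 \<le> (2 * \<delta> * m)\<^sup>2" using K by (intro power_mono) auto
    then have "8192 * (real K)\<^sup>2 \<le> (32768 * \<delta>\<^sup>2) * m\<^sup>2" by (simp add: power_mult_distrib)
    also have "\<dots> \<le> (c ^ 6 * \<epsilon> ^ 4) * m\<^sup>2" using \<delta>(3) by (intro mult_right_mono) auto
    finally show ?thesis using c m by (simp add: pos_divide_le_eq mult_ac)
  qed
  have "\<epsilon> ^ 4 \<le> (1/6) ^ 4" using \<epsilon> by (intro power_mono) auto
  then have y2: "\<epsilon> ^ 4 \<le> 1/2" by (simp add: power_divide)
  have tail: "(2 * \<epsilon>) ^ (4 * Suc K) \<le> \<epsilon> ^ 4 / real n"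
  proof -
    have "(2 * \<epsilon>) ^ (4 * Suc K) = (2 * \<epsilon>) ^ 4 * ((2 * \<epsilon>) ^ K) ^ 4"
    proof -
      have "4 * Suc K = 4 + K * 4" by simp
      then show ?thesis by (simp only: power_mult[symmetric] power_add[symmetric])
    qed
    also have "\<dots> \<le> (2 * \<epsilon>) ^ 4 * (1 / real n) ^ 4"
    proof (intro mult_left_mono power_mono)
      have "1 / 3 \<le> 1 / (exp 1 :: real)" using e3 by (intro divide_left_mono) auto
      then have "2 * \<epsilon> \<le> 1 / exp 1" using \<epsilon> by linarith
      then have "(2 * \<epsilon>) ^ K \<le> (1 / exp 1) ^ K" using \<epsilon> by (intro power_mono) auto
      also have "\<dots> = exp (- real K)"
        by (simp add: power_divide exp_of_nat_mult[symmetric] exp_minus inverse_eq_divide)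
      also have "\<dots> \<le> exp (- L)" using K by simp
      finally show "(2 * \<epsilon>) ^ K \<le> 1 / real n" by (simp add: exp_minus expL inverse_eq_divide)
    qed (use \<epsilon> in auto)
    also have "\<dots> = (\<epsilon> ^ 4 / real n) * (16 / real n ^ 3)"
      by (simp add: power_mult_distrib power_divide eval_nat_numeral)
    also have "\<dots> \<le> (\<epsilon> ^ 4 / real n) * 1"
    proof (intro mult_left_mono)
      have "(3::real) ^ 3 \<le> real n ^ 3" using n3 by (intro power_mono) auto
      then show "16 / real n ^ 3 \<le> 1" using n_pos by (simp add: pos_divide_le_eq)
    qed auto
    finally show ?thesis by simp
  qed
  have "dev4 \<epsilon>
      \<le> (2187 * \<epsilon> ^ 4 + 216 * \<epsilon> ^ 4) / (c ^ 4 * real n) + 27 * (2 * \<epsilon>) ^ (4 * Suc K)"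
    using \<epsilon> K4 y y2 by (intro pow4_eigenvector) auto
  also have "\<dots> \<le> (2187 * \<epsilon> ^ 4 + 216 * \<epsilon> ^ 4) / (c ^ 4 * real n) + 27 * (\<epsilon> ^ 4 / (c ^ 4 * real n))"
  proof (intro add_left_mono mult_left_mono order.trans[OF tail] divide_left_mono)
    show "c ^ 4 * real n \<le> real n" using c by (simp add: power_le_one mult_left_le_one_le)
  qed (use c n_pos in auto)
  also have "\<dots> = 2430 * \<epsilon> ^ 4 / (c ^ 4 * real n)"
    by (simp add: add_divide_distrib[symmetric])
  finally show "dev4 \<epsilon> \<le> 2430 * \<epsilon> ^ 4 / (c ^ 4 * real n)" .
qed

text \<open>The Young parameter is \<open>\<epsilon>\<^sup>2\<close>, which balances
  \<open>\<epsilon> ^ 4 / \<kappa>\<close> against \<open>\<kappa>\<close>. The scaling cancels the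
  factor m/n of the variance bound and leaves order \<open>\<epsilon>\<^sup>2\<close>; 350000 rounds
  up \<open>2 * 36 * 4861\<close>.\<close>

lemma variance_remainder_scaled:
  assumes \<epsilon>: "0 < \<epsilon>" "\<epsilon> \<le> 1/6"
    and bad: "bad_prob \<epsilon> \<le> 1 / real n ^ 4"
    and Z: "dev4 \<epsilon> \<le> 2430 * \<epsilon> ^ 4 / (c ^ 4 * real n)"
  shows "2 * real n / (c ^ 6 * m) * (E (\<lambda>\<eta>. (remainder \<eta>)\<^sup>2) - (E remainder)\<^sup>2)
    \<le> 350000 * \<epsilon>\<^sup>2 / c ^ 10 + 64 / (c ^ 6 * real n ^ 3)"
proof -
  let ?N = "c ^ 4 * real n"
  have N: "?N > 0" using c n_pos by simp
  have pos: "0 < c ^ 6 * m" using c m by simp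
  have "(1 + 1 / \<epsilon>\<^sup>2) * (2430 * \<epsilon> ^ 4 / ?N) + \<epsilon>\<^sup>2 / ?N = \<epsilon>\<^sup>2 * (2430 * \<epsilon>\<^sup>2 + 2431) / ?N"
  proof -
    define x where "x = \<epsilon>\<^sup>2"
    define N where "N = ?N"
    have "x > 0" "N > 0" using \<epsilon> N by (simp_all add: x_def N_def)
    moreover have "\<epsilon> ^ 4 = x * x" by (simp add: x_def power4_eq_xxxx power2_eq_square)
    ultimately show ?thesis
      unfolding N_def[symmetric] x_def[symmetric] by (simp add: field_simps)
  qed
  also have "\<dots> \<le> \<epsilon>\<^sup>2 * 4861 / ?N"
  proof (intro divide_right_mono mult_left_mono)
    have "\<epsilon>\<^sup>2 \<le> 1" using \<epsilon> by (simp add: power_le_one)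
    then show "2430 * \<epsilon>\<^sup>2 + 2431 \<le> 4861" by simp
  qed (use N in auto)
  finally have A: "(1 + 1 / \<epsilon>\<^sup>2) * (2430 * \<epsilon> ^ 4 / ?N) + \<epsilon>\<^sup>2 / ?N \<le> \<epsilon>\<^sup>2 * 4861 / ?N" .
  have "E (\<lambda>\<eta>. (remainder \<eta>)\<^sup>2) - (E remainder)\<^sup>2
      \<le> 36 * m * ((1 + 1 / \<epsilon>\<^sup>2) * (2430 * \<epsilon> ^ 4 / ?N) + \<epsilon>\<^sup>2 / ?N) + 32 * bad_prob \<epsilon>"
    using \<epsilon> Z by (intro variance_remainder_le) auto
  also have "\<dots> \<le> 36 * m * (\<epsilon>\<^sup>2 * 4861 / ?N) + 32 * (1 / real n ^ 4)"
    using A bad m by (intro add_mono mult_left_mono) auto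
  finally have "2 * real n / (c ^ 6 * m) * (E (\<lambda>\<eta>. (remainder \<eta>)\<^sup>2) - (E remainder)\<^sup>2)
      \<le> 2 * real n / (c ^ 6 * m) * (36 * m * (\<epsilon>\<^sup>2 * 4861 / ?N) + 32 * (1 / real n ^ 4))"
    using pos by (intro mult_left_mono) auto
  also have "\<dots> = 349992 * \<epsilon>\<^sup>2 / c ^ 10 + 64 / (c ^ 6 * real n ^ 3) * (1 / m)"
    using c m n_pos by (simp add: field_simps eval_nat_numeral)
  also have "\<dots> \<le> 350000 * \<epsilon>\<^sup>2 / c ^ 10 + 64 / (c ^ 6 * real n ^ 3) * 1"
    using c m by (intro add_mono mult_left_mono divide_right_mono mult_right_mono) auto
  finally show ?thesis by simp
qed

end

section \<open>Asymptotics\<close>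

lemma real_distribution_centered_normal: "s > 0 \<Longrightarrow> real_distribution (centered_normal s)"
  unfolding centered_normal_def real_distribution_def real_distribution_axioms_def
  using prob_space_normal_density[of "sqrt s" 0] by simp

text \<open>Substituting \<open>sqrt s * x\<close> for the variable reduces the integral to the
  standard normal law.\<close>

lemma char_centered_normal:
  assumes "s > 0"
  shows "char (centered_normal s) t = of_real (exp (- (s * t\<^sup>2 / 2)))"
proof -
  let ?r = "sqrt s"
  have r: "?r > 0" using assms by simp
  have dens: "?r * normal_density 0 ?r (?r * x) = normal_density 0 1 x" for x
    using assms by (simp add: normal_density_def real_sqrt_mult power_mult_distrib)
  have "char (centered_normal s) t = (CLINT x|lborel. normal_density 0 ?r x *\<^sub>R iexp (t * x))"
    unfolding char_def centered_normal_def
    by (subst integral_density) (auto intro!: normal_density_nonneg)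
  also have "\<dots> = \<bar>?r\<bar> *\<^sub>R (CLINT x|lborel. normal_density 0 ?r (0 + ?r * x) *\<^sub>R iexp (t * (0 + ?r * x)))"
    using r by (intro lborel_integral_real_affine) auto
  also have "\<dots> = (CLINT x|lborel. \<bar>?r\<bar> *\<^sub>R (normal_density 0 ?r (0 + ?r * x) *\<^sub>R iexp (t * (0 + ?r * x))))"
    by (rule integral_scaleR_right[symmetric])
  also have "\<dots> = (CLINT x|lborel. normal_density 0 1 x *\<^sub>R iexp ((t * ?r) * x))"
    using r by (intro Bochner_Integration.integral_cong refl) (simp add: dens[symmetric] mult.assoc)
  also have "\<dots> = char std_normal_distribution (t * ?r)"
    unfolding char_def by (subst integral_density) (auto intro!: normal_density_nonneg)
  also have "\<dots> = of_real (exp (- (s * t\<^sup>2 / 2)))"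
    using assms by (simp add: char_std_normal_distribution power_mult_distrib mult.commute)
  finally show ?thesis .
qed

text \<open>The order of the limits: how large \<open>n\<close> must be depends on
  \<open>\<epsilon>\<close>, but the null sequence \<open>r\<close> and the constant
  \<open>C\<close> do not, so \<open>n\<close> goes to infinity first and \<open>\<epsilon>\<close>
  to 0 afterwards.\<close>

lemma tendsto_zero_of_epsilon:
  fixes f :: "nat \<Rightarrow> 'a::real_normed_vector" and r :: "nat \<Rightarrow> real"
  assumes "C \<ge> 0" and "r \<longlonglongrightarrow> 0"
    and bound: "\<And>\<epsilon>. 0 < \<epsilon> \<Longrightarrow> \<epsilon> \<le> 1/6 \<Longrightarrow> eventually (\<lambda>n. norm (f n) \<le> C * \<epsilon> + r n) sequentially"
  shows "f \<longlonglongrightarrow> 0"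
  unfolding tendsto_iff dist_0_norm dist_norm diff_zero
proof (intro allI impI)
  fix e :: real assume "e > 0"
  define \<epsilon> where "\<epsilon> = min (1/6) (e / 2 / (C + 1))"
  have \<epsilon>: "0 < \<epsilon>" "\<epsilon> \<le> 1/6"
    using \<open>e > 0\<close> \<open>C \<ge> 0\<close> unfolding \<epsilon>_def by (simp, intro min.cobounded1)
  have "C * \<epsilon> \<le> (C + 1) * (e / 2 / (C + 1))"
    using \<epsilon> \<open>C \<ge> 0\<close> by (intro mult_mono) (auto simp: \<epsilon>_def)
  also have "\<dots> = e / 2" using \<open>C \<ge> 0\<close> by (simp add: field_simps)
  finally have C: "C * \<epsilon> \<le> e / 2" .
  have "eventually (\<lambda>n. r n < e / 2) sequentially"
    using \<open>r \<longlonglongrightarrow> 0\<close> \<open>e > 0\<close> by (intro order_tendstoD) auto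
  with bound[OF \<epsilon>] show "eventually (\<lambda>n. norm (f n) < e) sequentially"
    by eventually_elim (use C in linarith)
qed

context chung_lu_bounds
begin

lemma expected_lambda1_bound:
  assumes "0 < \<epsilon>" "\<epsilon> \<le> 1/6" and bad: "bad_prob \<epsilon> \<le> 1 / real n ^ 4"
  shows "\<bar>expected_lambda1 n d - (deg_sum 2 n d / deg_sum 1 n d
      + deg_sum 1 n d * deg_sum 3 n d / (deg_sum 2 n d)\<^sup>2)\<bar>
    \<le> 7 * (1 + 1 / c) * \<epsilon> + (5 / c * (1 / (real n)\<^sup>2) + 1 / c\<^sup>2 * (m / real n))"
proof -
  have "5 * (real n)\<^sup>2 / c * bad_prob \<epsilon> \<le> 5 * (real n)\<^sup>2 / c * (1 / real n ^ 4)"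
    using bad c by (intro mult_left_mono) auto
  also have "\<dots> = 5 / c * (1 / (real n)\<^sup>2)"
    using n_pos by (simp add: field_simps eval_nat_numeral)
  finally have "5 * (real n)\<^sup>2 / c * bad_prob \<epsilon> \<le> 5 / c * (1 / (real n)\<^sup>2)" .
  moreover have "q / c = 1 / c\<^sup>2 * (m / real n)"
    by (simp add: q_def power2_eq_square)
  moreover have "7 * \<epsilon> * (1 + 1 / c) = 7 * (1 + 1 / c) * \<epsilon>" by simp
  ultimately show ?thesis
    using E_lambda1_expansion[of \<epsilon>] assms(1,2) unfolding expected_lambda1_eq by linarith
qed

lemma char_stat_bound':
  assumes \<epsilon>: "0 < \<epsilon>" "\<epsilon> \<le> 1/6" and bad: "bad_prob \<epsilon> \<le> 1 / real n ^ 4"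
    and Z: "dev4 \<epsilon> \<le> 2430 * \<epsilon> ^ 4 / (c ^ 4 * real n)"
  shows "cmod (char (distr (measure_pmf (chung_lu n d)) borel stat) t - of_real (exp (- (t\<^sup>2))))
    \<le> 600 * \<bar>t\<bar> / c ^ 5 * \<epsilon> + (\<bar>t\<bar> * (8 / c ^ 3 * sqrt (1 / real n))
      + (2 * t\<^sup>2 * (\<bar>t\<bar> * (3 / c ^ 4 * sqrt (1 / real n)) + t\<^sup>2 * (8 / c ^ 8 * (1 / real n)))
      + t\<^sup>2 / c ^ 9 * (1 / real n)))"
proof -
  \<comment> \<open>The constants come from \<open>600\<^sup>2 \<ge> 350000\<close> and
    \<open>8\<^sup>2 = 64\<close>; the square of the sum then dominates the scaled variance. The 3
    in the bound on \<open>2 * q / \<sigma>\<close> likewise exceeds \<open>sqrt 8\<close>.\<close>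
  define W where "W = 600 * \<epsilon> / c ^ 5 + 8 / c ^ 3 * sqrt (1 / real n)"
  have W: "W \<ge> 0" using \<epsilon> c by (simp add: W_def)
  have "350000 * \<epsilon>\<^sup>2 / c ^ 10 + 64 / (c ^ 6 * real n ^ 3) \<le> (600 * \<epsilon> / c ^ 5)\<^sup>2 + (8 / c ^ 3 * sqrt (1 / real n))\<^sup>2"
  proof (rule add_mono)
    have "(600 * \<epsilon> / c ^ 5)\<^sup>2 = 360000 * \<epsilon>\<^sup>2 / c ^ 10"
      by (simp add: power_divide power_mult_distrib flip: power_mult)
    then show "350000 * \<epsilon>\<^sup>2 / c ^ 10 \<le> (600 * \<epsilon> / c ^ 5)\<^sup>2"
      using c by (simp add: divide_right_mono)
    have "(8 / c ^ 3 * sqrt (1 / real n))\<^sup>2 = (8 / c ^ 3)\<^sup>2 * (sqrt (1 / real n))\<^sup>2"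
      by (rule power_mult_distrib)
    also have "\<dots> = 64 / (c ^ 6 * real n)"
      by (simp add: power_divide flip: power_mult)
    finally have "(8 / c ^ 3 * sqrt (1 / real n))\<^sup>2 = 64 / (c ^ 6 * real n)" .
    moreover have "64 / (c ^ 6 * real n ^ 3) \<le> 64 / (c ^ 6 * real n ^ 1)"
      using c n_pos by (intro divide_left_mono mult_left_mono power_increasing mult_pos_pos) auto
    ultimately show "64 / (c ^ 6 * real n ^ 3) \<le> (8 / c ^ 3 * sqrt (1 / real n))\<^sup>2" by simp
  qed
  also have "\<dots> \<le> W\<^sup>2"
    unfolding W_def power2_sum using \<epsilon> c by simp
  finally have var: "2 * real n / (c ^ 6 * m) * (E (\<lambda>\<eta>. (remainder \<eta>)\<^sup>2) - (E remainder)\<^sup>2) \<le> W\<^sup>2"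
    using variance_remainder_scaled[OF \<epsilon> bad Z] by linarith
  have q\<sigma>: "0 \<le> 2 * q / \<sigma>" using q_bounds \<sigma>_pos by simp
  have "2 * q / \<sigma> \<le> 3 / c ^ 4 * sqrt (1 / real n)"
  proof (rule power2_le_imp_le)
    have "(3 / c ^ 4 * sqrt (1 / real n))\<^sup>2 = (3 / c ^ 4)\<^sup>2 * (sqrt (1 / real n))\<^sup>2"
      by (rule power_mult_distrib)
    also have "\<dots> = 9 / (c ^ 8 * real n)"
      by (simp add: power_divide flip: power_mult)
    finally have "(3 / c ^ 4 * sqrt (1 / real n))\<^sup>2 = 9 / (c ^ 8 * real n)" .
    moreover have "8 / (c ^ 8 * real n) \<le> 9 / (c ^ 8 * real n)" using c by (simp add: divide_right_mono)
    ultimately show "(2 * q / \<sigma>)\<^sup>2 \<le> (3 / c ^ 4 * sqrt (1 / real n))\<^sup>2"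
      using coef_sq_bound by linarith
  qed (use c in simp)
  moreover have "(2 * q / \<sigma>)\<^sup>2 \<le> 8 / c ^ 8 * (1 / real n)"
    using coef_sq_bound by simp
  ultimately have "2 * t\<^sup>2 * (\<bar>t\<bar> * (2 * q / \<sigma>) + t\<^sup>2 * (2 * q / \<sigma>)\<^sup>2)
      \<le> 2 * t\<^sup>2 * (\<bar>t\<bar> * (3 / c ^ 4 * sqrt (1 / real n)) + t\<^sup>2 * (8 / c ^ 8 * (1 / real n)))"
    by (intro mult_left_mono add_mono) auto
  moreover have "\<bar>t\<bar> * W = 600 * \<bar>t\<bar> / c ^ 5 * \<epsilon> + \<bar>t\<bar> * (8 / c ^ 3 * sqrt (1 / real n))"
    by (simp add: W_def distrib_left)
  moreover have "t\<^sup>2 / (c ^ 9 * real n) = t\<^sup>2 / c ^ 9 * (1 / real n)"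
    by simp
  moreover have char_eq: "char (distr (measure_pmf (chung_lu n d)) borel stat) t = E (\<lambda>\<eta>. iexp (t * stat \<eta>))"
    unfolding char_def chung_lu_eq by (subst integral_distr) auto
  ultimately show ?thesis
    using char_stat_bound[OF var W, of t] unfolding char_eq by linarith
qed

lemma \<sigma>_sq_ratio: "\<bar>\<sigma>\<^sup>2 / ((deg_sum 3 n d)\<^sup>2 / (deg_sum 1 n d) ^ 3) - 1\<bar> \<le> 1 / c * (m / real n)"
proof -
  let ?T = "(deg_sum 3 n d)\<^sup>2 / (deg_sum 1 n d) ^ 3"
  have T: "?T > 0" using deg_sum_pos[of 3] deg_sum_pos[of 1] by simp
  have "\<sigma>\<^sup>2 / ?T \<le> 1" using \<sigma>_sq_bounds(1) T by (simp only: pos_divide_le_eq mult_1_left)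
  moreover have "1 - q \<le> \<sigma>\<^sup>2 / ?T" using \<sigma>_sq_bounds(2) T by (simp only: pos_le_divide_eq)
  moreover have "q = 1 / c * (m / real n)" by (simp add: q_def)
  ultimately show ?thesis by (simp only: abs_le_iff) linarith
qed

end

text \<open>The locale is entered with \<open>m\<close> the maximal degree and \<open>c\<close> the
  constant from the lower half of (D2), capped at 1; positivity of the degrees gives
  \<open>m \<ge> 1\<close>. The two limits are the form in which (D1) enters the estimates.\<close>

lemma chung_lu_regularity:
  assumes pos: "\<And>n i. i < n \<Longrightarrow> d n i > 0"
    and D1: "\<exists>\<xi>::real. \<xi> > 2 \<and>
               (\<lambda>n. ln (real n) powr (2 * \<xi>)) \<in> o(\<lambda>n. deg_max n (d n)) \<and>
               (\<lambda>n. deg_max n (d n)) \<in> o(\<lambda>n. real n powr (1 / 2))"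
    and D2: "(\<lambda>n. deg_min n (d n)) \<in> \<Theta>(\<lambda>n. deg_max n (d n))"
  obtains c where "0 < c" "c \<le> 1"
    "eventually (\<lambda>n. chung_lu_bounds n (d n) c (deg_max n (d n))) sequentially"
    "(\<lambda>n. ln (real n) / deg_max n (d n)) \<longlonglongrightarrow> 0"
    "(\<lambda>n. deg_max n (d n) / real n) \<longlonglongrightarrow> 0"
proof -
  let ?M = "\<lambda>n. deg_max n (d n)"
  obtain \<xi> :: real where \<xi>: "\<xi> > 2" and ln_small: "(\<lambda>n. ln (real n) powr (2 * \<xi>)) \<in> o(?M)"
    and M_small: "?M \<in> o(\<lambda>n. real n powr (1 / 2))"
    using D1 by blast
  have "(\<lambda>n. deg_min n (d n)) \<in> \<Omega>(?M)" using D2 by (rule bigthetaD2)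
  then obtain c0 where c0: "c0 > 0"
    "eventually (\<lambda>n. norm (deg_min n (d n)) \<ge> c0 * norm (?M n)) sequentially"
    by (rule landau_omega.bigE)
  define c where "c = min c0 1"
  have c: "0 < c" "c \<le> 1" using c0 by (auto simp: c_def)
  have M0: "?M n \<ge> 0" for n by (simp add: deg_max_def)
  have d_le: "real (d n i) \<le> ?M n" if "i < n" for n i
    using that by (simp add: deg_max_def)
  have d_ge: "deg_min n (d n) \<le> real (d n i)" if "i < n" for n i
    using that by (simp add: deg_min_def)
  have M1: "?M n \<ge> 1" if "n > 0" for n
    using d_le[OF that] pos[OF that] by linarith
  have L: "(\<lambda>n. ln (real n) / ?M n) \<longlonglongrightarrow> 0"
  proof (rule tendsto_sandwich[OF _ _ tendsto_const smalloD_tendsto[OF ln_small]])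
    show "eventually (\<lambda>n. 0 \<le> ln (real n) / ?M n) sequentially"
      using eventually_gt_at_top[of 0] by eventually_elim (use M0 in simp)
    show "eventually (\<lambda>n. ln (real n) / ?M n \<le> ln (real n) powr (2 * \<xi>) / ?M n) sequentially"
      using eventually_ge_at_top[of 3]
    proof eventually_elim
      case (elim n)
      have "exp 1 \<le> real n" using exp_le elim by linarith
      then have "1 \<le> ln (real n)" using elim by (simp add: ln_ge_iff)
      \<comment> \<open>From \<open>n = 3\<close> on the logarithm is at least 1, so raising the
        exponent only increases the power.\<close>
      then have "ln (real n) powr 1 \<le> ln (real n) powr (2 * \<xi>)" using \<xi> by (intro powr_mono) auto
      then show ?case using M0 \<open>1 \<le> ln (real n)\<close> by (intro divide_right_mono) auto
    qed
  qed
  have Mn: "(\<lambda>n. ?M n / real n) \<longlonglongrightarrow> 0"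
  proof (rule tendsto_sandwich[OF _ _ tendsto_const smalloD_tendsto[OF M_small]])
    show "eventually (\<lambda>n. 0 \<le> ?M n / real n) sequentially" using M0 by simp
    show "eventually (\<lambda>n. ?M n / real n \<le> ?M n / real n powr (1 / 2)) sequentially"
      using eventually_gt_at_top[of 0]
    proof eventually_elim
      case (elim n)
      have "real n powr (1 / 2) \<le> real n powr 1" using elim by (intro powr_mono) auto
      then show ?case using elim M0 by (intro divide_left_mono mult_pos_pos) auto
    qed
  qed
  have "eventually (\<lambda>n. ?M n / real n < c / 2) sequentially"
    using Mn c by (intro order_tendstoD) auto
  then have ev: "eventually (\<lambda>n. chung_lu_bounds n (d n) c (?M n)) sequentially"
    using c0(2) eventually_gt_at_top[of 0]
  proof eventually_elim
    case (elim n)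
    have "c * ?M n \<le> c0 * ?M n" using M0 by (intro mult_right_mono) (auto simp: c_def)
    also have "\<dots> \<le> deg_min n (d n)" using elim(2) M0[of n] by (simp add: deg_min_def)
    finally have "c * ?M n \<le> real (d n i)" if "i < n" for i using d_ge[OF that] by linarith
    moreover have "?M n \<le> c * real n / 2" using elim by (simp add: field_simps)
    ultimately show ?case
      using elim c M1[of n] d_le by unfold_locales auto
  qed
  show ?thesis by (rule that[OF c ev L Mn])
qed

text \<open>Merges the conditions on \<open>\<delta>\<close> into one threshold that depends on
  \<open>c\<close> and \<open>\<epsilon>\<close> only. The constant 182 is the least integer whose
  square is at least 32768.\<close>

lemma (in chung_lu_bounds) scale_threshold:
  assumes "0 < \<epsilon>" "\<epsilon> \<le> 1/6" "n \<ge> 3"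
    and "ln (real n) / m < min (1/8) (min (c ^ 3 * \<epsilon>\<^sup>2 / 182) (exp (-6) * (c ^ 3 * \<epsilon>\<^sup>2) / 16))"
  shows "bad_prob \<epsilon> \<le> 1 / real n ^ 4"
    and "dev4 \<epsilon> \<le> 2430 * \<epsilon> ^ 4 / (c ^ 4 * real n)"
proof -
  define \<delta> where "\<delta> = ln (real n) / m"
  have \<delta>0: "0 \<le> \<delta>" using n_pos m by (simp add: \<delta>_def)
  have \<delta>1: "ln (real n) \<le> \<delta> * m" using m by (simp add: \<delta>_def)
  have \<delta>2: "\<delta> \<le> 1/8" "\<delta> \<le> c ^ 3 * \<epsilon>\<^sup>2 / 182" "16 * \<delta> \<le> exp (-6) * (c ^ 3 * \<epsilon>\<^sup>2)"
    using assms(4) unfolding \<delta>_def[symmetric] by simp_all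
  have "(182 * \<delta>)\<^sup>2 \<le> (c ^ 3 * \<epsilon>\<^sup>2)\<^sup>2" using \<delta>2(2) \<delta>0 by (intro power_mono) auto
  then have "33124 * \<delta>\<^sup>2 \<le> c ^ 6 * \<epsilon> ^ 4" by (simp add: power_mult_distrib flip: power_mult)
  moreover have "0 \<le> \<delta>\<^sup>2" by simp
  ultimately have \<delta>3: "32768 * \<delta>\<^sup>2 \<le> c ^ 6 * \<epsilon> ^ 4" by linarith
  note * = scale_choice[OF assms(1-3) \<delta>1 \<delta>2(1) \<delta>3 \<delta>2(3)]
  show "bad_prob \<epsilon> \<le> 1 / real n ^ 4" by (rule *(1))
  show "dev4 \<epsilon> \<le> 2430 * \<epsilon> ^ 4 / (c ^ 4 * real n)"
    by (rule *(2))
qed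

theorem theorem1p5:
  fixes d :: "nat \<Rightarrow> nat \<Rightarrow> nat"
  assumes pos: "\<And>n i. i < n \<Longrightarrow> d n i > 0"
    and D1: "\<exists>\<xi>::real. \<xi> > 2 \<and>
               (\<lambda>n. ln (real n) powr (2 * \<xi>)) \<in> o(\<lambda>n. deg_max n (d n)) \<and>
               (\<lambda>n. deg_max n (d n)) \<in> o(\<lambda>n. real n powr (1 / 2))"
    and D2: "(\<lambda>n. deg_min n (d n)) \<in> \<Theta>(\<lambda>n. deg_max n (d n))"
  shows "(\<lambda>n. expected_lambda1 n (d n)
              - (deg_sum 2 n (d n) / deg_sum 1 n (d n)
                 + deg_sum 1 n (d n) * deg_sum 3 n (d n) / (deg_sum 2 n (d n))\<^sup>2))
           \<in> o(\<lambda>_. 1)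
       \<and> weak_conv_m
           (\<lambda>n. distr (measure_pmf (chung_lu n (d n))) borel
                  (\<lambda>E. deg_sum 2 n (d n) / deg_sum 1 n (d n)
                        * ((lambda1 n E - expected_lambda1 n (d n)) / sigma1 n (d n))))
           (centered_normal 2)
       \<and> (\<lambda>n. (sigma1 n (d n))\<^sup>2) \<sim>[sequentially]
           (\<lambda>n. (deg_sum 3 n (d n))\<^sup>2 / (deg_sum 1 n (d n)) ^ 3)"
proof -
  let ?M = "\<lambda>n. deg_max n (d n)"
  obtain c where c: "0 < c" "c \<le> 1"
    and ev: "eventually (\<lambda>n. chung_lu_bounds n (d n) c (?M n)) sequentially"
    and L: "(\<lambda>n. ln (real n) / ?M n) \<longlonglongrightarrow> 0" and Mn: "(\<lambda>n. ?M n / real n) \<longlonglongrightarrow> 0"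
    using chung_lu_regularity[OF pos D1 D2] by blast
  have inv: "(\<lambda>n. 1 / real n) \<longlonglongrightarrow> 0" by (rule lim_1_over_n)
  have sqrt_inv: "(\<lambda>n. sqrt (1 / real n)) \<longlonglongrightarrow> 0"
    using tendsto_real_sqrt[OF inv] by simp
  have sq_inv: "(\<lambda>n. 1 / (real n)\<^sup>2) \<longlonglongrightarrow> 0"
    using tendsto_power[OF inv, of 2] by (simp add: power_divide)
  define \<delta> where "\<delta> = (\<lambda>\<epsilon>. min (1/8) (min (c ^ 3 * \<epsilon>\<^sup>2 / 182) (exp (-6) * (c ^ 3 * \<epsilon>\<^sup>2) / 16)))"
  have small: "eventually (\<lambda>n. chung_lu_bounds n (d n) c (?M n) \<and> n \<ge> 3 \<and> ln (real n) / ?M n < \<delta> \<epsilon>) sequentially"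
    if "0 < \<epsilon>" for \<epsilon>
  proof -
    have "\<delta> \<epsilon> > 0" using that c by (simp add: \<delta>_def)
    then have "eventually (\<lambda>n. ln (real n) / ?M n < \<delta> \<epsilon>) sequentially"
      using L by (intro order_tendstoD)
    with ev eventually_ge_at_top[of 3] show ?thesis by eventually_elim auto
  qed
  let ?stat = "\<lambda>n E. deg_sum 2 n (d n) / deg_sum 1 n (d n)
                        * ((lambda1 n E - expected_lambda1 n (d n)) / sigma1 n (d n))"
  have "(\<lambda>n. expected_lambda1 n (d n) - (deg_sum 2 n (d n) / deg_sum 1 n (d n)
      + deg_sum 1 n (d n) * deg_sum 3 n (d n) / (deg_sum 2 n (d n))\<^sup>2)) \<longlonglongrightarrow> 0"
  proof (rule tendsto_zero_of_epsilon)
    show "0 \<le> 7 * (1 + 1 / c)" using c by simp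
    have "(\<lambda>n. 5 / c * (1 / (real n)\<^sup>2) + 1 / c\<^sup>2 * (?M n / real n)) \<longlonglongrightarrow> 5 / c * 0 + 1 / c\<^sup>2 * 0"
      by (intro tendsto_intros sq_inv Mn)
    then show "(\<lambda>n. 5 / c * (1 / (real n)\<^sup>2) + 1 / c\<^sup>2 * (?M n / real n)) \<longlonglongrightarrow> 0" by simp
    fix \<epsilon> :: real assume \<epsilon>: "0 < \<epsilon>" "\<epsilon> \<le> 1/6"
    show "eventually (\<lambda>n. norm (expected_lambda1 n (d n) - (deg_sum 2 n (d n) / deg_sum 1 n (d n)
        + deg_sum 1 n (d n) * deg_sum 3 n (d n) / (deg_sum 2 n (d n))\<^sup>2))
      \<le> 7 * (1 + 1 / c) * \<epsilon> + (5 / c * (1 / (real n)\<^sup>2) + 1 / c\<^sup>2 * (?M n / real n))) sequentially"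
      using small[OF \<epsilon>(1)]
    proof eventually_elim
      case (elim n)
      then interpret chung_lu_bounds n "d n" c "?M n" by blast
      show ?case
        unfolding real_norm_def using elim \<epsilon>
        by (intro expected_lambda1_bound scale_threshold) (auto simp: \<delta>_def)
    qed
  qed
  then have I: "(\<lambda>n. expected_lambda1 n (d n) - (deg_sum 2 n (d n) / deg_sum 1 n (d n)
      + deg_sum 1 n (d n) * deg_sum 3 n (d n) / (deg_sum 2 n (d n))\<^sup>2)) \<in> o(\<lambda>_. 1)"
    by (intro smalloI_tendsto) auto
  have II: "weak_conv_m (\<lambda>n. distr (measure_pmf (chung_lu n (d n))) borel (?stat n)) (centered_normal 2)"
  proof (rule levy_continuity)
    \<comment> \<open>Needed for every \<open>n\<close>, also for small ones outside the locale:
      \<open>chung_lu\<close> is a \<open>pmf\<close> for any degree sequence.\<close>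
    show "real_distribution (distr (measure_pmf (chung_lu n (d n))) borel (?stat n))" for n
      unfolding real_distribution_def real_distribution_axioms_def
      by (simp add: measure_pmf.prob_space_distr)
    show "real_distribution (centered_normal 2)"
      by (rule real_distribution_centered_normal) simp
    fix t :: real
    have "(\<lambda>n. char (distr (measure_pmf (chung_lu n (d n))) borel (?stat n)) t - of_real (exp (- (t\<^sup>2)))) \<longlonglongrightarrow> 0"
    proof (rule tendsto_zero_of_epsilon)
      let ?r = "\<lambda>n. \<bar>t\<bar> * (8 / c ^ 3 * sqrt (1 / real n))
        + (2 * t\<^sup>2 * (\<bar>t\<bar> * (3 / c ^ 4 * sqrt (1 / real n)) + t\<^sup>2 * (8 / c ^ 8 * (1 / real n)))
        + t\<^sup>2 / c ^ 9 * (1 / real n))"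
      show "0 \<le> 600 * \<bar>t\<bar> / c ^ 5" using c by simp
      have "?r \<longlonglongrightarrow> \<bar>t\<bar> * (8 / c ^ 3 * 0)
        + (2 * t\<^sup>2 * (\<bar>t\<bar> * (3 / c ^ 4 * 0) + t\<^sup>2 * (8 / c ^ 8 * 0)) + t\<^sup>2 / c ^ 9 * 0)"
        by (intro tendsto_add tendsto_mult tendsto_const sqrt_inv inv)
      then show "?r \<longlonglongrightarrow> 0" by simp
      fix \<epsilon> :: real assume \<epsilon>: "0 < \<epsilon>" "\<epsilon> \<le> 1/6"
      show "eventually (\<lambda>n. norm (char (distr (measure_pmf (chung_lu n (d n))) borel (?stat n)) t
          - of_real (exp (- (t\<^sup>2)))) \<le> 600 * \<bar>t\<bar> / c ^ 5 * \<epsilon> + ?r n) sequentially"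
        using small[OF \<epsilon>(1)]
      proof eventually_elim
        case (elim n)
        then interpret chung_lu_bounds n "d n" c "?M n" by blast
        have "n \<ge> 3" "ln (real n) / ?M n < min (1/8) (min (c ^ 3 * \<epsilon>\<^sup>2 / 182) (exp (-6) * (c ^ 3 * \<epsilon>\<^sup>2) / 16))"
          using elim by (simp_all add: \<delta>_def)
        note s = scale_threshold[OF \<epsilon> this]
        show ?case
          using char_stat_bound'[OF \<epsilon> s] unfolding stat_def[abs_def] .
      qed
    qed
    then show "(\<lambda>n. char (distr (measure_pmf (chung_lu n (d n))) borel (?stat n)) t)
        \<longlonglongrightarrow> char (centered_normal 2) t"
      by (subst char_centered_normal) (auto intro: LIM_zero_cancel)
  qed
  have "(\<lambda>n. (sigma1 n (d n))\<^sup>2 / ((deg_sum 3 n (d n))\<^sup>2 / (deg_sum 1 n (d n)) ^ 3) - 1) \<longlonglongrightarrow> 0"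
  proof (rule Lim_null_comparison)
    show "eventually (\<lambda>n. norm ((sigma1 n (d n))\<^sup>2 / ((deg_sum 3 n (d n))\<^sup>2 / (deg_sum 1 n (d n)) ^ 3) - 1)
        \<le> 1 / c * (?M n / real n)) sequentially"
      using ev
    proof eventually_elim
      case (elim n)
      then interpret chung_lu_bounds n "d n" c "?M n" by blast
      show ?case using \<sigma>_sq_ratio by (simp only: real_norm_def \<sigma>_def)
    qed
    show "(\<lambda>n. 1 / c * (?M n / real n)) \<longlonglongrightarrow> 0"
      using tendsto_mult[OF tendsto_const Mn, of "1 / c"] by simp
  qed
  then have III: "(\<lambda>n. (sigma1 n (d n))\<^sup>2) \<sim>[sequentially]
      (\<lambda>n. (deg_sum 3 n (d n))\<^sup>2 / (deg_sum 1 n (d n)) ^ 3)"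
    by (intro asymp_equivI') (rule LIM_zero_cancel)
  from I II III show ?thesis by blast
qed

end
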